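(* Let $M$ be a smooth $n$-dimensional manifold, $\Phi\to M$ a smooth fibre bundle, $l\ge1$, and let $F=F^\lambda\,\partial_\lambda\lrcorner\, d^nx$ be a $\Lambda^{n-1}M$-valued function on $J^{l-1}\Phi$. Let $\mathcal{L}_0=L_0\,d^nx:=\mathrm{d}F=(\partial_\lambda F^\lambda)\,d^nx$ be the $l$-th order Lagrangian density given by the total divergence of $F$. Then to any section $f$ of $\Phi$ there corresponds biuniquely a section $$\sigma_f=\left(j^{l-1}(f),\,p\right)$$ of the phase bundle $\mathcal{P}=V^*(J^{l-1}\Phi)\otimes\Lambda^{n-1}M$ which is a solution of the (first-order) Euler--Lagrange equations generated by $\mathcal{L}_0$; its momenta are unambiguously determined by $$p^{\mu_1\dots\mu_m\lambda}=\frac{\partial F^\lambda}{\partial\varphi_{\mu_1\dots\mu_m}},\qquad 0\le m\le l-1,$$ evaluated along $j^{l-1}(f)$. That is, for every section $f$ the section $\sigma_f$ with these momenta solves the equations, and the correspondence $f\leftrightarrow\sigma_f$ is one-to-one.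
   Context: $\Lambda^iM:=\bigwedge^iT^*M$; $V^*B$ is the dual of the vertical tangent bundle of $B\to M$; $\delta$ is the vertical differential (exterior derivative along fibres over $M$). Coordinates on $\Phi$: $(x^\mu,\varphi)$, field index suppressed; on $J^{m}\Phi$: $\varphi_{\mu_1\dots\mu_i}$, $0\le i\le m$, symmetric in the indices. $\partial_\lambda F^\lambda$ is the total divergence, $\partial_\lambda F^\lambda=\frac{\partial F^\lambda}{\partial x^\lambda}+\sum_{m=0}^{l-1}\frac{\partial F^\lambda}{\partial\varphi_{\mu_1\dots\mu_m}}\varphi_{\mu_1\dots\mu_m\lambda}$. Partial derivatives with respect to symmetric jet coordinates are the totally symmetric coefficients for which $\delta G=\sum_m\frac{\partial G}{\partial\varphi_{\mu_1\dots\mu_m}}\delta\varphi_{\mu_1\dots\mu_m}$ (sum over all index values). A point of $\mathcal{P}$ is $p=\sum_{m=0}^{l-1}p^{\mu_1\dots\mu_m\lambda}\,\delta\varphi_{\mu_1\dots\mu_m}\otimes(\partial_\lambda\lrcorner\, d^nx)$, with $p^{\mu_1\dots\mu_m\lambda}$ symmetric in $\mu_1,\dots,\mu_m$ only. For an $l$-th order Lagrangian density $\mathcal{L}=L\,d^nx$ on $J^l\Phi$, a section $\sigma$ of $\mathcal{P}\to M$ is a solution of the Euler--Lagrange equations generated by $\mathcal{L}$ if its $J^{l-1}\Phi$-component is $j^{l-1}f$ for a section $f$ of $\Phi$ and, along $j^lf$, $$p^{(\mu_1\dots\mu_l)}=\frac{\partial L}{\partial\varphi_{\mu_1\dots\mu_l}},\qquad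 p^{(\mu_1\dots\mu_m)}=\frac{\partial L}{\partial\varphi_{\mu_1\dots\mu_m}}-\partial_\lambda p^{\mu_1\dots\mu_m\lambda}\ \ (1\le m\le l-1),\qquad 0=\frac{\partial L}{\partial\varphi}-\partial_\lambda p^\lambda,$$ where $(\ )$ denotes total symmetrisation of the indices. *)

theory Defs
  imports "HOL-Analysis.Analysis" "HOL-Combinatorics.Combinatorics"
begin

section \<open>Smooth manifolds\<close>

text \<open>
  A manifold is a whole type of class \<open>t2_space\<close> and \<open>second_countable_topology\<close>
  with a smooth atlas; a chart is a pair of a domain and a coordinate map, whose values off the
  domain are irrelevant.
\<close>

primrec Ck_on :: "nat \<Rightarrow> 'a::real_normed_vector set \<Rightarrow> ('a \<Rightarrow> 'b::real_normed_vector) \<Rightarrow> bool" where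
  "Ck_on 0 S f \<longleftrightarrow> continuous_on S f"
| "Ck_on (Suc r) S f \<longleftrightarrow>
     f differentiable_on S \<and> (\<forall>v. Ck_on r S (\<lambda>x. frechet_derivative f (at x) v))"

text \<open>Only meant for open \<open>S\<close>.\<close>

definition smooth_on :: "'a::real_normed_vector set \<Rightarrow> ('a \<Rightarrow> 'b::real_normed_vector) \<Rightarrow> bool" where
  "smooth_on S f \<longleftrightarrow> (\<forall>r. Ck_on r S f)"

type_synonym ('p, 'v) chart = "'p set \<times> ('p \<Rightarrow> 'v)"

definition is_chart :: "('p::topological_space, 'v::euclidean_space) chart \<Rightarrow> bool" where
  "is_chart c \<longleftrightarrow> open (fst c) \<and> open (snd c ` fst c) \<and>
     (\<exists>g. homeomorphism (fst c) (snd c ` fst c) (snd c) g)"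

definition chart_inv :: "('p, 'v) chart \<Rightarrow> 'v \<Rightarrow> 'p" where
  "chart_inv c = inv_into (fst c) (snd c)"

definition compatible :: "('p, 'v::euclidean_space) chart \<Rightarrow> ('p, 'v) chart \<Rightarrow> bool" where
  "compatible c d \<longleftrightarrow>
     smooth_on (snd c ` (fst c \<inter> fst d)) (snd d \<circ> chart_inv c) \<and>
     smooth_on (snd d ` (fst c \<inter> fst d)) (snd c \<circ> chart_inv d)"

definition smooth_atlas :: "('p::topological_space, 'v::euclidean_space) chart set \<Rightarrow> bool" where
  "smooth_atlas A \<longleftrightarrow> (\<forall>c\<in>A. is_chart c) \<and> (\<forall>c\<in>A. \<forall>d\<in>A. compatible c d) \<and> \<Union> (fst ` A) = UNIV"

definition max_atlas ::
  "('p::topological_space, 'v::euclidean_space) chart set \<Rightarrow> ('p, 'v) chart set" where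
  "max_atlas A = {c. is_chart c \<and> (\<forall>d\<in>A. compatible c d)}"

definition smooth_map_on ::
  "('p::topological_space, 'v::euclidean_space) chart set \<Rightarrow> 'p set \<Rightarrow>
   ('r::topological_space, 'w::euclidean_space) chart set \<Rightarrow> ('p \<Rightarrow> 'r) \<Rightarrow> bool" where
  "smooth_map_on A S B g \<longleftrightarrow> continuous_on S g \<and>
     (\<forall>c\<in>max_atlas A. \<forall>d\<in>max_atlas B.
        smooth_on (snd c ` (fst c \<inter> S \<inter> g -` fst d)) (snd d \<circ> g \<circ> chart_inv c))"

definition prod_atlas ::
  "('p, 'v) chart set \<Rightarrow> ('r, 'w) chart set \<Rightarrow> ('p \<times> 'r, 'v \<times> 'w) chart set" where
  "prod_atlas A C = {(fst c \<times> fst d, map_prod (snd c) (snd d)) | c d. c \<in> A \<and> d \<in> C}"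

text \<open>
  A tangent vector at \<open>x\<close> is the velocity of a curve through \<open>x\<close>, recorded by its components
  in all charts around \<open>x\<close> at once (and \<open>0\<close> in all other arguments), so that its vector space
  operations are the pointwise ones.
\<close>

type_synonym ('p, 'v) tvec = "('p, 'v) chart \<Rightarrow> 'v"

definition tangent_space ::
  "('p::topological_space, 'v::euclidean_space) chart set \<Rightarrow> 'p \<Rightarrow> ('p, 'v) tvec set" where
  "tangent_space A x = {v. \<exists>\<gamma>::real \<Rightarrow> 'p. \<gamma> 0 = x \<and>
     (\<forall>c\<in>max_atlas A. x \<in> fst c \<longrightarrow>
        (\<forall>\<^sub>F t in at 0. \<gamma> t \<in> fst c) \<and> (snd c \<circ> \<gamma>) differentiable (at 0)) \<and>
     v = (\<lambda>c. if c \<in> max_atlas A \<and> x \<in> fst c then vector_derivative (snd c \<circ> \<gamma>) (at 0) else 0)}"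

type_synonym ('p, 'v) form = "('p, 'v) tvec list \<Rightarrow> real"

text \<open>\<open>forms_at A i x\<close> is the \<open>i\<close>-th exterior power of the cotangent space at \<open>x\<close>.\<close>

definition forms_at ::
  "('p::topological_space, 'v::euclidean_space) chart set \<Rightarrow> nat \<Rightarrow> 'p \<Rightarrow> ('p, 'v) form set" where
  "forms_at A i x = {\<omega>.
     (\<forall>vs. \<not> (length vs = i \<and> set vs \<subseteq> tangent_space A x) \<longrightarrow> \<omega> vs = 0) \<and>
     (\<forall>vs j v w a b. length vs = i \<and> set vs \<subseteq> tangent_space A x \<and> j < i \<and>
        v \<in> tangent_space A x \<and> w \<in> tangent_space A x \<longrightarrow>
        \<omega> (vs[j := (\<lambda>c. a *\<^sub>R v c + b *\<^sub>R w c)]) = a * \<omega> (vs[j := v]) + b * \<omega> (vs[j := w])) \<and>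
     (\<forall>vs j j'. length vs = i \<and> set vs \<subseteq> tangent_space A x \<and> j < j' \<and> j' < i \<and> vs ! j = vs ! j' \<longrightarrow>
        \<omega> vs = 0)}"

text \<open>
  The coordinates of an \<open>n\<close>-manifold are indexed by a linearly ordered finite type \<open>'n\<close>, the order
  being the one used in \<open>d\<^sup>nx = dx\<^sup>1 \<and> \<dots> \<and> dx\<^sup>n\<close>.  The vectors of the list are the columns of the
  determinant.
\<close>

definition det_list :: "((real, 'n::{finite,linorder}) vec) list \<Rightarrow> real" where
  "det_list vs = det (\<chi> i j. (vs ! card {j'. j' < j}) $ i)"

text \<open>\<open>top_form A c x a\<close> is the \<open>n\<close>-form \<open>a d\<^sup>nx\<close> at \<open>x\<close>, in the coordinates of the chart \<open>c\<close>.\<close>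

definition top_form ::
  "('m::topological_space, (real, 'n::{finite,linorder}) vec) chart set \<Rightarrow> ('m, (real, 'n) vec) chart \<Rightarrow>
   'm \<Rightarrow> real \<Rightarrow> ('m, (real, 'n) vec) form" where
  "top_form A c x a = (\<lambda>vs. if length vs = CARD('n) \<and> set vs \<subseteq> tangent_space A x
     then a * det_list (map (\<lambda>v. v c) vs) else 0)"

text \<open>
  \<open>sub_form A c x a\<close> is the \<open>(n-1)\<close>-form \<open>\<Sum>\<lambda>. a\<^sup>\<lambda> (\<partial>\<^sub>\<lambda> \<rfloor> d\<^sup>nx)\<close> at \<open>x\<close>; contraction inserts
  \<open>\<partial>\<^sub>\<lambda>\<close> as the first argument.
\<close>

definition sub_form ::
  "('m::topological_space, (real, 'n::{finite,linorder}) vec) chart set \<Rightarrow> ('m, (real, 'n) vec) chart \<Rightarrow>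
   'm \<Rightarrow> (real, 'n) vec \<Rightarrow> ('m, (real, 'n) vec) form" where
  "sub_form A c x a = (\<lambda>vs. if length vs = CARD('n) - 1 \<and> set vs \<subseteq> tangent_space A x
     then (\<Sum>\<kappa>\<in>UNIV. a $ \<kappa> * det_list (axis \<kappa> 1 # map (\<lambda>v. v c) vs)) else 0)"

definition top_coeff ::
  "('m::topological_space, (real, 'n::{finite,linorder}) vec) chart set \<Rightarrow> ('m, (real, 'n) vec) chart \<Rightarrow>
   'm \<Rightarrow> ('m, (real, 'n) vec) form \<Rightarrow> real" where
  "top_coeff A c x \<omega> = (THE a. \<omega> = top_form A c x a)"

definition sub_coeff ::
  "('m::topological_space, (real, 'n::{finite,linorder}) vec) chart set \<Rightarrow> ('m, (real, 'n) vec) chart \<Rightarrow>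
   'm \<Rightarrow> ('m, (real, 'n) vec) form \<Rightarrow> (real, 'n) vec" where
  "sub_coeff A c x \<omega> = (THE a. \<omega> = sub_form A c x a)"


section \<open>Fibre bundles and jets of sections\<close>

record ('m, 'e, 'q, 'n, 'k) fbundle =
  base_atlas :: "('m, real^'n) chart set"
  total_atlas :: "('e, (real^'n) \<times> (real^'k)) chart set"
  fibre_atlas :: "('q, real^'k) chart set"
  proj :: "'e \<Rightarrow> 'm"

definition smooth_fibre_bundle ::
  "('m::{t2_space,second_countable_topology}, 'e::{t2_space,second_countable_topology},
    'q::{t2_space,second_countable_topology}, 'n::finite, 'k::finite) fbundle \<Rightarrow> bool" where
  "smooth_fibre_bundle B \<longleftrightarrow>
     smooth_atlas (base_atlas B) \<and> smooth_atlas (total_atlas B) \<and> smooth_atlas (fibre_atlas B) \<and>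
     smooth_map_on (total_atlas B) UNIV (base_atlas B) (proj B) \<and>
     (\<forall>x. \<exists>U \<tau>. open U \<and> x \<in> U \<and>
        bij_betw \<tau> (proj B -` U) (U \<times> (UNIV :: 'q set)) \<and>
        (\<forall>p. proj B p \<in> U \<longrightarrow> fst (\<tau> p) = proj B p) \<and>
        smooth_map_on (total_atlas B) (proj B -` U) (prod_atlas (base_atlas B) (fibre_atlas B)) \<tau> \<and>
        smooth_map_on (prod_atlas (base_atlas B) (fibre_atlas B)) (U \<times> UNIV) (total_atlas B)
          (inv_into (proj B -` U) \<tau>))"

definition sections ::
  "('m::topological_space, 'e::topological_space, 'q, 'n::finite, 'k::finite) fbundle \<Rightarrow> ('m \<Rightarrow> 'e) set" where
  "sections B = {f. smooth_map_on (base_atlas B) UNIV (total_atlas B) f \<and> (\<forall>x. proj B (f x) = x)}"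

definition local_section ::
  "('m::topological_space, 'e::topological_space, 'q, 'n::finite, 'k::finite) fbundle \<Rightarrow>
   'm \<Rightarrow> ('m \<Rightarrow> 'e) \<Rightarrow> bool" where
  "local_section B x s \<longleftrightarrow> (\<exists>U. open U \<and> x \<in> U \<and>
     smooth_map_on (base_atlas B) U (total_atlas B) s \<and> (\<forall>y\<in>U. proj B (s y) = y))"

text \<open>
  An adapted chart is a chart of the base together with a chart of the total space over it with
  coordinates \<open>(x\<^sup>\<mu>, \<phi>\<^sup>A)\<close>.
\<close>

type_synonym ('m, 'e, 'n, 'k) achart = "('m, real^'n) chart \<times> ('e, (real^'n) \<times> (real^'k)) chart"

definition adapted_charts ::
  "('m::topological_space, 'e::topological_space, 'q, 'n::finite, 'k::finite) fbundle \<Rightarrow>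
   ('m, 'e, 'n, 'k) achart set" where
  "adapted_charts B = {(c, d). c \<in> max_atlas (base_atlas B) \<and> d \<in> max_atlas (total_atlas B) \<and>
     (\<forall>p\<in>fst d. proj B p \<in> fst c \<and> fst (snd d p) = snd c (proj B p))}"

definition local_rep :: "('m, 'e, 'n::finite, 'k::finite) achart \<Rightarrow> ('m \<Rightarrow> 'e) \<Rightarrow> real^'n \<Rightarrow> real^'k" where
  "local_rep e s = (\<lambda>u. snd (snd (snd e) (s (chart_inv (fst e) u))))"

definition partial :: "'n::finite \<Rightarrow> (real^'n \<Rightarrow> 'b::real_normed_vector) \<Rightarrow> real^'n \<Rightarrow> 'b" where
  "partial \<mu> g u = vector_derivative (\<lambda>t. g (u + t *\<^sub>R axis \<mu> 1)) (at 0)"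

primrec partials :: "'n::finite list \<Rightarrow> (real^'n \<Rightarrow> 'b::real_normed_vector) \<Rightarrow> real^'n \<Rightarrow> 'b" where
  "partials [] g = g"
| "partials (\<mu> # \<mu>s) g = partial \<mu> (partials \<mu>s g)"

definition contact ::
  "('m::topological_space, 'e::topological_space, 'q, 'n::finite, 'k::finite) fbundle \<Rightarrow> nat \<Rightarrow>
   'm \<Rightarrow> ('m \<Rightarrow> 'e) \<Rightarrow> ('m \<Rightarrow> 'e) \<Rightarrow> bool" where
  "contact B k x s s' \<longleftrightarrow> s x = s' x \<and>
     (\<forall>e\<in>adapted_charts B. s x \<in> fst (snd e) \<longrightarrow>
        (\<forall>\<mu>s. length \<mu>s \<le> k \<longrightarrow>
           partials \<mu>s (local_rep e s) (snd (fst e) x) = partials \<mu>s (local_rep e s') (snd (fst e) x)))"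

text \<open>A jet is its source point together with an equivalence class of local sections.\<close>

type_synonym ('m, 'e) jet = "'m \<times> ('m \<Rightarrow> 'e) set"

definition jet ::
  "('m::topological_space, 'e::topological_space, 'q, 'n::finite, 'k::finite) fbundle \<Rightarrow> nat \<Rightarrow>
   'm \<Rightarrow> ('m \<Rightarrow> 'e) \<Rightarrow> ('m, 'e) jet" where
  "jet B k x s = (x, {s'. local_section B x s' \<and> contact B k x s s'})"

definition jet_space ::
  "('m::topological_space, 'e::topological_space, 'q, 'n::finite, 'k::finite) fbundle \<Rightarrow> nat \<Rightarrow>
   ('m, 'e) jet set" where
  "jet_space B k = {jet B k x s | x s. local_section B x s}"

definition jet_target :: "('m, 'e) jet \<Rightarrow> 'e" where
  "jet_target j = (SOME s. s \<in> snd j) (fst j)"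

definition jet_dom ::
  "('m::topological_space, 'e::topological_space, 'q, 'n::finite, 'k::finite) fbundle \<Rightarrow> nat \<Rightarrow>
   ('m, 'e, 'n, 'k) achart \<Rightarrow> ('m, 'e) jet set" where
  "jet_dom B k e = {j \<in> jet_space B k. jet_target j \<in> fst (snd e)}"

text \<open>
  Points of jet coordinate space are pairs \<open>(x, \<phi>)\<close>, the coordinate \<open>\<phi>\<^sub>\<mu>\<^sub>1\<^sub>\<dots>\<^sub>\<mu>\<^sub>m\<close>, symmetric in its
  indices, being \<open>\<phi> {#\<mu>\<^sub>1, \<dots>, \<mu>\<^sub>m#}\<close>; it vanishes beyond the order of the jet.
\<close>

type_synonym ('n, 'k) jcoord = "(real^'n) \<times> ('n multiset \<Rightarrow> real^'k)"

definition jet_coords ::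
  "nat \<Rightarrow> ('m, 'e, 'n::{finite,linorder}, 'k::finite) achart \<Rightarrow> ('m, 'e) jet \<Rightarrow> ('n, 'k) jcoord" where
  "jet_coords k e j = (let s = (SOME s. s \<in> snd j); u = snd (fst e) (fst j) in
     (u, \<lambda>M. if size M \<le> k then partials (sorted_list_of_multiset M) (local_rep e s) u else 0))"

definition jet_point ::
  "('m::topological_space, 'e::topological_space, 'q, 'n::{finite,linorder}, 'k::finite) fbundle \<Rightarrow>
   nat \<Rightarrow> ('m, 'e, 'n, 'k) achart \<Rightarrow> ('n, 'k) jcoord \<Rightarrow> ('m, 'e) jet" where
  "jet_point B k e = inv_into (jet_dom B k e) (jet_coords k e)"

definition jet_image ::
  "('m::topological_space, 'e::topological_space, 'q, 'n::{finite,linorder}, 'k::finite) fbundle \<Rightarrow>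
   nat \<Rightarrow> ('m, 'e, 'n, 'k) achart \<Rightarrow> ('n, 'k) jcoord set" where
  "jet_image B k e = jet_coords k e ` jet_dom B k e"


section \<open>Functions of jet coordinates\<close>

definition dx :: "'n::finite \<Rightarrow> (('n, 'k::finite) jcoord \<Rightarrow> real) \<Rightarrow> ('n, 'k) jcoord \<Rightarrow> real" where
  "dx \<mu> G z = deriv (\<lambda>t. G (fst z + t *\<^sub>R axis \<mu> 1, snd z)) 0"

text \<open>Derivative in the direction of the independent coordinate labelled by the multiset \<open>N\<close>.\<close>

definition dphi_indep ::
  "'n multiset \<Rightarrow> 'k \<Rightarrow> (('n::finite, 'k::finite) jcoord \<Rightarrow> real) \<Rightarrow> ('n, 'k) jcoord \<Rightarrow> real" where
  "dphi_indep N A G z = deriv (\<lambda>t. G (fst z, (snd z)(N := snd z N + t *\<^sub>R axis A 1))) 0"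

text \<open>
  The symmetric coefficients \<open>\<partial>G/\<partial>\<phi>\<^sub>\<mu>\<^sub>1\<^sub>\<dots>\<^sub>\<mu>\<^sub>m\<close> satisfy \<open>\<delta>G = \<Sum> \<partial>G/\<partial>\<phi>\<^sub>\<mu>\<^sub>1\<^sub>\<dots>\<^sub>\<mu>\<^sub>m \<delta>\<phi>\<^sub>\<mu>\<^sub>1\<^sub>\<dots>\<^sub>\<mu>\<^sub>m\<close> with
  summation over all index values, in which the independent coordinate labelled by a multiset
  occurs once for each of its orderings.
\<close>

definition dphi ::
  "'n list \<Rightarrow> 'k \<Rightarrow> (('n::finite, 'k::finite) jcoord \<Rightarrow> real) \<Rightarrow> ('n, 'k) jcoord \<Rightarrow> real" where
  "dphi \<mu>s A G z = dphi_indep (mset \<mu>s) A G z / real (card {\<nu>s. mset \<nu>s = mset \<mu>s})"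

text \<open>
  Jet coordinate space carries the product topology, which restricts to the Euclidean one on jets
  of order at most \<open>k\<close>; a function of finitely many real variables is \<open>C\<^sup>r\<close> if its iterated partial
  derivatives up to order \<open>r\<close> exist and are continuous.
\<close>

primrec jet_Ck_on ::
  "nat \<Rightarrow> nat \<Rightarrow> ('n::finite, 'k::finite) jcoord set \<Rightarrow> (('n, 'k) jcoord \<Rightarrow> real) \<Rightarrow> bool" where
  "jet_Ck_on k 0 D G \<longleftrightarrow> continuous_on D G"
| "jet_Ck_on k (Suc r) D G \<longleftrightarrow> continuous_on D G \<and>
     (\<forall>\<mu>. (\<forall>z\<in>D. (\<lambda>t::real. G (fst z + t *\<^sub>R axis \<mu> 1, snd z)) differentiable (at 0)) \<and>
          jet_Ck_on k r D (dx \<mu> G)) \<and>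
     (\<forall>N A. size N \<le> k \<longrightarrow>
          (\<forall>z\<in>D. (\<lambda>t::real. G (fst z, (snd z)(N := snd z N + t *\<^sub>R axis A 1))) differentiable (at 0)) \<and>
          jet_Ck_on k r D (dphi_indep N A G))"

definition jet_smooth_on ::
  "nat \<Rightarrow> ('n::finite, 'k::finite) jcoord set \<Rightarrow> (('n, 'k) jcoord \<Rightarrow> real) \<Rightarrow> bool" where
  "jet_smooth_on k D G \<longleftrightarrow> (\<forall>r. jet_Ck_on k r D G)"

definition jet_truncate :: "nat \<Rightarrow> ('n, 'k::finite) jcoord \<Rightarrow> ('n, 'k) jcoord" where
  "jet_truncate k z = (fst z, \<lambda>M. if size M \<le> k then snd z M else 0)"

text \<open>
  \<open>total_div k G\<close> is \<open>\<partial>\<^sub>\<lambda> G\<^sup>\<lambda>\<close>, a function on jets of order \<open>k + 1\<close>, for \<open>G\<^sup>\<lambda>\<close> on jets of order \<open>k\<close>.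
\<close>

definition total_div ::
  "nat \<Rightarrow> (('n::finite, 'k::finite) jcoord \<Rightarrow> real^'n) \<Rightarrow> ('n, 'k) jcoord \<Rightarrow> real" where
  "total_div k G z = (\<Sum>\<kappa>\<in>UNIV. dx \<kappa> (\<lambda>z. G z $ \<kappa>) (jet_truncate k z) +
     (\<Sum>\<mu>s | length \<mu>s \<le> k. \<Sum>A\<in>UNIV.
        dphi \<mu>s A (\<lambda>z. G z $ \<kappa>) (jet_truncate k z) * snd z (mset (\<mu>s @ [\<kappa>])) $ A))"


section \<open>Form-valued functions on jets\<close>

text \<open>The coefficients \<open>F\<^sup>\<lambda>\<close> and \<open>L\<close> of \<open>F = F\<^sup>\<lambda> \<partial>\<^sub>\<lambda> \<rfloor> d\<^sup>nx\<close> and \<open>L d\<^sup>nx\<close> as functions of jet coordinates.\<close>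

definition sub_local ::
  "('m::topological_space, 'e::topological_space, 'q, 'n::{finite,linorder}, 'k::finite) fbundle \<Rightarrow>
   nat \<Rightarrow> (('m, 'e) jet \<Rightarrow> ('m, (real, 'n) vec) form) \<Rightarrow> ('m, 'e, 'n, 'k) achart \<Rightarrow>
   ('n, 'k) jcoord \<Rightarrow> (real, 'n) vec" where
  "sub_local B k F e z = (let j = jet_point B k e z in sub_coeff (base_atlas B) (fst e) (fst j) (F j))"

definition top_local ::
  "('m::topological_space, 'e::topological_space, 'q, 'n::{finite,linorder}, 'k::finite) fbundle \<Rightarrow>
   nat \<Rightarrow> (('m, 'e) jet \<Rightarrow> ('m, (real, 'n) vec) form) \<Rightarrow> ('m, 'e, 'n, 'k) achart \<Rightarrow>
   ('n, 'k) jcoord \<Rightarrow> real" where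
  "top_local B k L e z = (let j = jet_point B k e z in top_coeff (base_atlas B) (fst e) (fst j) (L j))"

text \<open>Smooth functions on \<open>k\<close>-jets with values in the bundle of \<open>(n-1)\<close>-forms of the base.\<close>

definition smooth_sub_valued ::
  "('m::topological_space, 'e::topological_space, 'q, 'n::{finite,linorder}, 'k::finite) fbundle \<Rightarrow>
   nat \<Rightarrow> (('m, 'e) jet \<Rightarrow> ('m, (real, 'n) vec) form) \<Rightarrow> bool" where
  "smooth_sub_valued B k F \<longleftrightarrow>
     (\<forall>j\<in>jet_space B k. F j \<in> forms_at (base_atlas B) (CARD('n) - 1) (fst j)) \<and>
     (\<forall>e\<in>adapted_charts B. \<forall>\<kappa>. jet_smooth_on k (jet_image B k e) (\<lambda>z. sub_local B k F e z $ \<kappa>))"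

text \<open>
  \<open>L = dF = (\<partial>\<^sub>\<lambda> F\<^sup>\<lambda>) d\<^sup>nx\<close> in all adapted coordinates, for \<open>F\<close> on jets of order \<open>k\<close> and \<open>L\<close> on jets of
  order \<open>k + 1\<close>.  This determines \<open>L\<close> there.
\<close>

definition is_total_divergence ::
  "('m::topological_space, 'e::topological_space, 'q, 'n::{finite,linorder}, 'k::finite) fbundle \<Rightarrow>
   nat \<Rightarrow> (('m, 'e) jet \<Rightarrow> ('m, (real, 'n) vec) form) \<Rightarrow> (('m, 'e) jet \<Rightarrow> ('m, (real, 'n) vec) form) \<Rightarrow> bool" where
  "is_total_divergence B k F L \<longleftrightarrow>
     (\<forall>e\<in>adapted_charts B. \<forall>j\<in>jet_dom B (k + 1) e.
        L j = top_form (base_atlas B) (fst e) (fst j)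
                (total_div k (sub_local B k F e) (jet_coords (k + 1) e j)))"


section \<open>The phase bundle\<close>

text \<open>Vertical tangent vectors of the bundle of \<open>k\<close>-jets over the base, represented like tangent vectors.\<close>

type_synonym ('m, 'e, 'n, 'k) vvec = "('m, 'e, 'n, 'k) achart \<Rightarrow> 'n multiset \<Rightarrow> real^'k"

definition vertical_space ::
  "('m::topological_space, 'e::topological_space, 'q, 'n::{finite,linorder}, 'k::finite) fbundle \<Rightarrow>
   nat \<Rightarrow> ('m, 'e) jet \<Rightarrow> ('m, 'e, 'n, 'k) vvec set" where
  "vertical_space B k j = {v. \<exists>\<gamma>::real \<Rightarrow> ('m, 'e) jet. \<gamma> 0 = j \<and>
     (\<forall>t. \<gamma> t \<in> jet_space B k \<and> fst (\<gamma> t) = fst j) \<and>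
     (\<forall>e\<in>adapted_charts B. j \<in> jet_dom B k e \<longrightarrow>
        (\<forall>\<^sub>F t in at 0. \<gamma> t \<in> jet_dom B k e) \<and>
        (\<forall>M. (\<lambda>t. snd (jet_coords k e (\<gamma> t)) M) differentiable (at 0))) \<and>
     v = (\<lambda>e M. if e \<in> adapted_charts B \<and> j \<in> jet_dom B k e
                then vector_derivative (\<lambda>t. snd (jet_coords k e (\<gamma> t)) M) (at 0) else 0)}"

text \<open>
  A point of \<open>V\<^sup>*(J\<^sup>k) \<otimes> \<Lambda>\<^sup>n\<^sup>-\<^sup>1\<close> over a jet \<open>j\<close> is a linear map from the vertical vectors at \<open>j\<close> to the
  \<open>(n-1)\<close>-forms at the source of \<open>j\<close>, extended by \<open>0\<close>.
\<close>

type_synonym ('m, 'e, 'n, 'k) phase_point =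
  "('m, 'e) jet \<times> (('m, 'e, 'n, 'k) vvec \<Rightarrow> ('m, real^'n) form)"

definition phase_space ::
  "('m::topological_space, 'e::topological_space, 'q, 'n::{finite,linorder}, 'k::finite) fbundle \<Rightarrow>
   nat \<Rightarrow> ('m, 'e, 'n, 'k) phase_point set" where
  "phase_space B k = {(j, p). j \<in> jet_space B k \<and>
     (\<forall>v\<in>vertical_space B k j. p v \<in> forms_at (base_atlas B) (CARD('n) - 1) (fst j)) \<and>
     (\<forall>v\<in>vertical_space B k j. \<forall>w\<in>vertical_space B k j. \<forall>a b.
        p (\<lambda>e M. a *\<^sub>R v e M + b *\<^sub>R w e M) = (\<lambda>vs. a * p v vs + b * p w vs)) \<and>
     (\<forall>v. v \<notin> vertical_space B k j \<longrightarrow> p v = (\<lambda>_. 0))}"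

text \<open>
  Momenta in an adapted chart: \<open>p = \<Sum>\<^sub>m p\<^sup>\<mu>\<^sup>1\<^sup>\<dots>\<^sup>\<mu>\<^sup>m\<^sup>\<lambda> \<delta>\<phi>\<^sub>\<mu>\<^sub>1\<^sub>\<dots>\<^sub>\<mu>\<^sub>m \<otimes> (\<partial>\<^sub>\<lambda> \<rfloor> d\<^sup>nx)\<close>, summed over all index values.
  The symmetry in \<open>\<mu>\<^sub>1, \<dots>, \<mu>\<^sub>m\<close> is built into indexing by \<open>{#\<mu>\<^sub>1, \<dots>, \<mu>\<^sub>m#}\<close>.
\<close>

definition momenta ::
  "('m::topological_space, 'e::topological_space, 'q, 'n::{finite,linorder}, 'k::finite) fbundle \<Rightarrow>
   nat \<Rightarrow> ('m, 'e, 'n, 'k) achart \<Rightarrow> ('m, 'e, 'n, 'k) phase_point \<Rightarrow>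
   'n multiset \<Rightarrow> 'k \<Rightarrow> 'n \<Rightarrow> real" where
  "momenta B k e jp = (THE P. (\<forall>M A \<kappa>. size M > k \<longrightarrow> P M A \<kappa> = 0) \<and>
     (\<forall>v\<in>vertical_space B k (fst jp).
        snd jp v = sub_form (base_atlas B) (fst e) (fst (fst jp))
          (\<chi> \<kappa>. \<Sum>\<mu>s | length \<mu>s \<le> k. \<Sum>A\<in>UNIV. P (mset \<mu>s) A \<kappa> * v e (mset \<mu>s) $ A)))"

definition phase_sections ::
  "('m::topological_space, 'e::topological_space, 'q, 'n::{finite,linorder}, 'k::finite) fbundle \<Rightarrow>
   nat \<Rightarrow> ('m \<Rightarrow> ('m, 'e, 'n, 'k) phase_point) set" where
  "phase_sections B k = {\<sigma>.
     (\<forall>x. \<sigma> x \<in> phase_space B k \<and> fst (fst (\<sigma> x)) = x) \<and>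
     continuous_on UNIV (\<lambda>x. jet_target (fst (\<sigma> x))) \<and>
     (\<forall>e\<in>adapted_charts B. \<forall>M A \<kappa>.
        let S = snd (fst e) ` {x. fst (\<sigma> x) \<in> jet_dom B k e} in
          smooth_on S (\<lambda>u. snd (jet_coords k e (fst (\<sigma> (chart_inv (fst e) u)))) M) \<and>
          smooth_on S (\<lambda>u. momenta B k e (\<sigma> (chart_inv (fst e) u)) M A \<kappa>))}"


section \<open>The Euler--Lagrange equations\<close>

text \<open>
  Total symmetrisation \<open>p\<^sup>(\<^sup>\<mu>\<^sup>1\<^sup>\<dots>\<^sup>\<mu>\<^sup>m\<^sup>)\<close> of \<open>p\<^sup>\<mu>\<^sup>1\<^sup>\<dots>\<^sup>\<mu>\<^sup>m\<close> (where \<open>\<mu>\<^sub>m\<close> is the last, distinguished index), \<open>m \<ge> 1\<close>.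
\<close>

definition symmetrise :: "('n multiset \<Rightarrow> 'k \<Rightarrow> 'n \<Rightarrow> real) \<Rightarrow> 'n list \<Rightarrow> 'k \<Rightarrow> real" where
  "symmetrise P \<mu>s A = (\<Sum>\<pi> | \<pi> permutes {..<length \<mu>s}.
     let \<nu>s = permute_list \<pi> \<mu>s in P (mset (butlast \<nu>s)) A (last \<nu>s)) / fact (length \<mu>s)"

text \<open>\<open>\<partial>\<^sub>\<lambda> p\<^sup>\<mu>\<^sup>1\<^sup>\<dots>\<^sup>\<mu>\<^sup>m\<^sup>\<lambda>\<close> along a section of the phase bundle, at the point with coordinates \<open>u\<close>.\<close>

definition momenta_div ::
  "('m::topological_space, 'e::topological_space, 'q, 'n::{finite,linorder}, 'k::finite) fbundle \<Rightarrow>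
   nat \<Rightarrow> ('m, 'e, 'n, 'k) achart \<Rightarrow> ('m \<Rightarrow> ('m, 'e, 'n, 'k) phase_point) \<Rightarrow>
   'n list \<Rightarrow> 'k \<Rightarrow> (real, 'n) vec \<Rightarrow> real" where
  "momenta_div B k e \<sigma> \<mu>s A u =
     (\<Sum>\<kappa>\<in>UNIV. partial \<kappa> (\<lambda>u. momenta B k e (\<sigma> (chart_inv (fst e) u)) (mset \<mu>s) A \<kappa>) u)"

text \<open>\<open>\<sigma>\<close> is a solution of the equations generated by the Lagrangian density \<open>L\<close> of order \<open>l\<close>.\<close>

definition EL_solution ::
  "('m::topological_space, 'e::topological_space, 'q, 'n::{finite,linorder}, 'k::finite) fbundle \<Rightarrow>
   nat \<Rightarrow> (('m, 'e) jet \<Rightarrow> ('m, (real, 'n) vec) form) \<Rightarrow>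
   ('m \<Rightarrow> ('m, 'e, 'n, 'k) phase_point) \<Rightarrow> bool" where
  "EL_solution B l L \<sigma> \<longleftrightarrow> \<sigma> \<in> phase_sections B (l - 1) \<and>
     (\<exists>f\<in>sections B. (\<forall>x. fst (\<sigma> x) = jet B (l - 1) x f) \<and>
       (\<forall>e\<in>adapted_charts B. \<forall>x. f x \<in> fst (snd e) \<longrightarrow>
         (let P = momenta B (l - 1) e (\<sigma> x);
              divP = (\<lambda>\<mu>s A. momenta_div B (l - 1) e \<sigma> \<mu>s A (snd (fst e) x));
              dL = (\<lambda>\<mu>s A. dphi \<mu>s A (top_local B l L e) (jet_coords l e (jet B l x f)))
          in (\<forall>\<mu>s A. length \<mu>s = l \<longrightarrow> symmetrise P \<mu>s A = dL \<mu>s A) \<and>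
             (\<forall>\<mu>s A. 1 \<le> length \<mu>s \<and> length \<mu>s \<le> l - 1 \<longrightarrow>
                symmetrise P \<mu>s A = dL \<mu>s A - divP \<mu>s A) \<and>
             (\<forall>A. 0 = dL [] A - divP [] A))))"

text \<open>\<open>p\<^sup>\<mu>\<^sup>1\<^sup>\<dots>\<^sup>\<mu>\<^sup>m\<^sup>\<lambda> = \<partial>F\<^sup>\<lambda>/\<partial>\<phi>\<^sub>\<mu>\<^sub>1\<^sub>\<dots>\<^sub>\<mu>\<^sub>m\<close> along the jet component of \<open>\<sigma>\<close>, for \<open>0 \<le> m \<le> k\<close>.\<close>

definition momenta_given_by ::
  "('m::topological_space, 'e::topological_space, 'q, 'n::{finite,linorder}, 'k::finite) fbundle \<Rightarrow>
   nat \<Rightarrow> (('m, 'e) jet \<Rightarrow> ('m, (real, 'n) vec) form) \<Rightarrow>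
   ('m \<Rightarrow> ('m, 'e, 'n, 'k) phase_point) \<Rightarrow> bool" where
  "momenta_given_by B k F \<sigma> \<longleftrightarrow>
     (\<forall>e\<in>adapted_charts B. \<forall>x. fst (\<sigma> x) \<in> jet_dom B k e \<longrightarrow>
        (\<forall>\<mu>s A \<kappa>. length \<mu>s \<le> k \<longrightarrow>
           momenta B k e (\<sigma> x) (mset \<mu>s) A \<kappa> =
             dphi \<mu>s A (\<lambda>z. sub_local B k F e z $ \<kappa>) (jet_coords k e (fst (\<sigma> x)))))"

end

theory Submission
  imports Defs
begin

text \<open>
  The momenta \<open>\<partial>F\<^sup>\<lambda>/\<partial>\<phi>\<^sub>\<mu>\<^sub>1\<^sub>\<dots>\<^sub>\<mu>\<^sub>m\<close> are the vertical derivative of \<open>F\<close>: paired with the velocity of a curve of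
  jets over a fixed point of the base, they give the derivative of \<open>F\<close> along the curve.  Since this
  does not mention coordinates, the coordinate formulas fit together to a point of the phase bundle,
  and this point is determined by its momenta because the vertical vectors have arbitrary components
  in each chart.

  For the Euler--Lagrange equations, differentiate \<open>\<partial>\<^sub>\<lambda> F\<^sup>\<lambda>\<close> by the independent coordinate labelled by a
  multiset \<open>N\<close>.  The terms in which the coefficients are differentiated add up to the total divergence
  of \<open>\<partial>F\<^sup>\<lambda>/\<partial>\<phi>\<^sub>N\<close>, since partial derivatives commute.  The terms in which the explicit factor
  \<open>\<phi>\<^sub>M\<^sub>\<lambda>\<close> is differentiated add up to the derivatives of \<open>F\<^sup>\<kappa>\<close> by \<open>N - \<kappa>\<close>, with \<open>\<kappa>\<close> ranging over the
  elements of \<open>N\<close>; this is the symmetrised momentum, because the numbers of orderings of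
  \<open>N - \<kappa>\<close> and of \<open>N\<close> have the ratio \<open>count N \<kappa> / size N\<close>.

  Jets are transported between charts by a single fact: if the \<open>k\<close>-jets of a family of germs \<open>G\<^sub>t\<close> vary
  differentiably at \<open>t = 0\<close>, so do those of \<open>T \<circ> G\<^sub>t\<close>, with a velocity that depends linearly on that of
  \<open>G\<^sub>t\<close>.  It shows that vertical vectors transform linearly and, applied to a family that jumps from
  one germ to another at \<open>t = 0\<close>, that contact can be tested in one chart.
\<close>

section \<open>Calculus of smooth maps\<close>

text \<open>The definitions quantify over all charts of maximal atlases and over curves given only
  by existence, so vectors cannot be added or prescribed directly. In the tangent and in the
  vertical case a vector is therefore built in one chart, and linearity of the transitions carries
  the result to all others. Taylor polynomials supply germs with prescribed jets; they realise every
  admissible jet coordinate and every vertical velocity. Jet coordinates form an infinite product in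
  which only fibre coordinates of order at most \<open>k\<close> may be varied, and smoothness there
  means continuity of iterated partial derivatives; hence the chain rule and the commutation of
  derivatives are first proved for the finitely many active coordinates. Factors
  \<open>orderings\<close> appear because momenta are summed over lists of indices while independent
  coordinates are labelled by multisets. The Euler--Lagrange equations constrain momenta only
  through symmetrisations and divergences, so the momentum formula is part of the target of the
  bijection, and uniqueness rests on that formula.\<close>

lemma frechet_derivative_cong_open:
  assumes "open S" "x \<in> S" "\<And>y. y \<in> S \<Longrightarrow> f y = g y"
  shows "frechet_derivative f (at x) = frechet_derivative g (at x)"
proof -
  \<comment> \<open>\<open>frechet_derivative\<close> is a choice from all derivatives at the point,
    so equality of these sets suffices, also where no derivative exists.\<close>
  have "(f has_derivative D) (at x) \<longleftrightarrow> (g has_derivative D) (at x)" for D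
    using assms has_derivative_transform_within_open[of f D x UNIV S g]
      has_derivative_transform_within_open[of g D x UNIV S f] by fastforce
  then show ?thesis
    unfolding frechet_derivative_def by simp
qed

lemma Ck_on_cong:
  assumes "open S" "\<And>x. x \<in> S \<Longrightarrow> f x = g x" "Ck_on r S f"
  shows "Ck_on r S g"
  using assms(2,3)
proof (induction r arbitrary: f g)
  case 0
  then show ?case
    using continuous_on_cong by (metis Ck_on.simps(1))
next
  case (Suc r)
  have "g differentiable_on S"
    using Suc.prems unfolding differentiable_on_def
    by (metis Ck_on.simps(2) differentiable_on_def differentiable_transform_within zero_less_one)
  moreover have "frechet_derivative f (at x) v = frechet_derivative g (at x) v" if "x \<in> S" for x v
    using frechet_derivative_cong_open[OF assms(1) that] Suc.prems by metis
  ultimately show ?case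
    using Suc by (metis (mono_tags, lifting) Ck_on.simps(2))
qed

text \<open>\<open>Ck_on\<close> is stated with the chosen \<open>frechet_derivative\<close>. Here
  any derivative given in closed form may replace it, which is the pattern of the closure proofs for
  constants, sums, products and composites: write down the derivative, then show that it has class
  \<open>r\<close>.\<close>

lemma Ck_on_SucI:
  assumes "open S" and D: "\<And>x. x \<in> S \<Longrightarrow> (f has_derivative f' x) (at x)"
    and C: "\<And>v. Ck_on r S (\<lambda>x. f' x v)"
  shows "Ck_on (Suc r) S f"
proof -
  have "f differentiable_on S"
    unfolding differentiable_on_def using D has_derivative_at_withinI differentiable_def by blast
  moreover have "f' x v = frechet_derivative f (at x) v" if "x \<in> S" for x v
    using frechet_derivative_at[OF D[OF that]] by simp
  ultimately show ?thesis
    using Ck_on_cong[OF assms(1) _ C] by auto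
qed

lemma Ck_on_Suc_derivative:
  assumes "open S" "Ck_on (Suc r) S f" "x \<in> S"
  shows "(f has_derivative frechet_derivative f (at x)) (at x)"
  using assms by (metis Ck_on.simps(2) at_within_open differentiable_on_def frechet_derivative_works)

lemma Ck_on_frechet: "Ck_on (Suc r) S f \<Longrightarrow> Ck_on r S (\<lambda>x. frechet_derivative f (at x) v)"
  by simp

lemma Ck_on_subset: "Ck_on r S f \<Longrightarrow> T \<subseteq> S \<Longrightarrow> Ck_on r T f"
  by (induction r arbitrary: f) (auto intro: continuous_on_subset differentiable_on_subset)

lemma Ck_on_Suc_imp: "Ck_on (Suc r) S f \<Longrightarrow> Ck_on r S f"
  by (induction r arbitrary: f) (auto intro: differentiable_imp_continuous_on)

lemma Ck_on_const: "open S \<Longrightarrow> Ck_on r S (\<lambda>x. c)"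
proof (induction r arbitrary: c)
  case (Suc r)
  then show ?case by (intro Ck_on_SucI[where f' = "\<lambda>_ _. 0"]) auto
qed simp

lemma Ck_on_linear:
  assumes "open S" "bounded_linear h"
  shows "Ck_on r S h"
proof (cases r)
  case 0
  then show ?thesis using assms by (simp add: linear_continuous_on)
next
  case (Suc r')
  show ?thesis unfolding Suc
    by (rule Ck_on_SucI[where f' = "\<lambda>_. h"])
      (auto simp: assms Ck_on_const bounded_linear_imp_has_derivative)
qed

lemma Ck_on_linear_compose:
  assumes "open S" "bounded_linear h" "Ck_on r S f"
  shows "Ck_on r S (\<lambda>x. h (f x))"
  using assms(3)
proof (induction r arbitrary: f)
  case 0
  then show ?case
    using assms(2) by (simp add: bounded_linear.continuous_on)
next
  case (Suc r)
  show ?case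
    by (rule Ck_on_SucI[OF assms(1) bounded_linear.has_derivative[OF assms(2)
            Ck_on_Suc_derivative[OF assms(1) Suc.prems]] Suc.IH[OF Ck_on_frechet[OF Suc.prems]]])
qed

lemma Ck_on_add:
  assumes "open S" "Ck_on r S f" "Ck_on r S g"
  shows "Ck_on r S (\<lambda>x. f x + g x)"
  using assms(2,3)
proof (induction r arbitrary: f g)
  case 0
  then show ?case by (simp add: continuous_on_add)
next
  case (Suc r)
  show ?case
    by (rule Ck_on_SucI[OF assms(1) has_derivative_add[OF Ck_on_Suc_derivative[OF assms(1) Suc.prems(1)]
            Ck_on_Suc_derivative[OF assms(1) Suc.prems(2)]]
          Suc.IH[OF Ck_on_frechet[OF Suc.prems(1)] Ck_on_frechet[OF Suc.prems(2)]]])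
qed

lemma Ck_on_bilinear:
  assumes "open S" "bounded_bilinear b" "Ck_on r S f" "Ck_on r S g"
  shows "Ck_on r S (\<lambda>x. b (f x) (g x))"
  using assms(3,4)
proof (induction r arbitrary: f g)
  case 0
  then show ?case using assms(2) by (simp add: bounded_bilinear.continuous_on)
next
  case (Suc r)
  have "Ck_on r S f" "Ck_on r S g"
    using Suc.prems Ck_on_Suc_imp by blast+
  then have *: "Ck_on r S (\<lambda>x. b (f x) (frechet_derivative g (at x) v) + b (frechet_derivative f (at x) v) (g x))" for v
    using Suc.prems by (intro Ck_on_add[OF assms(1)] Suc.IH Ck_on_frechet)
  show ?case
    by (rule Ck_on_SucI[OF assms(1) bounded_bilinear.FDERIV[OF assms(2)
            Ck_on_Suc_derivative[OF assms(1) Suc.prems(1)] Ck_on_Suc_derivative[OF assms(1) Suc.prems(2)]] *])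
qed

lemma Ck_on_sum:
  assumes "open S" "\<And>i. i \<in> I \<Longrightarrow> Ck_on r S (f i)"
  shows "Ck_on r S (\<lambda>x. \<Sum>i\<in>I. f i x)"
  using assms(2)
  by (induction I rule: infinite_finite_induct) (auto simp: Ck_on_const Ck_on_add assms(1))

lemma linear_euclidean_sum:
  fixes h :: "'a::euclidean_space \<Rightarrow> 'b::real_vector"
  assumes "linear h"
  shows "h v = (\<Sum>i\<in>Basis. (v \<bullet> i) *\<^sub>R h i)"
  by (metis (no_types, lifting) assms euclidean_representation linear_cmul linear_sum sum.cong)

text \<open>The chain rule evaluates the derivative of \<open>g\<close> in the moving direction
  \<open>f' v\<close>, whereas \<open>Ck_on (Suc r)\<close> controls only fixed directions.
  Expanding in the basis of the middle space gives products of components of \<open>f'\<close> with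
  fixed directional derivatives of \<open>g\<close>, and the induction runs over \<open>g\<close>
  with \<open>f\<close> kept.\<close>

lemma Ck_on_compose:
  fixes f :: "'a::real_normed_vector \<Rightarrow> 'b::euclidean_space" and g :: "'b \<Rightarrow> 'c::real_normed_vector"
  assumes "open S" "open T" "f ` S \<subseteq> T" "Ck_on r S f" "Ck_on r T g"
  shows "Ck_on r S (\<lambda>x. g (f x))"
  using assms(4,5)
proof (induction r arbitrary: g)
  case 0
  then show ?case using assms(3) by (simp add: continuous_on_compose2)
next
  case (Suc r)
  have fr: "Ck_on r S f" using Suc.prems Ck_on_Suc_imp by blast
  let ?D = "\<lambda>x v. \<Sum>i\<in>Basis. (frechet_derivative f (at x) v \<bullet> i) *\<^sub>R frechet_derivative g (at (f x)) i"
  show ?case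
  proof (rule Ck_on_SucI[where f' = ?D, OF assms(1)])
    fix x assume x: "x \<in> S"
    have f: "(f has_derivative frechet_derivative f (at x)) (at x)"
      using Ck_on_Suc_derivative assms Suc.prems x by blast
    have g: "(g has_derivative frechet_derivative g (at (f x))) (at (f x))"
      using Ck_on_Suc_derivative assms Suc.prems x by blast
    show "((\<lambda>x. g (f x)) has_derivative ?D x) (at x)"
      using has_derivative_compose[OF f g]
      unfolding linear_euclidean_sum[OF has_derivative_linear[OF g], of "frechet_derivative f (at x) _"] .
  next
    fix v
    show "Ck_on r S (\<lambda>x. ?D x v)"
      by (rule Ck_on_sum[OF assms(1) Ck_on_bilinear[OF assms(1) bounded_bilinear_scaleR
              Ck_on_linear_compose[OF assms(1) bounded_linear_inner_left Ck_on_frechet[OF Suc.prems(1)]]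
              Suc.IH[OF fr Ck_on_frechet[OF Suc.prems(2)]]]])
  qed
qed

lemma Ck_on_local:
  assumes "\<And>x. x \<in> S \<Longrightarrow> \<exists>T. open T \<and> x \<in> T \<and> Ck_on r T f"
  shows "Ck_on r S f"
  using assms
proof (induction r arbitrary: f)
  case 0
  then show ?case
    by (metis Ck_on.simps(1) continuous_at_imp_continuous_on continuous_on_eq_continuous_at)
next
  case (Suc r)
  have "f differentiable_on S"
    unfolding differentiable_on_def
  proof
    fix x assume "x \<in> S"
    then obtain T where "open T" "x \<in> T" "Ck_on (Suc r) T f"
      using Suc.prems by blast
    then show "f differentiable at x within S"
      by (metis Ck_on_Suc_derivative differentiableI has_derivative_at_withinI)
  qed
  moreover have "Ck_on r S (\<lambda>x. frechet_derivative f (at x) v)" for v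
  proof (rule Suc.IH)
    fix x assume "x \<in> S"
    then obtain T where "open T" "x \<in> T" "Ck_on (Suc r) T f"
      using Suc.prems by blast
    then show "\<exists>T. open T \<and> x \<in> T \<and> Ck_on r T (\<lambda>x. frechet_derivative f (at x) v)"
      using Ck_on_frechet by blast
  qed
  ultimately show ?case by simp
qed

section \<open>Closure properties of smooth maps\<close>

lemma smooth_on_cong: "open S \<Longrightarrow> (\<And>x. x \<in> S \<Longrightarrow> f x = g x) \<Longrightarrow> smooth_on S f \<Longrightarrow> smooth_on S g"
  unfolding smooth_on_def using Ck_on_cong[of S f g] by blast

lemma smooth_on_subset: "smooth_on S f \<Longrightarrow> T \<subseteq> S \<Longrightarrow> smooth_on T f"
  unfolding smooth_on_def using Ck_on_subset by blast

lemma smooth_on_local: "(\<And>x. x \<in> S \<Longrightarrow> \<exists>T. open T \<and> x \<in> T \<and> smooth_on T f) \<Longrightarrow> smooth_on S f"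
  unfolding smooth_on_def by (intro allI Ck_on_local) meson

lemma smooth_on_const: "open S \<Longrightarrow> smooth_on S (\<lambda>x. c)"
  by (simp add: smooth_on_def Ck_on_const)

lemma smooth_on_linear: "open S \<Longrightarrow> bounded_linear h \<Longrightarrow> smooth_on S h"
  by (simp add: smooth_on_def Ck_on_linear)

lemma smooth_on_linear_compose:
  "open S \<Longrightarrow> bounded_linear h \<Longrightarrow> smooth_on S f \<Longrightarrow> smooth_on S (\<lambda>x. h (f x))"
  by (simp add: smooth_on_def Ck_on_linear_compose)

lemma smooth_on_add:
  "open S \<Longrightarrow> smooth_on S f \<Longrightarrow> smooth_on S g \<Longrightarrow> smooth_on S (\<lambda>x. f x + g x)"
  by (simp add: smooth_on_def Ck_on_add)

lemma smooth_on_bilinear: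
  "open S \<Longrightarrow> bounded_bilinear b \<Longrightarrow> smooth_on S f \<Longrightarrow> smooth_on S g \<Longrightarrow> smooth_on S (\<lambda>x. b (f x) (g x))"
  by (simp add: smooth_on_def Ck_on_bilinear)

lemma smooth_on_compose:
  fixes f :: "'a::real_normed_vector \<Rightarrow> 'b::euclidean_space" and g :: "'b \<Rightarrow> 'c::real_normed_vector"
  assumes "open S" "open T" "f ` S \<subseteq> T" "smooth_on S f" "smooth_on T g"
  shows "smooth_on S (\<lambda>x. g (f x))"
  using assms(4,5) Ck_on_compose[OF assms(1-3)] unfolding smooth_on_def by blast

lemma smooth_on_Pair:
  fixes f :: "'a::real_normed_vector \<Rightarrow> 'b::real_normed_vector" and g :: "'a \<Rightarrow> 'c::real_normed_vector"
  assumes "open S" "smooth_on S f" "smooth_on S g"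
  shows "smooth_on S (\<lambda>x. (f x, g x))"
proof -
  have 1: "bounded_linear (\<lambda>x::'b. (x, 0::'c))" "bounded_linear (\<lambda>x::'c. (0::'b, x))"
    by (rule bounded_linear_Pair bounded_linear_ident bounded_linear_zero)+
  have "smooth_on S (\<lambda>x. (f x, 0) + (0, g x))"
    by (rule smooth_on_add[OF assms(1) smooth_on_linear_compose[OF assms(1) 1(1) assms(2)]
          smooth_on_linear_compose[OF assms(1) 1(2) assms(3)]])
  then show ?thesis by simp
qed

lemma smooth_on_continuous: "smooth_on S f \<Longrightarrow> continuous_on S f"
  by (metis Ck_on.simps(1) smooth_on_def)

lemma smooth_on_derivative:
  "open S \<Longrightarrow> smooth_on S f \<Longrightarrow> x \<in> S \<Longrightarrow> (f has_derivative frechet_derivative f (at x)) (at x)"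
  using Ck_on_Suc_derivative[of S _ f x] smooth_on_def by blast

lemma smooth_on_frechet: "smooth_on S f \<Longrightarrow> smooth_on S (\<lambda>x. frechet_derivative f (at x) v)"
  unfolding smooth_on_def using Ck_on_frechet[of _ S f v] by blast

section \<open>Iterated partial derivatives\<close>

lemma partial_cong_open:
  assumes "open S" "u \<in> S" "\<And>x. x \<in> S \<Longrightarrow> f x = g x"
  shows "partial \<mu> f u = partial \<mu> g u"
proof -
  have "((\<lambda>t::real. u + t *\<^sub>R axis \<mu> 1) \<longlongrightarrow> u + 0 *\<^sub>R axis \<mu> 1) (nhds 0)"
    by (intro tendsto_intros filterlim_ident)
  then have "\<forall>\<^sub>F t in nhds 0. u + t *\<^sub>R axis \<mu> (1::real) \<in> S"
    by (rule topological_tendstoD) (use assms in auto)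
  then have "\<forall>\<^sub>F t in nhds 0. f (u + t *\<^sub>R axis \<mu> 1) = g (u + t *\<^sub>R axis \<mu> 1)"
    by (rule eventually_mono) (use assms in auto)
  then show ?thesis
    unfolding partial_def by (intro vector_derivative_cong_eq) auto
qed

lemma partials_cong_open:
  assumes "open S" "u \<in> S" "\<And>x. x \<in> S \<Longrightarrow> f x = g x"
  shows "partials \<mu>s f u = partials \<mu>s g u"
  using assms(2)
proof (induction \<mu>s arbitrary: u)
  case (Cons \<mu> \<mu>s)
  then show ?case using partial_cong_open[OF assms(1), of u "partials \<mu>s f"] by simp
qed (use assms in simp)

lemma has_derivative_partial:
  assumes "(f has_derivative f') (at u)"
  shows "((\<lambda>t. f (u + t *\<^sub>R axis \<mu> 1)) has_vector_derivative f' (axis \<mu> 1)) (at 0)"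
    and "partial \<mu> f u = f' (axis \<mu> 1)"
proof -
  have 1: "((\<lambda>t. u + t *\<^sub>R axis \<mu> 1) has_derivative (\<lambda>t. t *\<^sub>R axis \<mu> (1::real))) (at 0)"
    by (auto intro!: derivative_eq_intros)
  have "((\<lambda>t. f (u + t *\<^sub>R axis \<mu> 1)) has_derivative (\<lambda>t. f' (t *\<^sub>R axis \<mu> 1))) (at 0)"
    using has_derivative_compose[OF 1, of f f'] assms by simp
  then show *: "((\<lambda>t. f (u + t *\<^sub>R axis \<mu> 1)) has_vector_derivative f' (axis \<mu> 1)) (at 0)"
    using has_derivative_linear[OF assms] by (simp add: has_vector_derivative_def linear_cmul)
  show "partial \<mu> f u = f' (axis \<mu> 1)"
    unfolding partial_def by (rule vector_derivative_at[OF *])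
qed

lemma partial_eq_frechet:
  "open S \<Longrightarrow> smooth_on S f \<Longrightarrow> u \<in> S \<Longrightarrow> partial \<mu> f u = frechet_derivative f (at u) (axis \<mu> 1)"
  by (rule has_derivative_partial(2)[OF smooth_on_derivative])

lemma smooth_on_partial: "open S \<Longrightarrow> smooth_on S f \<Longrightarrow> smooth_on S (partial \<mu> f)"
  using smooth_on_cong[OF _ _ smooth_on_frechet, of S f "axis \<mu> 1" "partial \<mu> f"]
    partial_eq_frechet by metis

lemma smooth_on_partials: "open S \<Longrightarrow> smooth_on S f \<Longrightarrow> smooth_on S (partials \<mu>s f)"
  by (induction \<mu>s) (auto simp: smooth_on_partial)

section \<open>Symmetry of second derivatives\<close>

text \<open>Two applications of the mean value theorem write the second difference of
  \<open>H\<close> over a small square as \<open>h * h\<close> times either mixed derivative at some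
  inner point; continuity at the origin then compares them. The form with two real parameters serves
  both the Frechet derivatives of maps and the derivatives by jet coordinates.\<close>

lemma mixed_derivatives_eq_real:
  fixes H Hs Ht Hst Hts :: "real \<Rightarrow> real \<Rightarrow> real"
  assumes e: "e > 0"
    and s: "\<And>s t. \<bar>s\<bar> < e \<Longrightarrow> \<bar>t\<bar> < e \<Longrightarrow> ((\<lambda>s. H s t) has_real_derivative Hs s t) (at s)"
    and t: "\<And>s t. \<bar>s\<bar> < e \<Longrightarrow> \<bar>t\<bar> < e \<Longrightarrow> ((\<lambda>t. H s t) has_real_derivative Ht s t) (at t)"
    and st: "\<And>s t. \<bar>s\<bar> < e \<Longrightarrow> \<bar>t\<bar> < e \<Longrightarrow> ((\<lambda>t. Hs s t) has_real_derivative Hst s t) (at t)"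
    and ts: "\<And>s t. \<bar>s\<bar> < e \<Longrightarrow> \<bar>t\<bar> < e \<Longrightarrow> ((\<lambda>s. Ht s t) has_real_derivative Hts s t) (at s)"
    and cst: "((\<lambda>p. Hst (fst p) (snd p)) \<longlongrightarrow> Hst 0 0) (nhds (0, 0))"
    and cts: "((\<lambda>p. Hts (fst p) (snd p)) \<longlongrightarrow> Hts 0 0) (nhds (0, 0))"
  shows "Hst 0 0 = Hts 0 0"
proof (rule ccontr)
  assume ne: "Hst 0 0 \<noteq> Hts 0 0"
  define d where "d = \<bar>Hst 0 0 - Hts 0 0\<bar> / 2"
  have d: "d > 0" using ne by (simp add: d_def)
  have "\<forall>\<^sub>F p in nhds (0, 0). dist (Hst (fst p) (snd p)) (Hst 0 0) < d \<and> dist (Hts (fst p) (snd p)) (Hts 0 0) < d"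
    using tendstoD[OF cst d] tendstoD[OF cts d] by (rule eventually_conj)
  then obtain r where r: "r > 0" and
    near: "\<And>p. dist p (0::real, 0::real) < r \<Longrightarrow>
      dist (Hst (fst p) (snd p)) (Hst 0 0) < d \<and> dist (Hts (fst p) (snd p)) (Hts 0 0) < d"
    unfolding eventually_nhds_metric by blast
  \<comment> \<open>The factor 3 gives both \<open>h < e\<close> and \<open>2 * h < r\<close>; the
    second keeps all points of the square within distance \<open>r\<close> of the origin.\<close>
  define h where "h = min e r / 3"
  have h: "0 < h" "h < e" "2 * h < r" using e r by (auto simp: h_def)
  have small: "dist (a, b) (0::real, 0::real) < r" if "0 < a" "a < h" "0 < b" "b < h" for a b
  proof -
    have "dist (a, b) (0::real, 0::real) \<le> \<bar>a\<bar> + \<bar>b\<bar>"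
      by (simp add: dist_Pair_Pair dist_real_def sqrt_sum_squares_le_sum_abs)
    then show ?thesis using that h by simp
  qed
  have "\<exists>a>0. a < h \<and> (H h h - H h 0) - (H 0 h - H 0 0) = (h - 0) * (Hs a h - Hs a 0)"
    by (rule MVT2[OF h(1), of "\<lambda>s. H s h - H s 0"])
      (use h in \<open>auto intro!: DERIV_diff s\<close>)
  then obtain a where a: "0 < a" "a < h" "(H h h - H h 0) - (H 0 h - H 0 0) = h * (Hs a h - Hs a 0)"
    by auto
  have "\<exists>b>0. b < h \<and> Hs a h - Hs a 0 = (h - 0) * Hst a b"
    by (rule MVT2[OF h(1)]) (use h a in \<open>auto intro!: st\<close>)
  then obtain b where b: "0 < b" "b < h" "Hs a h - Hs a 0 = h * Hst a b" by auto
  have "\<exists>b>0. b < h \<and> (H h h - H 0 h) - (H h 0 - H 0 0) = (h - 0) * (Ht h b - Ht 0 b)"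
    by (rule MVT2[OF h(1), of "\<lambda>t. H h t - H 0 t"])
      (use h in \<open>auto intro!: DERIV_diff t\<close>)
  then obtain b' where b': "0 < b'" "b' < h" "(H h h - H 0 h) - (H h 0 - H 0 0) = h * (Ht h b' - Ht 0 b')"
    by auto
  have "\<exists>a>0. a < h \<and> Ht h b' - Ht 0 b' = (h - 0) * Hts a b'"
    by (rule MVT2[OF h(1)]) (use h b' in \<open>auto intro!: ts\<close>)
  then obtain a' where a': "0 < a'" "a' < h" "Ht h b' - Ht 0 b' = h * Hts a' b'" by auto
  have "h * (h * Hst a b) = h * (h * Hts a' b')"
    using a(3)[unfolded b(3)] b'(3)[unfolded a'(3)] by linarith
  then have "Hst a b = Hts a' b'" using h(1) by simp
  moreover have "\<bar>Hst a b - Hst 0 0\<bar> < d" "\<bar>Hts a' b' - Hts 0 0\<bar> < d"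
    using near[OF small[OF a(1,2) b(1,2)]] near[OF small[OF a'(1,2) b'(1,2)]]
    by (auto simp: dist_real_def)
  ultimately show False
    unfolding d_def by argo
qed

lemma frechet_derivative_linear_compose:
  assumes "bounded_linear h" "(f has_derivative f') (at x)"
  shows "frechet_derivative (\<lambda>x. h (f x)) (at x) v = h (f' v)"
  using frechet_derivative_at[OF bounded_linear.has_derivative[OF assms]] by metis

lemma has_derivative_line2:
  fixes a v w :: "'a::real_normed_vector"
  assumes "(g has_derivative g') (at (a + s *\<^sub>R v + t *\<^sub>R w))"
  shows "((\<lambda>s. g (a + s *\<^sub>R v + t *\<^sub>R w)) has_vector_derivative g' v) (at s)"
    and "((\<lambda>t. g (a + s *\<^sub>R v + t *\<^sub>R w)) has_vector_derivative g' w) (at t)"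
proof -
  have 1: "((\<lambda>s. a + s *\<^sub>R v + t *\<^sub>R w) has_derivative (\<lambda>s. s *\<^sub>R v)) (at s)"
    by (auto intro!: derivative_eq_intros)
  have 2: "((\<lambda>t. a + s *\<^sub>R v + t *\<^sub>R w) has_derivative (\<lambda>t. t *\<^sub>R w)) (at t)"
    by (auto intro!: derivative_eq_intros)
  show "((\<lambda>s. g (a + s *\<^sub>R v + t *\<^sub>R w)) has_vector_derivative g' v) (at s)"
    using has_derivative_compose[OF 1 assms] has_derivative_linear[OF assms]
    by (simp add: has_vector_derivative_def linear_cmul)
  show "((\<lambda>t. g (a + s *\<^sub>R v + t *\<^sub>R w)) has_vector_derivative g' w) (at t)"
    using has_derivative_compose[OF 2 assms] has_derivative_linear[OF assms]
    by (simp add: has_vector_derivative_def linear_cmul)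
qed

text \<open>Composing \<open>f\<close> with \<open>a + s v + t w\<close> reduces this to functions
  of the two real parameters \<open>s\<close> and \<open>t\<close>.\<close>

lemma frechet_derivative_symmetric_real:
  fixes f :: "'a::real_normed_vector \<Rightarrow> real"
  assumes S: "open S" and f: "smooth_on S f" and a: "a \<in> S"
  shows "frechet_derivative (\<lambda>x. frechet_derivative f (at x) v) (at a) w =
    frechet_derivative (\<lambda>x. frechet_derivative f (at x) w) (at a) v"
proof -
  let ?p = "\<lambda>s t. a + s *\<^sub>R v + t *\<^sub>R w"
  let ?D = "\<lambda>v x. frechet_derivative f (at x) v"
  let ?DD = "\<lambda>v w x. frechet_derivative (?D v) (at x) w"
  have lim: "((\<lambda>p::real\<times>real. ?p (fst p) (snd p)) \<longlongrightarrow> a) (nhds (0, 0))"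
  proof -
    have "continuous_on UNIV (\<lambda>p::real\<times>real. ?p (fst p) (snd p))"
      by (intro continuous_intros)
    then have "isCont (\<lambda>p::real\<times>real. ?p (fst p) (snd p)) (0, 0)"
      by (simp add: continuous_on_eq_continuous_at)
    then show ?thesis by (simp add: isCont_def tendsto_nhds_iff)
  qed
  then have "\<forall>\<^sub>F p in nhds (0::real, 0::real). ?p (fst p) (snd p) \<in> S"
    using S a by (rule topological_tendstoD)
  then obtain r where r: "r > 0" "\<And>p. dist p (0::real, 0::real) < r \<Longrightarrow> ?p (fst p) (snd p) \<in> S"
    unfolding eventually_nhds_metric by blast
  have inS: "?p s t \<in> S" if "\<bar>s\<bar> < r/2" "\<bar>t\<bar> < r/2" for s t
  proof -
    have "dist (s, t) (0, 0) \<le> \<bar>s\<bar> + \<bar>t\<bar>"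
      by (simp add: dist_Pair_Pair dist_real_def sqrt_sum_squares_le_sum_abs)
    then show ?thesis using r(2)[of "(s, t)"] that by simp
  qed
  have cont: "((\<lambda>p::real\<times>real. ?DD v w (?p (fst p) (snd p))) \<longlongrightarrow> ?DD v w (?p 0 0)) (nhds (0,0))"
  proof -
    have "isCont (?DD v w) a"
      using smooth_on_continuous[OF smooth_on_frechet[OF smooth_on_frechet[OF f]]] S a
        continuous_on_eq_continuous_at by blast
    then show ?thesis
      using isCont_tendsto_compose[OF _ lim] by simp
  qed
  have cont': "((\<lambda>p::real\<times>real. ?DD w v (?p (fst p) (snd p))) \<longlongrightarrow> ?DD w v (?p 0 0)) (nhds (0,0))"
  proof -
    have "isCont (?DD w v) a"
      using smooth_on_continuous[OF smooth_on_frechet[OF smooth_on_frechet[OF f]]] S a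
        continuous_on_eq_continuous_at by blast
    then show ?thesis
      using isCont_tendsto_compose[OF _ lim] by simp
  qed
  have "?DD v w (?p 0 0) = ?DD w v (?p 0 0)"
  proof (rule mixed_derivatives_eq_real[where H = "\<lambda>s t. f (?p s t)" and Hs = "\<lambda>s t. ?D v (?p s t)"
        and Ht = "\<lambda>s t. ?D w (?p s t)" and e = "r/2", OF _ _ _ _ _ cont cont'])
    fix s t assume st: "\<bar>s\<bar> < r/2" "\<bar>t\<bar> < r/2"
    note der = smooth_on_derivative[OF S f inS[OF st]]
      smooth_on_derivative[OF S smooth_on_frechet[OF f] inS[OF st]]
    show "((\<lambda>s. f (?p s t)) has_real_derivative ?D v (?p s t)) (at s)"
      unfolding has_real_derivative_iff_has_vector_derivative by (rule has_derivative_line2[OF der(1)])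
    show "((\<lambda>t. f (?p s t)) has_real_derivative ?D w (?p s t)) (at t)"
      unfolding has_real_derivative_iff_has_vector_derivative by (rule has_derivative_line2[OF der(1)])
    show "((\<lambda>t. ?D v (?p s t)) has_real_derivative ?DD v w (?p s t)) (at t)"
      unfolding has_real_derivative_iff_has_vector_derivative by (rule has_derivative_line2[OF der(2)])
    show "((\<lambda>s. ?D w (?p s t)) has_real_derivative ?DD w v (?p s t)) (at s)"
      unfolding has_real_derivative_iff_has_vector_derivative by (rule has_derivative_line2[OF der(2)])
  qed (use r in simp)
  then show ?thesis by simp
qed

text \<open>The mean value argument concerns real values, hence the passage to components.\<close>

lemma frechet_derivative_symmetric:
  fixes f :: "'a::real_normed_vector \<Rightarrow> 'b::euclidean_space"
  assumes S: "open S" and f: "smooth_on S f" and a: "a \<in> S"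
  shows "frechet_derivative (\<lambda>x. frechet_derivative f (at x) v) (at a) w =
    frechet_derivative (\<lambda>x. frechet_derivative f (at x) w) (at a) v"
proof (rule euclidean_eqI)
  fix i :: 'b assume "i \<in> Basis"
  let ?g = "\<lambda>x. f x \<bullet> i"
  have D: "frechet_derivative ?g (at x) v = frechet_derivative f (at x) v \<bullet> i" if "x \<in> S" for x v
    using frechet_derivative_linear_compose[OF bounded_linear_inner_left smooth_on_derivative[OF S f that]] .
  have DD: "frechet_derivative (\<lambda>x. frechet_derivative ?g (at x) v) (at a) w =
     frechet_derivative (\<lambda>x. frechet_derivative f (at x) v) (at a) w \<bullet> i" for v w
    using frechet_derivative_cong_open[OF S a, of "\<lambda>x. frechet_derivative ?g (at x) v", OF D]
      frechet_derivative_linear_compose[OF bounded_linear_inner_left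
        smooth_on_derivative[OF S smooth_on_frechet[OF f] a]] by metis
  show "frechet_derivative (\<lambda>x. frechet_derivative f (at x) v) (at a) w \<bullet> i =
    frechet_derivative (\<lambda>x. frechet_derivative f (at x) w) (at a) v \<bullet> i"
    using frechet_derivative_symmetric_real[OF S smooth_on_linear_compose[OF S bounded_linear_inner_left f, of i] a]
    by (simp add: DD)
qed

lemma partial_commute:
  fixes f :: "real^'n::finite \<Rightarrow> 'b::euclidean_space"
  assumes "open S" "smooth_on S f" "u \<in> S"
  shows "partial \<mu> (partial \<nu> f) u = partial \<nu> (partial \<mu> f) u"
proof -
  have "partial \<mu> (partial \<nu> f) u =
      frechet_derivative (\<lambda>x. frechet_derivative f (at x) (axis \<nu> 1)) (at u) (axis \<mu> 1)" for \<mu> \<nu>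
    by (rule trans[OF partial_cong_open[OF assms(1,3) partial_eq_frechet[OF assms(1,2)]]
          partial_eq_frechet[OF assms(1) smooth_on_frechet[OF assms(2)] assms(3)]])
  then show ?thesis
    using frechet_derivative_symmetric[OF assms] by simp
qed

lemma partials_append: "partials (\<mu>s @ \<nu>s) f = partials \<mu>s (partials \<nu>s f)"
  by (induction \<mu>s) auto

lemma partials_move_front:
  fixes f :: "real^'n::finite \<Rightarrow> 'b::euclidean_space"
  assumes "open S" "smooth_on S f" "u \<in> S"
  shows "partials (\<mu>s @ \<mu> # \<nu>s) f u = partials (\<mu> # \<mu>s @ \<nu>s) f u"
  using assms(3)
proof (induction \<mu>s arbitrary: u)
  case (Cons a \<mu>s)
  have "partials ((a # \<mu>s) @ \<mu> # \<nu>s) f u = partial a (partial \<mu> (partials (\<mu>s @ \<nu>s) f)) u"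
    using partial_cong_open[OF assms(1) Cons.prems Cons.IH] by simp
  also have "\<dots> = partial \<mu> (partial a (partials (\<mu>s @ \<nu>s) f)) u"
    by (rule partial_commute[OF assms(1) smooth_on_partials[OF assms(1,2)] Cons.prems])
  finally show ?case by simp
qed simp

text \<open>Jet coordinates are labelled by multisets and evaluated on the sorted list; this makes
  the chosen order immaterial.\<close>

lemma partials_mset_cong:
  fixes f :: "real^'n::finite \<Rightarrow> 'b::euclidean_space"
  assumes "open S" "smooth_on S f" "u \<in> S" "mset \<mu>s = mset \<nu>s"
  shows "partials \<mu>s f u = partials \<nu>s f u"
  using assms(3,4)
proof (induction \<mu>s arbitrary: \<nu>s u)
  case (Cons \<mu> \<mu>s)
  then have "\<mu> \<in> set \<nu>s"
    by (metis list.set_intros(1) set_mset_mset)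
  then obtain xs ys where \<nu>s: "\<nu>s = xs @ \<mu> # ys"
    by (meson split_list)
  then have "mset \<mu>s = mset (xs @ ys)"
    using Cons.prems by simp
  then have "partials (\<mu> # \<mu>s) f u = partials (\<mu> # xs @ ys) f u"
    using partial_cong_open[OF assms(1) Cons.prems(1) Cons.IH] by simp
  then show ?case
    unfolding \<nu>s using partials_move_front[OF assms(1,2) Cons.prems(1)] by metis
qed simp

section \<open>Germs and their variations\<close>

text \<open>Smoothness on a whole neighbourhood: the property then passes to nearby points and to
  all partial derivatives, so germs can be differentiated without naming domains.\<close>

definition smooth_at :: "'a::real_normed_vector \<Rightarrow> ('a \<Rightarrow> 'b::real_normed_vector) \<Rightarrow> bool" where
  "smooth_at u f \<longleftrightarrow> (\<exists>S. open S \<and> u \<in> S \<and> smooth_on S f)"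

lemma smooth_atI: "open S \<Longrightarrow> u \<in> S \<Longrightarrow> smooth_on S f \<Longrightarrow> smooth_at u f"
  unfolding smooth_at_def by blast

lemma smooth_at_eventually: "smooth_at u f \<Longrightarrow> \<forall>\<^sub>F x in nhds u. smooth_at x f"
  unfolding smooth_at_def eventually_nhds by blast

lemma smooth_at_const: "smooth_at u (\<lambda>x. c)"
  using smooth_on_const[OF open_UNIV] by (rule smooth_atI[OF open_UNIV UNIV_I])

lemma smooth_at_linear_compose:
  assumes "bounded_linear h" "smooth_at u f"
  shows "smooth_at u (\<lambda>x. h (f x))"
  using assms(2) smooth_on_linear_compose[OF _ assms(1), of _ f] unfolding smooth_at_def by blast

lemma smooth_at_common:
  assumes "smooth_at u f" "smooth_at u g"
  obtains S where "open S" "u \<in> S" "smooth_on S f" "smooth_on S g"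
proof -
  obtain S T where "open S" "u \<in> S" "smooth_on S f" "open T" "u \<in> T" "smooth_on T g"
    using assms unfolding smooth_at_def by blast
  then show ?thesis
    using that[of "S \<inter> T"] smooth_on_subset[of S f "S \<inter> T"] smooth_on_subset[of T g "S \<inter> T"] by auto
qed

lemma smooth_at_add: "smooth_at u f \<Longrightarrow> smooth_at u g \<Longrightarrow> smooth_at u (\<lambda>x. f x + g x)"
  by (erule smooth_at_common, assumption) (metis smooth_atI smooth_on_add)

lemma smooth_at_bilinear:
  assumes "bounded_bilinear b" "smooth_at u f" "smooth_at u g"
  shows "smooth_at u (\<lambda>x. b (f x) (g x))"
  using assms(2,3) by (rule smooth_at_common) (rule smooth_atI[OF _ _ smooth_on_bilinear[OF _ assms(1)]])

lemma smooth_at_sum: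
  "(\<And>i. i \<in> I \<Longrightarrow> smooth_at u (f i)) \<Longrightarrow> smooth_at u (\<lambda>x. \<Sum>i\<in>I. f i x)"
  by (induction I rule: infinite_finite_induct) (auto simp: smooth_at_const smooth_at_add)

lemma smooth_at_partial: "smooth_at u f \<Longrightarrow> smooth_at u (partial \<mu> f)"
  unfolding smooth_at_def using smooth_on_partial[of _ f \<mu>] by blast

lemma smooth_at_partials: "smooth_at u f \<Longrightarrow> smooth_at u (partials \<mu>s f)"
  by (induction \<mu>s) (auto simp: smooth_at_partial)

lemma smooth_at_derivative:
  "smooth_at u f \<Longrightarrow> (f has_derivative frechet_derivative f (at u)) (at u)"
  unfolding smooth_at_def using smooth_on_derivative[of _ f u] by blast

lemma smooth_at_partial_eq:
  "smooth_at u f \<Longrightarrow> partial \<mu> f u = frechet_derivative f (at u) (axis \<mu> 1)"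
  by (rule has_derivative_partial(2)[OF smooth_at_derivative])

lemma smooth_at_isCont: "smooth_at u f \<Longrightarrow> isCont f u"
  by (rule has_derivative_continuous[OF smooth_at_derivative])

lemma smooth_at_frechet: "smooth_at u f \<Longrightarrow> smooth_at u (\<lambda>x. frechet_derivative f (at x) v)"
  unfolding smooth_at_def using smooth_on_frechet[of _ f v] by blast

lemma smooth_at_cong:
  assumes "\<forall>\<^sub>F x in nhds u. f x = g x" "smooth_at u f"
  shows "smooth_at u g"
proof -
  obtain S T where S: "open S" "u \<in> S" "smooth_on S f" and T: "open T" "u \<in> T" "\<And>x. x \<in> T \<Longrightarrow> f x = g x"
    using assms unfolding smooth_at_def eventually_nhds by blast
  have "smooth_on (S \<inter> T) g"
    by (rule smooth_on_cong[OF _ _ smooth_on_subset[OF S(3)]]) (use S T in auto)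
  then show ?thesis
    by (rule smooth_atI[rotated 2]) (use S T in auto)
qed

lemma smooth_at_compose:
  fixes f :: "'a::real_normed_vector \<Rightarrow> 'b::euclidean_space" and g :: "'b \<Rightarrow> 'c::real_normed_vector"
  assumes "smooth_at u f" "smooth_at (f u) g"
  shows "smooth_at u (\<lambda>x. g (f x))"
proof -
  obtain S T where S: "open S" "u \<in> S" "smooth_on S f" and T: "open T" "f u \<in> T" "smooth_on T g"
    using assms unfolding smooth_at_def by blast
  have o: "open (S \<inter> f -` T)"
    using continuous_open_preimage[OF smooth_on_continuous[OF S(3)] S(1) T(1)] .
  have "smooth_on (S \<inter> f -` T) (\<lambda>x. g (f x))"
    by (rule smooth_on_compose[OF o T(1) _ smooth_on_subset[OF S(3)] T(3)]) auto
  then show ?thesis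
    using S T by (intro smooth_atI[OF o]) auto
qed

lemma smooth_at_Pair: "smooth_at u f \<Longrightarrow> smooth_at u g \<Longrightarrow> smooth_at u (\<lambda>x. (f x, g x))"
  by (erule smooth_at_common, assumption) (metis smooth_atI smooth_on_Pair)

lemma smooth_on_iff_smooth_at: "open S \<Longrightarrow> smooth_on S f \<longleftrightarrow> (\<forall>x\<in>S. smooth_at x f)"
  unfolding smooth_at_def using smooth_on_local[of S f] by blast

lemma partial_cong_eventually:
  assumes "\<forall>\<^sub>F x in nhds u. f x = g x"
  shows "partial \<mu> f u = partial \<mu> g u"
  using assms partial_cong_open[of _ u f g \<mu>] unfolding eventually_nhds by blast

lemma partials_cong_eventually:
  assumes "\<forall>\<^sub>F x in nhds u. f x = g x"
  shows "partials \<mu>s f u = partials \<mu>s g u"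
  using assms partials_cong_open[of _ u f g \<mu>s] unfolding eventually_nhds by blast

lemma partial_linear_compose:
  "bounded_linear h \<Longrightarrow> smooth_at u f \<Longrightarrow> partial \<mu> (\<lambda>x. h (f x)) u = h (partial \<mu> f u)"
  by (simp add: smooth_at_partial_eq smooth_at_linear_compose
      frechet_derivative_linear_compose[OF _ smooth_at_derivative])

lemma partial_bilinear:
  assumes "bounded_bilinear b" "smooth_at u f" "smooth_at u g"
  shows "partial \<mu> (\<lambda>x. b (f x) (g x)) u = b (f u) (partial \<mu> g u) + b (partial \<mu> f u) (g u)"
  using has_derivative_partial(2)[OF bounded_bilinear.FDERIV[OF assms(1)
        smooth_at_derivative[OF assms(2)] smooth_at_derivative[OF assms(3)]]] assms
  by (simp add: smooth_at_partial_eq)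

lemma partial_add:
  assumes "smooth_at u f" "smooth_at u g"
  shows "partial \<mu> (\<lambda>x. f x + g x) u = partial \<mu> f u + partial \<mu> g u"
  using has_derivative_partial(2)[OF has_derivative_add[OF
        smooth_at_derivative[OF assms(1)] smooth_at_derivative[OF assms(2)]]] assms
  by (simp add: smooth_at_partial_eq)

lemma partial_sum:
  assumes "\<And>i. i \<in> I \<Longrightarrow> smooth_at u (f i)"
  shows "partial \<mu> (\<lambda>x. \<Sum>i\<in>I. f i x) u = (\<Sum>i\<in>I. partial \<mu> (f i) u)"
  using has_derivative_partial(2)[OF has_derivative_sum[of I, OF smooth_at_derivative[OF assms]]] assms
  by (simp add: smooth_at_partial_eq)

lemma partials_linear_compose:
  assumes "bounded_linear h"
  shows "smooth_at u f \<Longrightarrow> partials \<mu>s (\<lambda>x. h (f x)) u = h (partials \<mu>s f u)"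
proof (induction \<mu>s arbitrary: u)
  case (Cons \<mu> \<mu>s)
  have "\<forall>\<^sub>F x in nhds u. partials \<mu>s (\<lambda>x. h (f x)) x = h (partials \<mu>s f x)"
    using smooth_at_eventually[OF Cons.prems] by (rule eventually_mono) (rule Cons.IH)
  then show ?case
    using partial_linear_compose[OF assms smooth_at_partials[OF Cons.prems]]
    by (simp add: partial_cong_eventually)
qed simp

lemma partials_add:
  "smooth_at u f \<Longrightarrow> smooth_at u g \<Longrightarrow> partials \<mu>s (\<lambda>x. f x + g x) u = partials \<mu>s f u + partials \<mu>s g u"
proof (induction \<mu>s arbitrary: u)
  case (Cons \<mu> \<mu>s)
  have "\<forall>\<^sub>F x in nhds u. partials \<mu>s (\<lambda>x. f x + g x) x = partials \<mu>s f x + partials \<mu>s g x"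
    using eventually_conj[OF smooth_at_eventually[OF Cons.prems(1)] smooth_at_eventually[OF Cons.prems(2)]]
    by (rule eventually_mono) (simp add: Cons.IH)
  then show ?case
    using partial_add[OF smooth_at_partials[OF Cons.prems(1)] smooth_at_partials[OF Cons.prems(2)]]
    by (simp add: partial_cong_eventually)
qed simp

lemma partial_const: "partial \<mu> (\<lambda>x. c) = (\<lambda>x. 0)"
  unfolding partial_def by simp

lemma partials_zero: "partials \<mu>s (\<lambda>x. 0) = (\<lambda>x. 0)"
  by (induction \<mu>s) (auto simp: partial_const)

lemma partials_sum:
  assumes "\<And>i. i \<in> I \<Longrightarrow> smooth_at u (f i)"
  shows "partials \<mu>s (\<lambda>x. \<Sum>i\<in>I. f i x) u = (\<Sum>i\<in>I. partials \<mu>s (f i) u)"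
  using assms
proof (induction I rule: infinite_finite_induct)
  case (insert i I)
  then show ?case
    using partials_add[of u "f i" "\<lambda>x. \<Sum>i\<in>I. f i x"] smooth_at_sum[of I u f] by simp
qed (simp_all add: partials_zero)

text \<open>
  A family of germs at \<open>u\<close> whose jets of order \<open>k\<close> vary differentiably at \<open>t = 0\<close>; the germ \<open>G'\<close>
  only serves to record the velocity.
\<close>

definition jet_variation ::
  "nat \<Rightarrow> (real \<Rightarrow> real^'n::finite \<Rightarrow> 'b::real_normed_vector) \<Rightarrow> (real^'n \<Rightarrow> 'b) \<Rightarrow> real^'n \<Rightarrow> bool" where
  "jet_variation k G G' u \<longleftrightarrow> (\<forall>t. smooth_at u (G t)) \<and> smooth_at u G' \<and>
     (\<forall>\<mu>s. length \<mu>s \<le> k \<longrightarrow>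
        ((\<lambda>t. partials \<mu>s (G t) u) has_vector_derivative partials \<mu>s G' u) (at 0))"

lemma jet_variation_smooth:
  "jet_variation k G G' u \<Longrightarrow> smooth_at u (G t)" "jet_variation k G G' u \<Longrightarrow> smooth_at u G'"
  by (auto simp: jet_variation_def)

lemma jet_variation_le: "jet_variation k G G' u \<Longrightarrow> j \<le> k \<Longrightarrow> jet_variation j G G' u"
  by (auto simp: jet_variation_def)

lemma jet_variation_cong:
  assumes "jet_variation k G G' u" "\<And>t. \<forall>\<^sub>F x in nhds u. G t x = H t x" "\<forall>\<^sub>F x in nhds u. G' x = H' x"
  shows "jet_variation k H H' u"
proof -
  have "partials \<mu>s (G t) u = partials \<mu>s (H t) u" "partials \<mu>s G' u = partials \<mu>s H' u" for t \<mu>s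
    using partials_cong_eventually[OF assms(2)] partials_cong_eventually[OF assms(3)] .
  moreover have "smooth_at u (H t)" "smooth_at u H'" for t
    using smooth_at_cong[OF assms(2) jet_variation_smooth(1)[OF assms(1)]]
      smooth_at_cong[OF assms(3) jet_variation_smooth(2)[OF assms(1)]] .
  ultimately show ?thesis
    using assms(1) unfolding jet_variation_def by simp
qed

lemma jet_variation_0:
  "jet_variation 0 G G' u \<longleftrightarrow> (\<forall>t. smooth_at u (G t)) \<and> smooth_at u G' \<and>
     ((\<lambda>t. G t u) has_vector_derivative G' u) (at 0)"
  by (simp add: jet_variation_def)

text \<open>\<open>partials\<close> applies the last index of the list first, so a nonempty list
  splits at its end into a shorter iterated derivative of one partial derivative. The product and
  composition rules below induct along this recursion.\<close>

lemma jet_variation_Suc: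
  "jet_variation (Suc k) G G' u \<longleftrightarrow>
     jet_variation 0 G G' u \<and> (\<forall>\<mu>. jet_variation k (\<lambda>t. partial \<mu> (G t)) (partial \<mu> G') u)"
  (is "?L \<longleftrightarrow> ?R")
proof
  assume L: ?L
  show ?R
  proof (intro conjI allI)
    show "jet_variation 0 G G' u" using L by (rule jet_variation_le) simp
    fix \<mu>
    show "jet_variation k (\<lambda>t. partial \<mu> (G t)) (partial \<mu> G') u"
      unfolding jet_variation_def
    proof (intro conjI allI impI)
      fix \<mu>s :: "'a list" assume "length \<mu>s \<le> k"
      then have "length (\<mu>s @ [\<mu>]) \<le> Suc k" by simp
      then have "((\<lambda>t. partials (\<mu>s @ [\<mu>]) (G t) u) has_vector_derivative partials (\<mu>s @ [\<mu>]) G' u) (at 0)"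
        using L unfolding jet_variation_def by blast
      then show "((\<lambda>t. partials \<mu>s (partial \<mu> (G t)) u) has_vector_derivative partials \<mu>s (partial \<mu> G') u) (at 0)"
        by (simp add: partials_append)
    qed (use L in \<open>auto simp: jet_variation_def intro: smooth_at_partial\<close>)
  qed
next
  assume R: ?R
  show ?L
    unfolding jet_variation_def
  proof (intro conjI allI impI)
    fix \<mu>s :: "'a list" assume len: "length \<mu>s \<le> Suc k"
    show "((\<lambda>t. partials \<mu>s (G t) u) has_vector_derivative partials \<mu>s G' u) (at 0)"
    proof (cases \<mu>s rule: rev_cases)
      case Nil
      then show ?thesis using R by (simp add: jet_variation_0)
    next
      case (snoc \<nu>s \<mu>)
      then show ?thesis using R len by (simp add: jet_variation_def partials_append)
    qed
  qed (use R in \<open>auto simp: jet_variation_def\<close>)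
qed

lemma jet_variation_const: "smooth_at u g \<Longrightarrow> jet_variation k (\<lambda>t. g) (\<lambda>x. 0) u"
  by (simp add: jet_variation_def smooth_at_const partials_zero has_vector_derivative_const)

lemma jet_variation_linear:
  assumes "bounded_linear h" "jet_variation k G G' u"
  shows "jet_variation k (\<lambda>t x. h (G t x)) (\<lambda>x. h (G' x)) u"
  using assms(2) unfolding jet_variation_def
  by (simp add: partials_linear_compose smooth_at_linear_compose assms(1)
      bounded_linear.has_vector_derivative[OF assms(1)])

lemma jet_variation_add:
  assumes "jet_variation k G G' u" "jet_variation k H H' u"
  shows "jet_variation k (\<lambda>t x. G t x + H t x) (\<lambda>x. G' x + H' x) u"
  using assms unfolding jet_variation_def
  by (simp add: partials_add smooth_at_add has_vector_derivative_add)

lemma jet_variation_sum: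
  assumes "\<And>i. i \<in> I \<Longrightarrow> jet_variation k (G i) (G' i) u"
  shows "jet_variation k (\<lambda>t x. \<Sum>i\<in>I. G i t x) (\<lambda>x. \<Sum>i\<in>I. G' i x) u"
  using assms
proof (induction I rule: infinite_finite_induct)
  case (insert i I)
  then show ?case
    using jet_variation_add[of k "G i" "G' i" u "\<lambda>t x. \<Sum>i\<in>I. G i t x" "\<lambda>x. \<Sum>i\<in>I. G' i x"] by simp
qed (simp_all add: jet_variation_const smooth_at_const)

text \<open>Leibniz rule for variations. A partial derivative of the product is a sum of two
  products of variations of order \<open>k\<close>; the velocity is a germ too, and its partial
  derivative splits into the same four terms.\<close>

lemma jet_variation_bilinear:
  assumes b: "bounded_bilinear b" and "jet_variation k G G' u" "jet_variation k H H' u"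
  shows "jet_variation k (\<lambda>t x. b (G t x) (H t x)) (\<lambda>x. b (G 0 x) (H' x) + b (G' x) (H 0 x)) u"
  using assms(2,3)
proof (induction k arbitrary: G G' H H')
  case 0
  then show ?case
    using bounded_bilinear.has_vector_derivative[OF b, of "\<lambda>t. G t u" "G' u" 0 UNIV "\<lambda>t. H t u" "H' u"]
    by (simp add: jet_variation_0 smooth_at_bilinear[OF b] smooth_at_add)
next
  case (Suc k)
  note smG = jet_variation_smooth[OF Suc.prems(1)]
  note smH = jet_variation_smooth[OF Suc.prems(2)]
  show ?case
    unfolding jet_variation_Suc
  proof (intro conjI allI)
    show "jet_variation 0 (\<lambda>t x. b (G t x) (H t x)) (\<lambda>x. b (G 0 x) (H' x) + b (G' x) (H 0 x)) u"
      using Suc.prems bounded_bilinear.has_vector_derivative[OF b, of "\<lambda>t. G t u" "G' u" 0 UNIV "\<lambda>t. H t u" "H' u"]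
      by (simp add: jet_variation_Suc jet_variation_0 smooth_at_bilinear[OF b] smooth_at_add)
    fix \<mu>
    have G: "jet_variation k G G' u" "jet_variation k (\<lambda>t. partial \<mu> (G t)) (partial \<mu> G') u"
      using Suc.prems(1) jet_variation_le[OF Suc.prems(1), of k] by (auto simp: jet_variation_Suc)
    have H: "jet_variation k H H' u" "jet_variation k (\<lambda>t. partial \<mu> (H t)) (partial \<mu> H') u"
      using Suc.prems(2) jet_variation_le[OF Suc.prems(2), of k] by (auto simp: jet_variation_Suc)
    show "jet_variation k (\<lambda>t. partial \<mu> (\<lambda>x. b (G t x) (H t x)))
        (partial \<mu> (\<lambda>x. b (G 0 x) (H' x) + b (G' x) (H 0 x))) u"
    proof (rule jet_variation_cong[OF jet_variation_add[OF Suc.IH[OF G(1) H(2)] Suc.IH[OF G(2) H(1)]]])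
      fix t
      show "\<forall>\<^sub>F x in nhds u. b (G t x) (partial \<mu> (H t) x) + b (partial \<mu> (G t) x) (H t x) =
          partial \<mu> (\<lambda>x. b (G t x) (H t x)) x"
        using eventually_conj[OF smooth_at_eventually[OF smG(1)[of t]] smooth_at_eventually[OF smH(1)[of t]]]
        by (rule eventually_mono) (simp add: partial_bilinear[OF b])
    next
      show "\<forall>\<^sub>F x in nhds u. b (G 0 x) (partial \<mu> H' x) + b (G' x) (partial \<mu> (H 0) x) +
            (b (partial \<mu> (G 0) x) (H' x) + b (partial \<mu> G' x) (H 0 x)) =
          partial \<mu> (\<lambda>x. b (G 0 x) (H' x) + b (G' x) (H 0 x)) x"
        using eventually_conj[OF
            eventually_conj[OF smooth_at_eventually[OF smG(1)[of 0]] smooth_at_eventually[OF smG(2)]]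
            eventually_conj[OF smooth_at_eventually[OF smH(1)[of 0]] smooth_at_eventually[OF smH(2)]]]
        by (rule eventually_mono)
          (simp add: partial_bilinear[OF b] partial_add smooth_at_bilinear[OF b] algebra_simps)
    qed
  qed
qed

lemma partial_compose:
  fixes f :: "real^'n::finite \<Rightarrow> 'b::euclidean_space"
  assumes "smooth_at x f" "smooth_at (f x) T"
  shows "partial \<mu> (\<lambda>x. T (f x)) x =
    (\<Sum>i\<in>Basis. (partial \<mu> f x \<bullet> i) *\<^sub>R frechet_derivative T (at (f x)) i)"
  unfolding has_derivative_partial(2)[OF has_derivative_compose[OF
        smooth_at_derivative[OF assms(1)] smooth_at_derivative[OF assms(2)]]]
    smooth_at_partial_eq[OF assms(1), symmetric]
  by (rule linear_euclidean_sum[OF has_derivative_linear[OF smooth_at_derivative[OF assms(2)]]])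

lemma smooth_at_compose_eventually:
  assumes "smooth_at u f" "smooth_at (f u) T"
  shows "\<forall>\<^sub>F x in nhds u. smooth_at x f \<and> smooth_at (f x) T"
proof -
  have "(f \<longlongrightarrow> f u) (nhds u)"
    using smooth_at_isCont[OF assms(1)] by (simp add: isCont_def tendsto_nhds_iff)
  then have "\<forall>\<^sub>F x in nhds u. smooth_at (f x) T"
    by (rule eventually_compose_filterlim[OF smooth_at_eventually[OF assms(2)]])
  then show ?thesis
    using smooth_at_eventually[OF assms(1)] by eventually_elim simp
qed

lemma jet_variation_compose_0:
  fixes T :: "'b::euclidean_space \<Rightarrow> 'c::euclidean_space"
  assumes "jet_variation 0 G G' u" "\<And>t. smooth_at (G t u) T"
  shows "jet_variation 0 (\<lambda>t x. T (G t x)) (\<lambda>x. \<Sum>i\<in>Basis. (G' x \<bullet> i) *\<^sub>R frechet_derivative T (at (G 0 x)) i) u"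
  unfolding jet_variation_0
proof (intro conjI allI)
  note sm = jet_variation_smooth[OF assms(1)]
  show "smooth_at u (\<lambda>x. T (G t x))" for t
    by (rule smooth_at_compose[OF sm(1) assms(2)])
  show "smooth_at u (\<lambda>x. \<Sum>i\<in>Basis. (G' x \<bullet> i) *\<^sub>R frechet_derivative T (at (G 0 x)) i)"
    by (intro smooth_at_sum smooth_at_bilinear[OF bounded_bilinear_scaleR]
        smooth_at_linear_compose[OF bounded_linear_inner_left sm(2)]
        smooth_at_compose[OF sm(1) smooth_at_frechet[OF assms(2)]])
  have T: "(T has_derivative frechet_derivative T (at (G 0 u))) (at (G 0 u))"
    by (rule smooth_at_derivative[OF assms(2)])
  have "((\<lambda>t. G t u) has_derivative (\<lambda>t. t *\<^sub>R G' u)) (at 0)"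
    using assms(1) by (simp add: jet_variation_0 has_vector_derivative_def)
  from has_derivative_compose[OF this T]
  show "((\<lambda>t. T (G t u)) has_vector_derivative (\<Sum>i\<in>Basis. (G' u \<bullet> i) *\<^sub>R frechet_derivative T (at (G 0 u)) i)) (at 0)"
    unfolding linear_euclidean_sum[OF has_derivative_linear[OF T], symmetric]
    by (simp add: has_vector_derivative_def linear_cmul[OF has_derivative_linear[OF T]])
qed

text \<open>The velocity is the derivative of \<open>T\<close> at \<open>G 0\<close> applied to
  \<open>G'\<close>. The induction runs over \<open>T\<close>: a partial derivative of the composite
  is a sum of products of components of \<open>partial \<mu> (G t)\<close> with directional
  derivatives of \<open>T\<close> along \<open>G t\<close>, and the latter are composites of order
  \<open>k\<close>.\<close>

lemma jet_variation_compose: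
  fixes T :: "'b::euclidean_space \<Rightarrow> 'c::euclidean_space"
  assumes "jet_variation k G G' u" "\<And>t. smooth_at (G t u) T"
  shows "jet_variation k (\<lambda>t x. T (G t x)) (\<lambda>x. \<Sum>i\<in>Basis. (G' x \<bullet> i) *\<^sub>R frechet_derivative T (at (G 0 x)) i) u"
  using assms(2,1)
proof (induction k arbitrary: T)
  case 0
  then show ?case by (rule jet_variation_compose_0[rotated])
next
  case (Suc k)
  let ?D = "\<lambda>y i. frechet_derivative T (at y) i"
  let ?DD = "\<lambda>y i j. frechet_derivative (\<lambda>y. ?D y i) (at y) j"
  note sm = jet_variation_smooth[OF Suc.prems(2)]
  have G: "jet_variation 0 G G' u" "jet_variation k G G' u"
    and dG: "\<And>\<mu>. jet_variation k (\<lambda>t. partial \<mu> (G t)) (partial \<mu> G') u"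
    using Suc.prems(2) jet_variation_le[OF Suc.prems(2), of k] by (auto simp: jet_variation_Suc)
  show ?case
    unfolding jet_variation_Suc
  proof (intro conjI allI)
    show "jet_variation 0 (\<lambda>t x. T (G t x)) (\<lambda>x. \<Sum>i\<in>Basis. (G' x \<bullet> i) *\<^sub>R ?D (G 0 x) i) u"
      by (rule jet_variation_compose_0[OF G(1) Suc.prems(1)])
    fix \<mu>
    have var: "jet_variation k (\<lambda>t x. (partial \<mu> (G t) x \<bullet> i) *\<^sub>R ?D (G t x) i)
        (\<lambda>x. (partial \<mu> (G 0) x \<bullet> i) *\<^sub>R (\<Sum>j\<in>Basis. (G' x \<bullet> j) *\<^sub>R ?DD (G 0 x) i j) +
          (partial \<mu> G' x \<bullet> i) *\<^sub>R ?D (G 0 x) i) u" for i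
      by (rule jet_variation_bilinear[OF bounded_bilinear_scaleR
            jet_variation_linear[OF bounded_linear_inner_left dG]
            Suc.IH[OF smooth_at_frechet[OF Suc.prems(1)] G(2)]])
    show "jet_variation k (\<lambda>t. partial \<mu> (\<lambda>x. T (G t x)))
       (partial \<mu> (\<lambda>x. \<Sum>i\<in>Basis. (G' x \<bullet> i) *\<^sub>R ?D (G 0 x) i)) u"
    proof (rule jet_variation_cong[OF jet_variation_sum[of Basis, OF var]])
      fix t
      show "\<forall>\<^sub>F x in nhds u. (\<Sum>i\<in>Basis. (partial \<mu> (G t) x \<bullet> i) *\<^sub>R ?D (G t x) i) =
          partial \<mu> (\<lambda>x. T (G t x)) x"
        using smooth_at_compose_eventually[OF sm(1)[of t] Suc.prems(1)]
        by (rule eventually_mono) (simp add: partial_compose)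
    next
      have key: "(\<Sum>i\<in>Basis. (partial \<mu> (G 0) x \<bullet> i) *\<^sub>R (\<Sum>j\<in>Basis. (G' x \<bullet> j) *\<^sub>R ?DD (G 0 x) i j) +
            (partial \<mu> G' x \<bullet> i) *\<^sub>R ?D (G 0 x) i) =
          partial \<mu> (\<lambda>x. \<Sum>i\<in>Basis. (G' x \<bullet> i) *\<^sub>R ?D (G 0 x) i) x"
        if G0: "smooth_at x (G 0)" and T: "smooth_at (G 0 x) T" and G': "smooth_at x G'" for x
      proof -
        note sG' = smooth_at_linear_compose[OF bounded_linear_inner_left G']
        note sD = smooth_at_compose[OF G0 smooth_at_frechet[OF T]]
        \<comment> \<open>Varying the differentiated composite and differentiating the recorded
          velocity give the same double sum, except that the two directions of the second derivative
          of \<open>T\<close> are exchanged; its symmetry identifies them.\<close>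
        have sym: "?DD (G 0 x) i j = ?DD (G 0 x) j i" for i j
          using T frechet_derivative_symmetric[of _ T "G 0 x" i j] unfolding smooth_at_def by blast
        have "partial \<mu> (\<lambda>x. \<Sum>i\<in>Basis. (G' x \<bullet> i) *\<^sub>R ?D (G 0 x) i) x =
            (\<Sum>i\<in>Basis. (G' x \<bullet> i) *\<^sub>R (\<Sum>j\<in>Basis. (partial \<mu> (G 0) x \<bullet> j) *\<^sub>R ?DD (G 0 x) i j) +
              (partial \<mu> G' x \<bullet> i) *\<^sub>R ?D (G 0 x) i)"
          by (subst partial_sum[OF smooth_at_bilinear[OF bounded_bilinear_scaleR sG' sD]])
            (simp only: partial_bilinear[OF bounded_bilinear_scaleR sG' sD]
              partial_compose[OF G0 smooth_at_frechet[OF T]]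
              partial_linear_compose[OF bounded_linear_inner_left G'])
        moreover have "(\<Sum>i\<in>Basis. (G' x \<bullet> i) *\<^sub>R (\<Sum>j\<in>Basis. (partial \<mu> (G 0) x \<bullet> j) *\<^sub>R ?DD (G 0 x) i j)) =
            (\<Sum>i\<in>Basis. (partial \<mu> (G 0) x \<bullet> i) *\<^sub>R (\<Sum>j\<in>Basis. (G' x \<bullet> j) *\<^sub>R ?DD (G 0 x) i j))"
          unfolding scaleR_sum_right
          by (subst sum.swap) (intro sum.cong refl, simp add: sym mult.commute)
        ultimately show ?thesis
          by (simp only: sum.distrib)
      qed
      show "\<forall>\<^sub>F x in nhds u. (\<Sum>i\<in>Basis. (partial \<mu> (G 0) x \<bullet> i) *\<^sub>R (\<Sum>j\<in>Basis. (G' x \<bullet> j) *\<^sub>R ?DD (G 0 x) i j) +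
            (partial \<mu> G' x \<bullet> i) *\<^sub>R ?D (G 0 x) i) =
          partial \<mu> (\<lambda>x. \<Sum>i\<in>Basis. (G' x \<bullet> i) *\<^sub>R ?D (G 0 x) i) x"
        using eventually_conj[OF smooth_at_compose_eventually[OF sm(1)[of 0] Suc.prems(1)] smooth_at_eventually[OF sm(2)]]
        by (rule eventually_mono) (elim conjE, rule key)
    qed
  qed
qed

lemma partial_compose_vec:
  fixes \<phi> :: "real^'n::finite \<Rightarrow> real^'m::finite"
  assumes "smooth_at x \<phi>" "smooth_at (\<phi> x) g"
  shows "partial \<mu> (\<lambda>x. g (\<phi> x)) x = (\<Sum>j\<in>UNIV. (partial \<mu> \<phi> x $ j) *\<^sub>R partial j g (\<phi> x))"
proof -
  let ?D = "frechet_derivative g (at (\<phi> x))"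
  have D: "(g has_derivative ?D) (at (\<phi> x))"
    by (rule smooth_at_derivative[OF assms(2)])
  have lin: "?D v = (\<Sum>j\<in>UNIV. (v $ j) *\<^sub>R ?D (axis j 1))" for v
    by (subst basis_expansion[of v, symmetric], subst linear_sum[OF has_derivative_linear[OF D]])
      (simp add: linear_cmul[OF has_derivative_linear[OF D]] scalar_mult_eq_scaleR)
  show ?thesis
    unfolding has_derivative_partial(2)[OF has_derivative_compose[OF smooth_at_derivative[OF assms(1)] D]]
    by (subst lin) (simp add: smooth_at_partial_eq assms)
qed

text \<open>The substitution \<open>\<phi>\<close> does not depend on \<open>t\<close>: by the chain
  rule each partial derivative is a sum of fixed Jacobian coefficients times partial derivatives of
  \<open>G t\<close>, and the constant factors add nothing to the velocity.\<close>

lemma jet_variation_precompose: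
  fixes \<phi> :: "real^'n::finite \<Rightarrow> real^'m::finite"
  assumes \<phi>: "smooth_at u' \<phi>" "\<phi> u' = u" and "jet_variation k G G' u"
  shows "jet_variation k (\<lambda>t x. G t (\<phi> x)) (\<lambda>x. G' (\<phi> x)) u'"
  using assms(3)
proof (induction k arbitrary: G G')
  case 0
  then show ?case using assms by (simp add: jet_variation_0 smooth_at_compose)
next
  case (Suc k)
  note sm = jet_variation_smooth[OF Suc.prems, folded \<phi>(2)]
  show ?case
    unfolding jet_variation_Suc
  proof (intro conjI allI)
    show "jet_variation 0 (\<lambda>t x. G t (\<phi> x)) (\<lambda>x. G' (\<phi> x)) u'"
      using Suc.prems assms by (simp add: jet_variation_Suc jet_variation_0 smooth_at_compose)
    fix \<mu>
    have var: "jet_variation k (\<lambda>t x. (partial \<mu> \<phi> x $ j) *\<^sub>R partial j (G t) (\<phi> x))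
       (\<lambda>x. (partial \<mu> \<phi> x $ j) *\<^sub>R partial j G' (\<phi> x) + 0 *\<^sub>R partial j (G 0) (\<phi> x)) u'" for j
      using Suc.prems unfolding jet_variation_Suc
      by (intro jet_variation_bilinear[OF bounded_bilinear_scaleR jet_variation_const Suc.IH]
          smooth_at_linear_compose[OF bounded_linear_vec_nth smooth_at_partial[OF \<phi>(1)]]) blast
    show "jet_variation k (\<lambda>t. partial \<mu> (\<lambda>x. G t (\<phi> x))) (partial \<mu> (\<lambda>x. G' (\<phi> x))) u'"
    proof (rule jet_variation_cong[OF jet_variation_sum[of UNIV, OF var]])
      fix t
      show "\<forall>\<^sub>F x in nhds u'. (\<Sum>j\<in>UNIV. (partial \<mu> \<phi> x $ j) *\<^sub>R partial j (G t) (\<phi> x)) =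
          partial \<mu> (\<lambda>x. G t (\<phi> x)) x"
        using smooth_at_compose_eventually[OF \<phi>(1) sm(1)[of t]]
        by (rule eventually_mono) (simp add: partial_compose_vec)
    next
      show "\<forall>\<^sub>F x in nhds u'. (\<Sum>j\<in>UNIV. (partial \<mu> \<phi> x $ j) *\<^sub>R partial j G' (\<phi> x) +
            0 *\<^sub>R partial j (G 0) (\<phi> x)) = partial \<mu> (\<lambda>x. G' (\<phi> x)) x"
        using smooth_at_compose_eventually[OF \<phi>(1) sm(2)]
        by (rule eventually_mono) (simp add: partial_compose_vec)
    qed
  qed
qed

section \<open>Polynomials with prescribed jets\<close>

text \<open>The Taylor monomial at \<open>v\<close>, divided by the factorials so that
  differentiation by an index just removes it from \<open>M\<close>.\<close>

definition jet_monomial :: "real^'n::finite \<Rightarrow> 'n multiset \<Rightarrow> real^'n \<Rightarrow> real" where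
  "jet_monomial v M u = (\<Prod>i\<in>UNIV. (u $ i - v $ i) ^ count M i / fact (count M i))"

definition jet_polynomial ::
  "nat \<Rightarrow> real^'n::finite \<Rightarrow> ('n multiset \<Rightarrow> 'b::real_normed_vector) \<Rightarrow> real^'n \<Rightarrow> 'b" where
  "jet_polynomial k v a u = (\<Sum>M | size M \<le> k. jet_monomial v M u *\<^sub>R a M)"

lemma multisets_size_le_eq: "{M::'n multiset. size M \<le> k} = mset ` {xs. length xs \<le> k}"
proof -
  have "M \<in> mset ` {xs. length xs \<le> k}" if "size M \<le> k" for M :: "'n multiset"
    using that by (metis (mono_tags, lifting) ex_mset image_eqI mem_Collect_eq size_mset)
  then show ?thesis by auto
qed

lemma finite_lists_le: "finite {xs::'n::finite list. length xs \<le> k}"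
  using finite_lists_length_le[of "UNIV :: 'n set" k] by simp

lemma finite_multisets_size_le: "finite {M::'n::finite multiset. size M \<le> k}"
  unfolding multisets_size_le_eq using finite_lists_le by blast

lemma smooth_at_power: "smooth_at u f \<Longrightarrow> smooth_at u (\<lambda>x. f x ^ m :: real)"
proof (induction m)
  case (Suc m)
  then show ?case
    using smooth_at_bilinear[OF bounded_bilinear_mult Suc.prems Suc.IH] by simp
qed (simp add: smooth_at_const)

lemma smooth_at_prod:
  "(\<And>i. i \<in> I \<Longrightarrow> smooth_at u (f i)) \<Longrightarrow> smooth_at u (\<lambda>x. \<Prod>i\<in>I. f i x :: real)"
proof (induction I rule: infinite_finite_induct)
  case (insert i I)
  then show ?case
    using smooth_at_bilinear[OF bounded_bilinear_mult, of u "f i" "\<lambda>x. \<Prod>i\<in>I. f i x"] by simp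
qed (simp_all add: smooth_at_const)

lemma smooth_at_id: "smooth_at u (\<lambda>x. x)"
  by (rule smooth_atI[OF open_UNIV UNIV_I smooth_on_linear[OF open_UNIV bounded_linear_ident]])

lemma smooth_at_jet_monomial: "smooth_at u (jet_monomial v M)"
proof -
  have "smooth_at u (\<lambda>u. u $ i + - v $ i)" for i
    by (rule smooth_at_add[OF smooth_at_linear_compose[OF bounded_linear_vec_nth smooth_at_id] smooth_at_const])
  then have "smooth_at u (\<lambda>u. (1 / fact (count M i)) * (u $ i + - v $ i) ^ count M i)" for i
    by (rule smooth_at_bilinear[OF bounded_bilinear_mult smooth_at_const smooth_at_power])
  from smooth_at_prod[of UNIV, OF this] show ?thesis
    unfolding jet_monomial_def[abs_def] by simp
qed

lemma smooth_at_jet_polynomial: "smooth_at u (jet_polynomial k v a)"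
  unfolding jet_polynomial_def[abs_def]
  by (intro smooth_at_sum smooth_at_bilinear[OF bounded_bilinear_scaleR] smooth_at_jet_monomial smooth_at_const)

lemma partial_jet_monomial:
  "partial \<mu> (jet_monomial v M) u = (if \<mu> \<in># M then jet_monomial v (M - {#\<mu>#}) u else 0)"
proof -
  let ?p = "\<lambda>m s::real. s ^ m / fact m"
  let ?s = "u $ \<mu> - v $ \<mu>"
  \<comment> \<open>Along the coordinate line only the factor of \<open>\<mu>\<close> varies;
    \<open>R\<close> collects the others and is common to \<open>M\<close> and
    \<open>M - {#\<mu>#}\<close>.\<close>
  define R where "R = (\<Prod>i\<in>UNIV - {\<mu>}. ?p (count M i) (u $ i - v $ i))"
  have split: "jet_monomial v N (u + t *\<^sub>R axis \<mu> 1) = ?p (count N \<mu>) (?s + t) * R"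
    if "\<And>i. i \<noteq> \<mu> \<Longrightarrow> count N i = count M i" for N t
    unfolding jet_monomial_def R_def using that
    by (subst prod.remove[of UNIV \<mu>]) (auto simp: axis_def algebra_simps intro!: prod.cong)
  have "((\<lambda>t. ?p m (?s + t)) has_real_derivative (if m = 0 then 0 else ?p (m - 1) ?s)) (at 0)" for m
    by (cases m) (auto intro!: derivative_eq_intros simp del: of_nat_Suc power_Suc simp: fact_Suc)
  then have "((\<lambda>t. ?p (count M \<mu>) (?s + t) * R) has_real_derivative
      (if count M \<mu> = 0 then 0 else ?p (count M \<mu> - 1) ?s) * R) (at 0)"
    by (rule DERIV_cmult_right)
  then have "partial \<mu> (jet_monomial v M) u = (if count M \<mu> = 0 then 0 else ?p (count M \<mu> - 1) ?s) * R"
    unfolding partial_def split[of M, OF refl]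
    by (intro vector_derivative_at) (simp add: has_real_derivative_iff_has_vector_derivative)
  then show ?thesis
    using split[of "M - {#\<mu>#}" 0] by (auto simp: count_eq_zero_iff)
qed

lemma partials_jet_monomial:
  "partials \<mu>s (jet_monomial v M) u = (if mset \<mu>s \<subseteq># M then jet_monomial v (M - mset \<mu>s) u else 0)"
proof (induction \<mu>s arbitrary: u)
  case (Cons \<mu> \<mu>s)
  then have "partials \<mu>s (jet_monomial v M) = (if mset \<mu>s \<subseteq># M then jet_monomial v (M - mset \<mu>s) else (\<lambda>u. 0))"
    by auto
  moreover have "mset (\<mu> # \<mu>s) \<subseteq># M \<longleftrightarrow> mset \<mu>s \<subseteq># M \<and> \<mu> \<in># M - mset \<mu>s"
    by (force simp: subseteq_mset_def in_diff_count Suc_le_eq intro: less_imp_le_nat)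
  ultimately show ?case
    by (auto simp: partial_jet_monomial partial_const)
qed simp

lemma jet_monomial_at_base: "jet_monomial v M v = (if M = {#} then 1 else 0)"
proof (cases "M = {#}")
  case False
  then obtain i where "i \<in># M" by blast
  then have "\<exists>i. count M i \<noteq> 0" by (metis count_eq_zero_iff)
  then show ?thesis
    using False by (auto simp: jet_monomial_def prod_zero_iff zero_power)
qed (simp add: jet_monomial_def)

text \<open>After differentiation a monomial survives at its base point only if nothing is left of
  its multiset, so exactly the term of \<open>mset \<mu>s\<close> remains. Hence any coefficient
  family of order at most \<open>k\<close> is the jet of a polynomial.\<close>

lemma partials_jet_polynomial:
  fixes a :: "'n::finite multiset \<Rightarrow> 'b::real_normed_vector"
  shows "partials \<mu>s (jet_polynomial k v a) v = (if length \<mu>s \<le> k then a (mset \<mu>s) else 0)"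
proof -
  have "partials \<mu>s (\<lambda>u. jet_monomial v M u *\<^sub>R a M) v = (if M = mset \<mu>s then a M else 0)" for M
  proof -
    have "partials \<mu>s (\<lambda>u. jet_monomial v M u *\<^sub>R a M) v = partials \<mu>s (jet_monomial v M) v *\<^sub>R a M"
      by (rule partials_linear_compose[OF bounded_linear_scaleR_left smooth_at_jet_monomial])
    moreover have "M - mset \<mu>s = {#} \<longleftrightarrow> M \<subseteq># mset \<mu>s"
      by (rule Diff_eq_empty_iff_mset)
    ultimately show ?thesis
      by (auto simp: partials_jet_monomial jet_monomial_at_base)
  qed
  then have "partials \<mu>s (jet_polynomial k v a) v = (\<Sum>M | size M \<le> k. if M = mset \<mu>s then a M else 0)"
    unfolding jet_polynomial_def[abs_def]
    by (subst partials_sum) (auto intro!: smooth_at_bilinear[OF bounded_bilinear_scaleR] smooth_at_jet_monomial smooth_at_const)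
  then show ?thesis
    by (simp add: sum.delta' finite_multisets_size_le)
qed

section \<open>Charts\<close>

lemma is_chartD:
  assumes "is_chart c"
  shows "open (fst c)" "open (snd c ` fst c)" "inj_on (snd c) (fst c)"
    and "continuous_on (fst c) (snd c)" "continuous_on (snd c ` fst c) (chart_inv c)"
proof -
  obtain g where g: "homeomorphism (fst c) (snd c ` fst c) (snd c) g"
    and o: "open (fst c)" "open (snd c ` fst c)"
    using assms unfolding is_chart_def by blast
  show "open (fst c)" "open (snd c ` fst c)" using o .
  show inj: "inj_on (snd c) (fst c)"
    by (rule inj_on_inverseI[of _ g]) (rule homeomorphism_apply1[OF g])
  show "continuous_on (fst c) (snd c)" using g by (rule homeomorphism_cont1)
  have "chart_inv c u = g u" if "u \<in> snd c ` fst c" for u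
    using that g inj unfolding chart_inv_def
    by (auto simp: homeomorphism_apply1)
  then show "continuous_on (snd c ` fst c) (chart_inv c)"
    using homeomorphism_cont2[OF g] continuous_on_cong[of "snd c ` fst c" _ "chart_inv c" g] by blast
qed

lemma chart_inv_left: "is_chart c \<Longrightarrow> x \<in> fst c \<Longrightarrow> chart_inv c (snd c x) = x"
  unfolding chart_inv_def using is_chartD(3) by (rule inv_into_f_f)

lemma chart_inv_right: "u \<in> snd c ` fst c \<Longrightarrow> snd c (chart_inv c u) = u"
  unfolding chart_inv_def by (rule f_inv_into_f)

lemma chart_inv_in: "u \<in> snd c ` fst c \<Longrightarrow> chart_inv c u \<in> fst c"
  unfolding chart_inv_def by (rule inv_into_into)

lemma chart_image_eq:
  "is_chart c \<Longrightarrow> snd c ` (fst c \<inter> U) = snd c ` fst c \<inter> chart_inv c -` U"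
  using chart_inv_left[of c] chart_inv_right[of _ c] by fastforce

lemma chart_image_open: "is_chart c \<Longrightarrow> open U \<Longrightarrow> open (snd c ` (fst c \<inter> U))"
  unfolding chart_image_eq using is_chartD(2,5) continuous_open_preimage by blast

lemma max_atlas_chart: "c \<in> max_atlas A \<Longrightarrow> is_chart c"
  by (simp add: max_atlas_def)

lemma atlas_subset_max: "smooth_atlas A \<Longrightarrow> A \<subseteq> max_atlas A"
  by (auto simp: smooth_atlas_def max_atlas_def)

lemma atlas_chart_around:
  assumes "smooth_atlas A"
  obtains c where "c \<in> A" "c \<in> max_atlas A" "x \<in> fst c"
proof -
  have "x \<in> \<Union> (fst ` A)" using assms by (simp add: smooth_atlas_def)
  then show ?thesis using that atlas_subset_max[OF assms] by blast
qed

lemma compatible_smooth_at: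
  assumes "is_chart c" "is_chart d" "compatible c d" "x \<in> fst c" "x \<in> fst d"
  shows "smooth_at (snd c x) (\<lambda>u. snd d (chart_inv c u))"
  using assms is_chartD(1)[OF assms(2)]
  by (intro smooth_atI[OF chart_image_open[OF assms(1)]]) (auto simp: compatible_def comp_def)

lemma compatible_commute: "compatible c d \<longleftrightarrow> compatible d c"
  unfolding compatible_def by (auto simp: Int_commute)

text \<open>Charts of the maximal atlas are compatible with those of \<open>A\<close> by definition,
  but not yet with each other; the transition factors locally through a chart of \<open>A\<close>
  around \<open>x\<close>.\<close>

lemma transition_smooth_at:
  assumes A: "smooth_atlas A" and c: "c \<in> max_atlas A" and d: "d \<in> max_atlas A"
    and x: "x \<in> fst c" "x \<in> fst d"
  shows "smooth_at (snd c x) (\<lambda>u. snd d (chart_inv c u))"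
proof -
  obtain b where b: "b \<in> A" "x \<in> fst b" "is_chart b"
    using atlas_chart_around[OF A] max_atlas_chart by metis
  note ch = max_atlas_chart[OF c] max_atlas_chart[OF d] b(3)
  have "compatible c b" "compatible b d"
    using c d b(1) compatible_commute[of b d] by (simp_all add: max_atlas_def)
  then have 1: "smooth_at (snd c x) (\<lambda>u. snd b (chart_inv c u))"
    and 2: "smooth_at (snd b x) (\<lambda>u. snd d (chart_inv b u))"
    using compatible_smooth_at ch x b by blast+
  have "smooth_at (snd c x) (\<lambda>u. snd d (chart_inv b (snd b (chart_inv c u))))"
    by (rule smooth_at_compose[OF 1]) (use 2 chart_inv_left[OF ch(1) x(1)] in simp)
  moreover have "\<forall>\<^sub>F u in nhds (snd c x). u \<in> snd c ` (fst c \<inter> fst b)"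
    using x b by (intro eventually_nhds_in_open[OF chart_image_open[OF ch(1) is_chartD(1)[OF ch(3)]]]) auto
  then have "\<forall>\<^sub>F u in nhds (snd c x). snd d (chart_inv b (snd b (chart_inv c u))) = snd d (chart_inv c u)"
    by (rule eventually_mono) (auto simp: chart_inv_left ch)
  ultimately show ?thesis by (rule smooth_at_cong[rotated])
qed

lemma chart_eventually_in:
  assumes "is_chart c" "open U" "x \<in> fst c" "x \<in> U"
  shows "\<forall>\<^sub>F u in nhds (snd c x). u \<in> snd c ` fst c \<and> chart_inv c u \<in> U"
proof -
  have "\<forall>\<^sub>F u in nhds (snd c x). u \<in> snd c ` (fst c \<inter> U)"
    using assms by (intro eventually_nhds_in_open[OF chart_image_open]) auto
  then show ?thesis
    by (rule eventually_mono) (auto simp: chart_image_eq[OF assms(1)])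
qed

section \<open>Tangent spaces\<close>

lemma has_vector_derivative_compose_smooth:
  assumes "(f has_vector_derivative f') (at t)" "smooth_at (f t) g"
  shows "((\<lambda>t. g (f t)) has_vector_derivative frechet_derivative g (at (f t)) f') (at t)"
  using has_derivative_compose[OF assms(1)[unfolded has_vector_derivative_def] smooth_at_derivative[OF assms(2)]]
    linear_cmul[OF has_derivative_linear[OF smooth_at_derivative[OF assms(2)]]]
  by (simp add: has_vector_derivative_def)

lemma has_vector_derivative_eventually_cong:
  assumes "(f has_vector_derivative f') (at x)" "\<forall>\<^sub>F t in nhds x. f t = g t"
  shows "(g has_vector_derivative f') (at x)"
  using assms has_vector_derivative_cong_ev[of UNIV f g x f'] eventually_nhds_x_imp_x[OF assms(2)] by simp

text \<open>All components of \<open>v\<close> come from one and the same curve, so the transition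
  map can be differentiated along it.\<close>

lemma tangent_transition:
  assumes A: "smooth_atlas A" and v: "v \<in> tangent_space A x"
    and c: "c \<in> max_atlas A" "x \<in> fst c" and d: "d \<in> max_atlas A" "x \<in> fst d"
  shows "v d = frechet_derivative (\<lambda>u. snd d (chart_inv c u)) (at (snd c x)) (v c)"
proof -
  obtain \<gamma> where \<gamma>: "\<gamma> 0 = x" and in_dom: "\<And>c. c \<in> max_atlas A \<Longrightarrow> x \<in> fst c \<Longrightarrow> \<forall>\<^sub>F t in at 0. \<gamma> t \<in> fst c"
    and diff: "\<And>c. c \<in> max_atlas A \<Longrightarrow> x \<in> fst c \<Longrightarrow> (snd c \<circ> \<gamma>) differentiable (at 0)"
    and v: "v = (\<lambda>c. if c \<in> max_atlas A \<and> x \<in> fst c then vector_derivative (snd c \<circ> \<gamma>) (at 0) else 0)"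
    using v unfolding tangent_space_def by auto
  have der: "((\<lambda>t. snd c (\<gamma> t)) has_vector_derivative v c) (at 0)" if "c \<in> max_atlas A" "x \<in> fst c" for c
    using diff[OF that] that by (simp add: v vector_derivative_works comp_def)
  have der': "((\<lambda>t. snd d (chart_inv c (snd c (\<gamma> t)))) has_vector_derivative
      frechet_derivative (\<lambda>u. snd d (chart_inv c u)) (at (snd c x)) (v c)) (at 0)"
    using has_vector_derivative_compose_smooth[OF der[OF c], of "\<lambda>u. snd d (chart_inv c u)"]
      transition_smooth_at[OF A c(1) d(1) c(2) d(2)] by (simp add: \<gamma>)
  have "\<forall>\<^sub>F t in at 0. snd d (chart_inv c (snd c (\<gamma> t))) = snd d (\<gamma> t)"
    using in_dom[OF c] by (rule eventually_mono) (simp add: chart_inv_left max_atlas_chart[OF c(1)])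
  then have "\<forall>\<^sub>F t in nhds 0. snd d (chart_inv c (snd c (\<gamma> t))) = snd d (\<gamma> t)"
    using \<gamma> c by (simp add: eventually_nhds_conv_at chart_inv_left max_atlas_chart)
  then have "((\<lambda>t. snd d (\<gamma> t)) has_vector_derivative
      frechet_derivative (\<lambda>u. snd d (chart_inv c u)) (at (snd c x)) (v c)) (at 0)"
    by (rule has_vector_derivative_eventually_cong[OF der'])
  then show ?thesis
    using der[OF d] vector_derivative_unique_at by blast
qed

lemma tangent_space_surj:
  assumes A: "smooth_atlas A" and c: "c \<in> max_atlas A" "x \<in> fst c"
  shows "\<exists>v\<in>tangent_space A x. v c = w"
proof -
  note ch = max_atlas_chart[OF c(1)]
  \<comment> \<open>A curve must be total: it follows the straight line in the chart
    \<open>c\<close> and rests at \<open>x\<close> where the line leaves the chart image, which does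
    not happen near \<open>0\<close>.\<close>
  define \<gamma> where "\<gamma> t = (let u = snd c x + t *\<^sub>R w in if u \<in> snd c ` fst c then chart_inv c u else x)" for t :: real
  define v where "v = (\<lambda>c. if c \<in> max_atlas A \<and> x \<in> fst c then vector_derivative (snd c \<circ> \<gamma>) (at 0) else 0)"
  have line: "((\<lambda>t. snd c x + t *\<^sub>R w) has_vector_derivative w) (at 0)"
    by (auto intro!: derivative_eq_intros)
  have "((\<lambda>t. snd c x + t *\<^sub>R w) \<longlongrightarrow> snd c x + 0 *\<^sub>R w) (nhds 0)"
    by (intro tendsto_intros filterlim_ident)
  then have lim: "((\<lambda>t. snd c x + t *\<^sub>R w) \<longlongrightarrow> snd c x) (nhds 0)"
    by simp
  have ev: "\<forall>\<^sub>F t in nhds 0. \<gamma> t = chart_inv c (snd c x + t *\<^sub>R w) \<and> \<gamma> t \<in> fst d"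
    if "d \<in> max_atlas A" "x \<in> fst d" for d
    using eventually_compose_filterlim[OF chart_eventually_in[OF ch is_chartD(1)[OF max_atlas_chart[OF that(1)]] c(2) that(2)] lim]
    by (rule eventually_mono) (simp add: \<gamma>_def)
  have der: "((snd d \<circ> \<gamma>) has_vector_derivative
      frechet_derivative (\<lambda>u. snd d (chart_inv c u)) (at (snd c x)) w) (at 0)"
    if "d \<in> max_atlas A" "x \<in> fst d" for d
  proof (rule has_vector_derivative_eventually_cong)
    show "((\<lambda>t. snd d (chart_inv c (snd c x + t *\<^sub>R w))) has_vector_derivative
        frechet_derivative (\<lambda>u. snd d (chart_inv c u)) (at (snd c x)) w) (at 0)"
      using has_vector_derivative_compose_smooth[OF line, of "\<lambda>u. snd d (chart_inv c u)"]
        transition_smooth_at[OF A c(1) that(1) c(2) that(2)] by simp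
    show "\<forall>\<^sub>F t in nhds 0. snd d (chart_inv c (snd c x + t *\<^sub>R w)) = (snd d \<circ> \<gamma>) t"
      using ev[OF that] by (rule eventually_mono) simp
  qed
  have "((snd c \<circ> \<gamma>) has_vector_derivative w) (at 0)"
  proof (rule has_vector_derivative_eventually_cong[OF line])
    show "\<forall>\<^sub>F t in nhds 0. snd c x + t *\<^sub>R w = (snd c \<circ> \<gamma>) t"
      using eventually_compose_filterlim[OF chart_eventually_in[OF ch open_UNIV c(2) UNIV_I] lim]
      by (rule eventually_mono) (simp add: \<gamma>_def chart_inv_right)
  qed
  then have "v c = w"
    using c by (simp add: v_def vector_derivative_at)
  moreover have "\<gamma> 0 = x"
    using c chart_inv_left[OF ch c(2)] by (simp add: \<gamma>_def)
  moreover have "\<forall>\<^sub>F t in at 0. \<gamma> t \<in> fst d" "(snd d \<circ> \<gamma>) differentiable (at 0)"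
    if "d \<in> max_atlas A" "x \<in> fst d" for d
    using ev[OF that] der[OF that] by (auto simp: eventually_nhds_conv_at eventually_conj_iff vector_derivative_works
        dest: differentiableI_vector)
  ultimately show ?thesis
    by (intro bexI[of _ v]) (auto simp: tangent_space_def v_def)
qed

lemma tangent_space_outside:
  "v \<in> tangent_space A x \<Longrightarrow> \<not> (d \<in> max_atlas A \<and> x \<in> fst d) \<Longrightarrow> v d = 0"
  unfolding tangent_space_def by auto

lemma tangent_vector_eqI:
  assumes "smooth_atlas A" "c \<in> max_atlas A" "x \<in> fst c"
    and "v \<in> tangent_space A x" "w \<in> tangent_space A x" "v c = w c"
  shows "v = w"
proof
  fix d
  show "v d = w d"
    using tangent_transition[OF assms(1) _ assms(2,3), of v d] tangent_transition[OF assms(1) _ assms(2,3), of w d]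
      tangent_space_outside[of v A x d] tangent_space_outside[of w A x d] assms by (cases "d \<in> max_atlas A \<and> x \<in> fst d") simp_all
qed

text \<open>Curves cannot be added. A vector with the desired components in one chart is realised by
  a curve instead, and linearity of the transitions gives the other components.\<close>

lemma tangent_space_linear:
  assumes A: "smooth_atlas A" and v: "v \<in> tangent_space A x" "w \<in> tangent_space A x"
  shows "(\<lambda>d. a *\<^sub>R v d + b *\<^sub>R w d) \<in> tangent_space A x"
proof -
  obtain c where c: "c \<in> max_atlas A" "x \<in> fst c"
    using atlas_chart_around[OF A] by blast
  obtain z where z: "z \<in> tangent_space A x" "z c = a *\<^sub>R v c + b *\<^sub>R w c"
    using tangent_space_surj[OF A c] by blast
  have "z d = a *\<^sub>R v d + b *\<^sub>R w d" for d
  proof (cases "d \<in> max_atlas A \<and> x \<in> fst d")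
    case True
    then have d: "d \<in> max_atlas A" "x \<in> fst d" by auto
    have "linear (frechet_derivative (\<lambda>u. snd d (chart_inv c u)) (at (snd c x)))"
      using has_derivative_linear[OF smooth_at_derivative[OF transition_smooth_at[OF A c(1) d(1) c(2) d(2)]]] .
    then show ?thesis
      unfolding tangent_transition[OF A z(1) c d] tangent_transition[OF A v(1) c d]
        tangent_transition[OF A v(2) c d] z(2)
      by (simp add: linear_add linear_cmul)
  next
    case False
    then show ?thesis
      using tangent_space_outside[OF v(1)] tangent_space_outside[OF v(2)] tangent_space_outside[OF z(1)] by simp
  qed
  then have "z = (\<lambda>d. a *\<^sub>R v d + b *\<^sub>R w d)" by (rule ext)
  then show ?thesis using z(1) by simp
qed

section \<open>Exterior forms of degree \<open>n\<close> and \<open>n - 1\<close>\<close>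

text \<open>The conditions of \<open>forms_at\<close>, transferred to lists of coordinate vectors,
  where determinants are available.\<close>

definition multilinear_alternating :: "nat \<Rightarrow> ('a::real_vector list \<Rightarrow> real) \<Rightarrow> bool" where
  "multilinear_alternating m D \<longleftrightarrow>
     (\<forall>vs j v w a b. length vs = m \<and> j < m \<longrightarrow>
        D (vs[j := a *\<^sub>R v + b *\<^sub>R w]) = a * D (vs[j := v]) + b * D (vs[j := w])) \<and>
     (\<forall>vs i j. length vs = m \<and> i < j \<and> j < m \<and> vs ! i = vs ! j \<longrightarrow> D vs = 0)"

lemma multilinear_alternatingD:
  assumes "multilinear_alternating m D" "length vs = m"
  shows "j < m \<Longrightarrow> D (vs[j := a *\<^sub>R v + b *\<^sub>R w]) = a * D (vs[j := v]) + b * D (vs[j := w])"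
    and "i \<noteq> j \<Longrightarrow> i < m \<Longrightarrow> j < m \<Longrightarrow> vs ! i = vs ! j \<Longrightarrow> D vs = 0"
  using assms unfolding multilinear_alternating_def by (blast, metis linorder_neqE_nat)

lemma alternating_sum:
  assumes D: "multilinear_alternating m D" "length vs = m" "j < m"
  shows "D (vs[j := \<Sum>i\<in>I. c i *\<^sub>R b i]) = (\<Sum>i\<in>I. c i * D (vs[j := b i]))"
proof (induction I rule: infinite_finite_induct)
  case (insert i I)
  then show ?case
    using multilinear_alternatingD(1)[OF D, of "c i" "b i" 1 "\<Sum>i\<in>I. c i *\<^sub>R b i"] by simp
qed (use multilinear_alternatingD(1)[OF D, of 0 0 0 0] in simp_all)

text \<open>Polarisation: the value with \<open>vs ! i + vs ! j\<close> in both places vanishes, and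
  so do the two terms of its expansion with a repeated entry.\<close>

lemma alternating_swap:
  assumes D: "multilinear_alternating m D" and len: "length vs = m" and ij: "i < m" "j < m" "i \<noteq> j"
  shows "D (vs[i := vs ! j, j := vs ! i]) = - D vs"
proof -
  let ?x = "vs ! i" and ?y = "vs ! j"
  have add: "D (ws[l := v + w]) = D (ws[l := v]) + D (ws[l := w])" if "length ws = m" "l < m" for ws l v w
    using multilinear_alternatingD(1)[OF D that, of 1 v 1 w] by simp
  have zero: "D (vs[i := z, j := z]) = 0" for z
    using multilinear_alternatingD(2)[OF D, of "vs[i := z, j := z]" i j] ij len by simp
  have upd: "vs[j := ?x, i := ?x] = vs[i := ?x, j := ?x]" "vs[j := ?x, i := ?y] = vs[i := ?y, j := ?x]"
    "vs[j := ?y, i := ?x] = vs" "vs[j := ?y, i := ?y] = vs[i := ?y, j := ?y]"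
    using ij len by (auto intro!: nth_equalityI simp: nth_list_update)
  have "D (vs[i := ?x + ?y, j := ?x + ?y]) = D (vs[i := ?x + ?y, j := ?x]) + D (vs[i := ?x + ?y, j := ?y])"
    by (rule add) (use len ij in simp_all)
  also have "\<dots> = D (vs[j := ?x, i := ?x + ?y]) + D (vs[j := ?y, i := ?x + ?y])"
    using ij list_update_swap[of i j vs "?x + ?y"] by simp
  also have "\<dots> = D (vs[j := ?x, i := ?x]) + D (vs[j := ?x, i := ?y]) + (D (vs[j := ?y, i := ?x]) + D (vs[j := ?y, i := ?y]))"
    using add[of "vs[j := ?x]" i ?x ?y] add[of "vs[j := ?y]" i ?x ?y] len ij by simp
  also have "\<dots> = D (vs[i := ?y, j := ?x]) + D vs"
    unfolding upd by (simp only: zero add_0_left add_0_right)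
  finally show ?thesis using zero[of "?x + ?y"] by simp
qed

text \<open>Each transposition changes only the sign; tracking the vanishing of \<open>D\<close>
  alone avoids recording the sign of the permutation.\<close>

lemma alternating_perm_zero:
  assumes D: "multilinear_alternating m D" and len: "length vs = m" and "mset vs = mset ws"
    and "D vs = 0"
  shows "D ws = 0"
proof -
  obtain p where p: "p permutes {..<length vs}" "permute_list p vs = ws"
    using mset_eq_permutation[OF assms(3)[symmetric]] by blast
  have "\<forall>vs. length vs = m \<longrightarrow> D vs = 0 \<longrightarrow> D (permute_list p vs) = 0"
    using p(1)[unfolded len] finite_lessThan
  proof (induction p rule: permutes_induct)
    case (swap a b p)
    show ?case
    proof (intro allI impI)
      fix vs assume vs: "length vs = m" "D vs = 0"
      have "permute_list (Transposition.transpose a b) vs = vs[a := vs ! b, b := vs ! a]"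
        using vs swap.hyps
        by (intro nth_equalityI) (auto simp: permute_list_def nth_list_update transpose_def)
      then have "D (permute_list (Transposition.transpose a b) vs) = 0"
        using alternating_swap[OF D vs(1), of a b] swap.hyps vs(2) by simp
      then show "D (permute_list (Transposition.transpose a b \<circ> p) vs) = 0"
        using swap vs(1) by (simp add: permute_list_compose)
    qed
  qed simp
  then show ?thesis using len p assms(4) by blast
qed

lemma alternating_eq_zero:
  fixes D :: "(real^'n::finite) list \<Rightarrow> real"
  assumes D: "multilinear_alternating m D"
    and zero: "\<And>is. length is = m \<Longrightarrow> distinct is \<Longrightarrow> D (map (\<lambda>i. axis i 1) is) = 0"
    and "length vs = m"
  shows "D vs = 0"
proof -
  \<comment> \<open>Entries from position \<open>k\<close> on are basis vectors; the induction step
    expands the entry at \<open>k\<close> and so enlarges that range by one.\<close>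
  have "D vs = 0" if "length vs = m" "k \<le> m" "\<forall>j. k \<le> j \<and> j < m \<longrightarrow> vs ! j \<in> range (\<lambda>i. axis i 1)" for k vs
    using that
  proof (induction k arbitrary: vs)
    case 0
    then have "set vs \<subseteq> range (\<lambda>i. axis i 1)"
      by (auto simp: in_set_conv_nth)
    then obtain "is" where vs: "vs = map (\<lambda>i. axis i 1) is"
      by (metis ex_map_conv subset_code(1) rangeE)
    show ?case
    proof (cases "distinct is")
      case False
      then obtain i j where "i < length is" "j < length is" "i \<noteq> j" "is ! i = is ! j"
        by (auto simp: distinct_conv_nth)
      then show ?thesis
        using multilinear_alternatingD(2)[OF D 0(1), of i j] 0(1) vs by simp
    qed (use zero vs 0 in simp)
  next
    case (Suc k)
    have "vs ! k = (\<Sum>i\<in>UNIV. (vs ! k $ i) *\<^sub>R axis i 1)"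
      by (simp add: basis_expansion flip: scalar_mult_eq_scaleR)
    then have "D vs = D (vs[k := \<Sum>i\<in>UNIV. (vs ! k $ i) *\<^sub>R axis i 1])"
      by (metis list_update_id)
    also have "\<dots> = (\<Sum>i\<in>UNIV. (vs ! k $ i) * D (vs[k := axis i 1]))"
      by (rule alternating_sum[OF D Suc.prems(1)]) (use Suc in simp)
    also have "\<dots> = 0"
    proof (rule sum.neutral, safe)
      fix i
      have "D (vs[k := axis i 1]) = 0"
        by (rule Suc.IH) (use Suc.prems in \<open>auto simp: nth_list_update\<close>)
      then show "(vs ! k $ i) * D (vs[k := axis i 1]) = 0" by simp
    qed
    finally show ?case .
  qed
  from this[OF assms(3) order_refl] show ?thesis by (meson not_less)
qed

section \<open>Determinants of lists of columns\<close>

definition col_index :: "'n::{finite,linorder} \<Rightarrow> nat" where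
  "col_index j = card {j'. j' < j}"

lemma col_index_bij: "bij_betw col_index (UNIV :: 'n::{finite,linorder} set) {..<CARD('n)}"
proof -
  have inj: "inj (col_index :: 'n \<Rightarrow> nat)"
  proof (rule linorder_injI)
    fix x y :: 'n assume "x < y"
    then have "{j. j < x} \<subset> {j. j < y}" by auto
    then have "col_index x < col_index y"
      unfolding col_index_def by (rule psubset_card_mono[rotated]) simp
    then show "col_index x \<noteq> col_index y" by simp
  qed
  have "col_index x < CARD('n)" for x :: 'n
    unfolding col_index_def by (rule psubset_card_mono) auto
  then have "range (col_index :: 'n \<Rightarrow> nat) \<subseteq> {..<CARD('n)}" by auto
  moreover have "card (range (col_index :: 'n \<Rightarrow> nat)) = CARD('n)"
    using inj by (rule card_image)
  ultimately have "range (col_index :: 'n \<Rightarrow> nat) = {..<CARD('n)}"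
    by (intro card_subset_eq) auto
  then show ?thesis using inj by (simp add: bij_betw_def)
qed

text \<open>Transposition: the rules for sums, multiples and equal entries used below are about
  rows, while the list gives columns.\<close>

lemma det_list_rows:
  fixes vs :: "(real, 'n::{finite,linorder}) vec list"
  shows "det_list vs = det (\<chi> j. vs ! col_index j)"
proof -
  have "(\<chi> i (j::'n). (vs ! card {j'. j' < j}) $ i) = transpose (\<chi> j. vs ! col_index j)"
    by (simp add: transpose_def col_index_def vec_eq_iff)
  then show ?thesis unfolding det_list_def by (simp only: det_transpose)
qed

lemma det_list_alternating:
  "multilinear_alternating CARD('n) (det_list :: (real, 'n::{finite,linorder}) vec list \<Rightarrow> real)"
  unfolding multilinear_alternating_def
proof (intro conjI allI impI; elim conjE)
  fix vs :: "(real, 'n) vec list" and k v w a b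
  assume len: "length vs = CARD('n)" and k: "k < CARD('n)"
  obtain l :: 'n where l: "col_index l = k"
    using col_index_bij k by (metis bij_betw_imp_surj_on imageE lessThan_iff)
  have inj: "col_index j = k \<longleftrightarrow> j = l" for j :: 'n
    using col_index_bij l by (metis bij_betw_imp_inj_on injD)
  have idx: "col_index j < CARD('n)" for j :: 'n
    using col_index_bij by (metis UNIV_I bij_betwE lessThan_iff)
  have upd: "det_list (vs[k := z]) = det (\<chi> j. if j = l then z else vs ! col_index j)" for z
  proof -
    have "vs[k := z] ! col_index j = (if j = l then z else vs ! col_index j)" for j
      using inj[of j] k by (auto simp: nth_list_update len)
    then show ?thesis unfolding det_list_rows by simp
  qed
  show "det_list (vs[k := a *\<^sub>R v + b *\<^sub>R w]) = a * det_list (vs[k := v]) + b * det_list (vs[k := w])"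
    unfolding upd by (simp add: det_row_add det_row_mul[where 'a = real, unfolded scalar_mult_eq_scaleR])
next
  fix vs :: "(real, 'n) vec list" and i j
  assume len: "length vs = CARD('n)" and ij: "i < j" "j < CARD('n)" and eq: "vs ! i = vs ! j"
  obtain i' :: 'n where i': "col_index i' = i"
    using col_index_bij ij by (metis bij_betw_imp_surj_on imageE lessThan_iff less_trans)
  obtain j' :: 'n where j': "col_index j' = j"
    using col_index_bij ij by (metis bij_betw_imp_surj_on imageE lessThan_iff)
  have "i' \<noteq> j'" using i' j' ij by auto
  then show "det_list vs = 0"
    unfolding det_list_rows by (rule det_identical_rows) (simp add: row_def i' j' eq)
qed

text \<open>The columns are those of the unit matrix in permuted order, so the determinant is a
  sign.\<close>

lemma det_list_axis:
  fixes "is" :: "'n::{finite,linorder} list"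
  assumes "distinct is" "length is = CARD('n)"
  shows "det_list (map (\<lambda>i. axis i 1) is) \<noteq> 0"
proof -
  define p where "p j = is ! col_index j" for j :: 'n
  have idx: "col_index j < length is" for j :: 'n
    using col_index_bij assms(2) by (metis UNIV_I bij_betwE lessThan_iff)
  have "inj p"
  proof (rule injI)
    fix x y assume "p x = p y"
    then have "col_index x = col_index y"
      using assms(1) idx by (simp add: p_def nth_eq_iff_index_eq)
    then show "x = y" using col_index_bij by (metis bij_betw_imp_inj_on injD)
  qed
  then have "p permutes UNIV"
    using finite_UNIV_inj_surj[of p] by (intro bij_imp_permutes) (auto simp: bij_betw_def)
  from det_permute_rows[OF this, of "mat 1 :: ((real, 'n) vec, 'n) vec"]
  have "det (\<chi> j. (mat 1 :: ((real, 'n) vec, 'n) vec) $ p j) = of_int (sign p)"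
    by simp
  moreover have "(mat 1 :: ((real, 'n) vec, 'n) vec) $ k = axis k 1" for k
    by (auto simp: axis_def mat_def vec_eq_iff)
  ultimately have "det (\<chi> j. (axis (p j) 1 :: (real, 'n) vec)) = of_int (sign p)"
    by simp
  then have "det_list (map (\<lambda>i. axis i 1) is) = of_int (sign p)"
    using idx by (simp add: det_list_rows p_def)
  then show ?thesis by (simp add: sign_def)
qed

text \<open>The order of the enumeration affects only signs, and these cancel in the quotient that
  defines the coefficients in \<open>contraction_surj\<close>.\<close>

definition omit_list :: "'n::finite \<Rightarrow> 'n list" where
  "omit_list \<kappa> = (SOME is. distinct is \<and> set is = UNIV - {\<kappa>})"

lemma omit_list: "distinct (omit_list \<kappa>)" "set (omit_list \<kappa>) = UNIV - {\<kappa>}"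
proof -
  have "\<exists>is. distinct is \<and> set is = UNIV - {\<kappa>}"
    using finite_distinct_list[of "UNIV - {\<kappa>}"] by auto
  from someI_ex[OF this] show "distinct (omit_list \<kappa>)" "set (omit_list \<kappa>) = UNIV - {\<kappa>}"
    unfolding omit_list_def by auto
qed

lemma length_omit_list: "length (omit_list (\<kappa>::'n::finite)) = CARD('n) - 1"
  using distinct_card[OF omit_list(1)[of \<kappa>]] by (simp add: omit_list(2) card_Diff_singleton)

text \<open>Putting \<open>\<kappa>\<close> in front of the list completes a basis, any other index
  repeats an entry; thus evaluation on \<open>omit_list \<kappa>\<close> isolates the coefficient of
  index \<open>\<kappa>\<close>.\<close>

lemma det_list_omit:
  fixes \<kappa> \<nu> :: "'n::{finite,linorder}"
  shows "det_list (axis \<nu> 1 # map (\<lambda>i. axis i 1) (omit_list \<kappa>)) = 0 \<longleftrightarrow> \<nu> \<noteq> \<kappa>"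
proof -
  have len: "length (\<nu> # omit_list \<kappa>) = CARD('n)"
    by (simp add: length_omit_list)
  show ?thesis
  proof (cases "\<nu> = \<kappa>")
    case True
    then show ?thesis
      using det_list_axis[of "\<kappa> # omit_list \<kappa>"] len omit_list[of \<kappa>] by simp
  next
    case False
    then have "\<nu> \<in> set (omit_list \<kappa>)" by (simp add: omit_list)
    then obtain i where "i < length (omit_list \<kappa>)" "omit_list \<kappa> ! i = \<nu>"
      by (auto simp: in_set_conv_nth)
    then show ?thesis
      using multilinear_alternatingD(2)[OF det_list_alternating, of "axis \<nu> 1 # map (\<lambda>i. axis i 1) (omit_list \<kappa>)" 0 "Suc i"]
        len False by simp
  qed
qed

text \<open>The formula of \<open>sub_form\<close> on component vectors in place of tangent
  vectors.\<close>

definition contraction :: "(real, 'n::{finite,linorder}) vec \<Rightarrow> (real, 'n) vec list \<Rightarrow> real" where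
  "contraction a ws = (\<Sum>\<kappa>\<in>UNIV. a $ \<kappa> * det_list (axis \<kappa> 1 # ws))"

lemma contraction_alternating: "multilinear_alternating (CARD('n) - 1) (contraction (a :: (real, 'n::{finite,linorder}) vec))"
  unfolding multilinear_alternating_def
proof (intro conjI allI impI; elim conjE)
  fix vs :: "(real, 'n) vec list" and j v w r s
  assume "length vs = CARD('n) - 1" "j < CARD('n) - 1"
  then have "det_list (axis \<kappa> 1 # vs[j := r *\<^sub>R v + s *\<^sub>R w]) =
      r * det_list (axis \<kappa> 1 # vs[j := v]) + s * det_list (axis \<kappa> 1 # vs[j := w])" for \<kappa>
    using multilinear_alternatingD(1)[OF det_list_alternating, of "axis \<kappa> 1 # vs" "Suc j" r v s w] by simp
  then show "contraction a (vs[j := r *\<^sub>R v + s *\<^sub>R w]) = r * contraction a (vs[j := v]) + s * contraction a (vs[j := w])"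
    by (simp add: contraction_def sum_distrib_left sum.distrib[symmetric] algebra_simps)
next
  fix vs :: "(real, 'n) vec list" and i j
  assume "length vs = CARD('n) - 1" "i < j" "j < CARD('n) - 1" "vs ! i = vs ! j"
  then have "det_list (axis \<kappa> 1 # vs) = 0" for \<kappa>
    using multilinear_alternatingD(2)[OF det_list_alternating, of "axis \<kappa> 1 # vs" "Suc i" "Suc j"] by simp
  then show "contraction a vs = 0" by (simp add: contraction_def)
qed

lemma contraction_omit:
  "contraction a (map (\<lambda>i. axis i 1) (omit_list \<kappa>)) =
    a $ \<kappa> * det_list (axis \<kappa> 1 # map (\<lambda>i. axis i 1) (omit_list \<kappa>))"
  unfolding contraction_def
  by (subst sum.remove[of UNIV \<kappa>]) (auto simp: det_list_omit intro!: sum.neutral)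

lemma contraction_inj:
  fixes a b :: "(real, 'n::{finite,linorder}) vec"
  assumes "\<And>ws. length ws = CARD('n) - 1 \<Longrightarrow> contraction a ws = contraction b ws"
  shows "a = b"
proof -
  have "a $ \<kappa> = b $ \<kappa>" for \<kappa>
    using assms[of "map (\<lambda>i. axis i 1) (omit_list \<kappa>)"] det_list_omit[of \<kappa> \<kappa>]
    by (simp add: contraction_omit length_omit_list)
  then show ?thesis by (simp add: vec_eq_iff)
qed

text \<open>An alternating function is determined by its values on distinct basis vectors, and a
  list of \<open>CARD('n) - 1\<close> of them is, up to order, an \<open>omit_list\<close>. It
  therefore suffices to match the values on these lists.\<close>

lemma contraction_surj:
  fixes D :: "(real, 'n::{finite,linorder}) vec list \<Rightarrow> real"
  assumes D: "multilinear_alternating (CARD('n) - 1) D"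
  shows "\<exists>a. \<forall>ws. length ws = CARD('n) - 1 \<longrightarrow> D ws = contraction a ws"
proof -
  let ?ax = "map (\<lambda>i::'n. axis i (1::real))"
  define a where "a = (\<chi> \<kappa>. D (?ax (omit_list \<kappa>)) / det_list (axis \<kappa> 1 # ?ax (omit_list \<kappa>)))"
  define D' where "D' ws = D ws - contraction a ws" for ws
  have D': "multilinear_alternating (CARD('n) - 1) D'"
    using D contraction_alternating[of a] unfolding multilinear_alternating_def D'_def
    by (simp add: algebra_simps)
  have "D' (?ax is) = 0" if len: "length is = CARD('n) - 1" and dist: "distinct is" for "is"
  proof -
    have "card (set is) = CARD('n) - 1" using len dist by (simp add: distinct_card)
    then have "card (UNIV - set is) = 1"
      by (simp add: card_Diff_subset Suc_leI)
    then obtain \<kappa> where "UNIV - set is = {\<kappa>}" by (metis card_1_singletonE)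
    then have "set is = set (omit_list \<kappa>)" by (auto simp: omit_list)
    then have "mset (omit_list \<kappa>) = mset is"
      using set_eq_iff_mset_eq_distinct[OF omit_list(1)[of \<kappa>] dist] by simp
    then have ms: "mset (?ax (omit_list \<kappa>)) = mset (?ax is)" by simp
    have z: "D' (?ax (omit_list \<kappa>)) = 0"
      using det_list_omit[of \<kappa> \<kappa>] by (simp add: D'_def contraction_omit a_def)
    show ?thesis
      by (rule alternating_perm_zero[OF D' _ ms z]) (simp add: length_omit_list)
  qed
  then have "D' ws = 0" if "length ws = CARD('n) - 1" for ws
    using alternating_eq_zero[OF D' _ that] by blast
  then show ?thesis by (auto simp: D'_def)
qed

section \<open>Forms on tangent spaces and their coefficients\<close>

lemma forms_atD:
  assumes "\<omega> \<in> forms_at A i x"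
  shows "\<not> (length vs = i \<and> set vs \<subseteq> tangent_space A x) \<Longrightarrow> \<omega> vs = 0"
    and "length vs = i \<Longrightarrow> set vs \<subseteq> tangent_space A x \<Longrightarrow> j < i \<Longrightarrow> v \<in> tangent_space A x \<Longrightarrow>
      w \<in> tangent_space A x \<Longrightarrow>
      \<omega> (vs[j := (\<lambda>c. a *\<^sub>R v c + b *\<^sub>R w c)]) = a * \<omega> (vs[j := v]) + b * \<omega> (vs[j := w])"
    and "length vs = i \<Longrightarrow> set vs \<subseteq> tangent_space A x \<Longrightarrow> j < j' \<Longrightarrow> j' < i \<Longrightarrow> vs ! j = vs ! j' \<Longrightarrow>
      \<omega> vs = 0"
  using assms unfolding forms_at_def by blast+

lemma sub_form_eq_contraction:
  "length vs = CARD('n) - 1 \<Longrightarrow> set vs \<subseteq> tangent_space A x \<Longrightarrow>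
    sub_form A c x (a :: (real, 'n::{finite,linorder}) vec) vs = contraction a (map (\<lambda>v. v c) vs)"
  by (simp add: sub_form_def contraction_def)

lemma sub_form_in_forms_at:
  fixes A :: "('m::topological_space, (real, 'n::{finite,linorder}) vec) chart set"
  assumes A: "smooth_atlas A"
  shows "sub_form A c x a \<in> forms_at A (CARD('n) - 1) x"
proof -
  note alt = contraction_alternating[of a]
  show ?thesis
    unfolding forms_at_def
  proof (intro CollectI conjI allI impI; (elim conjE)?)
    fix vs j v w r s
    assume vs: "length vs = CARD('n) - 1" "set vs \<subseteq> tangent_space A x" and j: "j < CARD('n) - 1"
      and v: "v \<in> tangent_space A x" "w \<in> tangent_space A x"
    have sub: "set (vs[j := z]) \<subseteq> tangent_space A x" if "z \<in> tangent_space A x" for z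
      using vs(2) that by (meson insert_subset order_trans set_update_subset_insert)
    show "sub_form A c x a (vs[j := \<lambda>c. r *\<^sub>R v c + s *\<^sub>R w c]) =
        r * sub_form A c x a (vs[j := v]) + s * sub_form A c x a (vs[j := w])"
      using multilinear_alternatingD(1)[OF alt, of "map (\<lambda>v. v c) vs" j r "v c" s "w c"] vs j
      by (simp add: sub_form_eq_contraction sub v tangent_space_linear[OF A v] map_update)
  next
    fix vs j j'
    assume vs: "length vs = CARD('n) - 1" "set vs \<subseteq> tangent_space A x" and j: "j < j'" "j' < CARD('n) - 1"
      and eq: "vs ! j = vs ! j'"
    show "sub_form A c x a vs = 0"
      using multilinear_alternatingD(2)[OF alt, of "map (\<lambda>v. v c) vs" j j'] vs j eq
      by (simp add: sub_form_eq_contraction)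
  qed (auto simp: sub_form_def)
qed

text \<open>Components in one chart identify the tangent space with the coordinate space; composing
  with the inverse \<open>T\<close> turns forms at \<open>x\<close> into functions of component
  lists, to which \<open>contraction_surj\<close> applies.\<close>

lemma tangent_coordinates_inverse:
  assumes A: "smooth_atlas A" and c: "c \<in> max_atlas A" "x \<in> fst c"
  obtains T where "\<And>w. T w \<in> tangent_space A x" "\<And>w. T w c = w"
    "\<And>v. v \<in> tangent_space A x \<Longrightarrow> T (v c) = v"
    "\<And>a b v w. T (a *\<^sub>R v + b *\<^sub>R w) = (\<lambda>d. a *\<^sub>R T v d + b *\<^sub>R T w d)"
proof -
  define T where "T w = (SOME v. v \<in> tangent_space A x \<and> v c = w)" for w
  have "\<exists>v. v \<in> tangent_space A x \<and> v c = w" for w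
    using tangent_space_surj[OF A c] by blast
  from someI_ex[OF this] have T: "T w \<in> tangent_space A x" "T w c = w" for w
    by (simp_all add: T_def)
  have eqI: "T w = v" if "v \<in> tangent_space A x" "v c = w" for v w
    using tangent_vector_eqI[OF A c T(1) that(1)] T(2) that(2) by simp
  show ?thesis
  proof (rule that[of T])
    show "T (a *\<^sub>R v + b *\<^sub>R w) = (\<lambda>d. a *\<^sub>R T v d + b *\<^sub>R T w d)" for a b v w
      by (rule eqI[OF tangent_space_linear[OF A T(1) T(1)]]) (simp add: T(2))
  qed (use T eqI in auto)
qed

lemma forms_at_eq_sub_form:
  fixes A :: "('m::topological_space, (real, 'n::{finite,linorder}) vec) chart set"
  assumes A: "smooth_atlas A" and c: "c \<in> max_atlas A" "x \<in> fst c"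
    and \<omega>: "\<omega> \<in> forms_at A (CARD('n) - 1) x"
  shows "\<exists>a. \<omega> = sub_form A c x a"
proof -
  obtain T where T: "\<And>w. T w \<in> tangent_space A x" "\<And>w. T w c = w"
    "\<And>v. v \<in> tangent_space A x \<Longrightarrow> T (v c) = v"
    "\<And>a b v w. T (a *\<^sub>R v + b *\<^sub>R w) = (\<lambda>d. a *\<^sub>R T v d + b *\<^sub>R T w d)"
    using tangent_coordinates_inverse[OF A c] by blast
  have sub: "set (map T ws) \<subseteq> tangent_space A x" for ws
    using T(1) by auto
  have "multilinear_alternating (CARD('n) - 1) (\<lambda>ws. \<omega> (map T ws))"
    unfolding multilinear_alternating_def
  proof (intro conjI allI impI; elim conjE)
    fix ws :: "(real, 'n) vec list" and j v w a b
    assume "length ws = CARD('n) - 1" "j < CARD('n) - 1"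
    then show "\<omega> (map T (ws[j := a *\<^sub>R v + b *\<^sub>R w])) = a * \<omega> (map T (ws[j := v])) + b * \<omega> (map T (ws[j := w]))"
      using forms_atD(2)[OF \<omega> _ sub, of ws j "T v" "T w" a b] T(1) by (simp add: map_update T(4))
  next
    fix ws :: "(real, 'n) vec list" and i j
    assume "length ws = CARD('n) - 1" "i < j" "j < CARD('n) - 1" "ws ! i = ws ! j"
    then show "\<omega> (map T ws) = 0"
      using forms_atD(3)[OF \<omega> _ sub, of ws i j] by simp
  qed
  then obtain a where a: "\<And>ws. length ws = CARD('n) - 1 \<Longrightarrow> \<omega> (map T ws) = contraction a ws"
    using contraction_surj by blast
  have "\<omega> vs = sub_form A c x a vs" for vs
  proof (cases "length vs = CARD('n) - 1 \<and> set vs \<subseteq> tangent_space A x")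
    case True
    then have "map T (map (\<lambda>v. v c) vs) = vs"
      unfolding map_map by (intro map_idI) (use T(3) in auto)
    then show ?thesis
      using a[of "map (\<lambda>v. v c) vs"] True by (simp add: sub_form_eq_contraction)
  next
    case False
    then show ?thesis
      using forms_atD(1)[OF \<omega> False] by (auto simp: sub_form_def)
  qed
  then show ?thesis by blast
qed

lemma sub_form_inj:
  fixes A :: "('m::topological_space, (real, 'n::{finite,linorder}) vec) chart set"
  assumes A: "smooth_atlas A" and c: "c \<in> max_atlas A" "x \<in> fst c"
    and eq: "sub_form A c x a = sub_form A c x b"
  shows "a = b"
proof (rule contraction_inj)
  obtain T where T: "\<And>w. T w \<in> tangent_space A x" "\<And>w. T w c = w"
    using tangent_coordinates_inverse[OF A c] by metis
  fix ws :: "(real, 'n) vec list" assume "length ws = CARD('n) - 1"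
  then have "sub_form A c x a (map T ws) = contraction a ws" for a
    using T(1) by (subst sub_form_eq_contraction) (auto simp: comp_def T(2))
  then show "contraction a ws = contraction b ws" using eq by metis
qed

lemma sub_coeff_sub_form:
  fixes A :: "('m::topological_space, (real, 'n::{finite,linorder}) vec) chart set"
  assumes "smooth_atlas A" "c \<in> max_atlas A" "x \<in> fst c"
  shows "sub_coeff A c x (sub_form A c x a) = a"
  unfolding sub_coeff_def using sub_form_inj[OF assms] by blast

text \<open>Evaluation on the frame of coordinate vectors gives \<open>a\<close> times a nonzero
  determinant, so the coefficient is unique.\<close>

lemma top_coeff_top_form:
  fixes A :: "('m::topological_space, (real, 'n::{finite,linorder}) vec) chart set"
  assumes A: "smooth_atlas A" and c: "c \<in> max_atlas A" "x \<in> fst c"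
  shows "top_coeff A c x (top_form A c x a) = a"
proof -
  obtain T where T: "\<And>w. T w \<in> tangent_space A x" "\<And>w. T w c = w"
    using tangent_coordinates_inverse[OF A c] by metis
  obtain "is" :: "'n list" where "is": "distinct is" "set is = UNIV"
    using finite_distinct_list[of "UNIV :: 'n set"] by auto
  then have len: "length is = CARD('n)" using distinct_card by metis
  let ?vs = "map (\<lambda>i. T (axis i 1)) is"
  have "top_form A c x a ?vs = a * det_list (map (\<lambda>i. axis i 1) is)" for a
    using T(1) len by (auto simp: top_form_def comp_def T(2))
  then have "a = b" if "top_form A c x a = top_form A c x b" for a b
    using that det_list_axis[OF "is"(1) len] by (metis mult_cancel_right)
  then show ?thesis
    unfolding top_coeff_def by blast
qed

section \<open>Adapted charts\<close>

lemma chart_inv_prod: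
  assumes "is_chart c" "is_chart d" "u \<in> snd c ` fst c" "w \<in> snd d ` fst d"
  shows "chart_inv (fst c \<times> fst d, map_prod (snd c) (snd d)) (u, w) = (chart_inv c u, chart_inv d w)"
proof -
  obtain x y where xy: "x \<in> fst c" "u = snd c x" "y \<in> fst d" "w = snd d y"
    using assms by blast
  have inj: "inj_on (map_prod (snd c) (snd d)) (fst c \<times> fst d)"
    using is_chartD(3)[OF assms(1)] is_chartD(3)[OF assms(2)] by (rule map_prod_inj_on)
  have "chart_inv (fst c \<times> fst d, map_prod (snd c) (snd d)) (map_prod (snd c) (snd d) (x, y)) = (x, y)"
    unfolding chart_inv_def fst_conv snd_conv by (rule inv_into_f_f[OF inj]) (use xy in simp)
  then show ?thesis
    using xy chart_inv_left[OF assms(1) xy(1)] chart_inv_left[OF assms(2) xy(3)] by simp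
qed

lemma is_chart_prod:
  assumes c: "is_chart c" and d: "is_chart d"
  shows "is_chart (fst c \<times> fst d, map_prod (snd c) (snd d))"
proof -
  let ?f = "map_prod (snd c) (snd d)" and ?g = "map_prod (chart_inv c) (chart_inv d)"
  have img: "?f ` (fst c \<times> fst d) = snd c ` fst c \<times> snd d ` fst d"
    by (rule map_prod_surj_on) auto
  have "homeomorphism (fst c \<times> fst d) (snd c ` fst c \<times> snd d ` fst d) ?f ?g"
  proof (rule homeomorphismI)
    show "continuous_on (fst c \<times> fst d) ?f"
      unfolding map_prod_def split_beta
      by (intro continuous_on_Pair continuous_on_compose2[OF is_chartD(4)[OF c] continuous_on_fst]
          continuous_on_compose2[OF is_chartD(4)[OF d] continuous_on_snd] continuous_on_id) auto
    show "continuous_on (snd c ` fst c \<times> snd d ` fst d) ?g"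
      unfolding map_prod_def split_beta
      by (intro continuous_on_Pair continuous_on_compose2[OF is_chartD(5)[OF c] continuous_on_fst]
          continuous_on_compose2[OF is_chartD(5)[OF d] continuous_on_snd] continuous_on_id) auto
  qed (auto simp: chart_inv_left c d chart_inv_right chart_inv_in)
  then show ?thesis
    unfolding is_chart_def fst_conv snd_conv img
    using is_chartD[OF c] is_chartD[OF d] by (auto intro: open_Times)
qed

lemma compatible_prod:
  assumes ch: "is_chart c" "is_chart d" "is_chart c'" "is_chart d'"
    and comp: "compatible c c'" "compatible d d'"
  shows "compatible (fst c \<times> fst d, map_prod (snd c) (snd d)) (fst c' \<times> fst d', map_prod (snd c') (snd d'))"
proof -
  \<comment> \<open>Half of the compatibility, for arbitrary charts; the other half is the same
    statement with the roles of the two products exchanged.\<close>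
  have *: "smooth_on (map_prod (snd c) (snd d) ` (fst c \<times> fst d \<inter> fst c' \<times> fst d'))
     (map_prod (snd c') (snd d') \<circ> chart_inv (fst c \<times> fst d, map_prod (snd c) (snd d)))"
    (is "smooth_on ?S ?f")
    if ch: "is_chart c" "is_chart d" "is_chart c'" "is_chart d'" and comp: "compatible c c'" "compatible d d'"
    for c c' :: "('a, 'b) chart" and d d' :: "('c, 'd) chart"
  proof -
    have S: "?S = snd c ` (fst c \<inter> fst c') \<times> snd d ` (fst d \<inter> fst d')"
      unfolding Times_Int_Times by (rule map_prod_surj_on) auto
    have o: "open (snd c ` (fst c \<inter> fst c'))" "open (snd d ` (fst d \<inter> fst d'))"
      using chart_image_open is_chartD(1) ch by blast+
    then have oS: "open ?S" unfolding S by (rule open_Times)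
    have sm: "smooth_on (snd c ` (fst c \<inter> fst c')) (snd c' \<circ> chart_inv c)"
      "smooth_on (snd d ` (fst d \<inter> fst d')) (snd d' \<circ> chart_inv d)"
      using comp by (simp_all add: compatible_def)
    have sub: "fst ` ?S \<subseteq> snd c ` (fst c \<inter> fst c')" "snd ` ?S \<subseteq> snd d ` (fst d \<inter> fst d')"
      unfolding S by auto
    have "smooth_on ?S (\<lambda>p. ((snd c' \<circ> chart_inv c) (fst p), (snd d' \<circ> chart_inv d) (snd p)))"
      by (rule smooth_on_Pair[OF oS
            smooth_on_compose[OF oS o(1) sub(1) smooth_on_linear[OF oS bounded_linear_fst] sm(1)]
            smooth_on_compose[OF oS o(2) sub(2) smooth_on_linear[OF oS bounded_linear_snd] sm(2)]])
    moreover have "((snd c' \<circ> chart_inv c) (fst p), (snd d' \<circ> chart_inv d) (snd p)) = ?f p" if "p \<in> ?S" for p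
      using that chart_inv_prod[OF ch(1,2), of "fst p" "snd p"] unfolding S by auto
    ultimately show ?thesis
      by (rule smooth_on_cong[OF oS, rotated])
  qed
  show ?thesis
    unfolding compatible_def fst_conv snd_conv
    using *[OF ch comp] *[OF ch(3,4,1,2) comp[unfolded compatible_commute[of c] compatible_commute[of d]]]
    by (simp add: Int_commute)
qed

lemma prod_atlas_smooth:
  assumes A: "smooth_atlas A" and C: "smooth_atlas C"
  shows "smooth_atlas (prod_atlas A C)"
  unfolding smooth_atlas_def
proof (intro conjI ballI)
  have chA: "is_chart c" if "c \<in> A" for c using A that by (simp add: smooth_atlas_def)
  have chC: "is_chart c" if "c \<in> C" for c using C that by (simp add: smooth_atlas_def)
  fix r assume "r \<in> prod_atlas A C"
  then obtain c d where r: "r = (fst c \<times> fst d, map_prod (snd c) (snd d))" and cd: "c \<in> A" "d \<in> C"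
    unfolding prod_atlas_def by blast
  show "is_chart r" unfolding r using chA[OF cd(1)] chC[OF cd(2)] by (rule is_chart_prod)
  fix r' assume "r' \<in> prod_atlas A C"
  then obtain c' d' where r': "r' = (fst c' \<times> fst d', map_prod (snd c') (snd d'))" and cd': "c' \<in> A" "d' \<in> C"
    unfolding prod_atlas_def by blast
  have "compatible c c'" "compatible d d'"
    using A C cd cd' by (simp_all add: smooth_atlas_def)
  then show "compatible r r'"
    unfolding r r' by (rule compatible_prod[OF chA[OF cd(1)] chC[OF cd(2)] chA[OF cd'(1)] chC[OF cd'(2)]])
next
  show "\<Union> (fst ` prod_atlas A C) = UNIV"
  proof safe
    fix x y
    obtain c where c: "c \<in> A" "x \<in> fst c" using atlas_chart_around[OF A] by metis
    obtain d where d: "d \<in> C" "y \<in> fst d" using atlas_chart_around[OF C] by metis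
    have "(fst c \<times> fst d, map_prod (snd c) (snd d)) \<in> prod_atlas A C"
      unfolding prod_atlas_def using c d by blast
    then show "(x, y) \<in> \<Union> (fst ` prod_atlas A C)"
      by (rule UN_I) (use c d in simp)
  qed simp
qed

text \<open>Both \<open>\<tau>\<close> and its inverse are smooth in all charts, which yields the
  two halves of compatibility with each chart of \<open>A\<close>. With a local trivialisation for
  \<open>\<tau>\<close> this produces the charts of the total space from which adapted charts are
  made.\<close>

lemma pullback_chart:
  fixes A :: "('p::topological_space, 'v::euclidean_space) chart set"
    and C :: "('r::topological_space, 'v) chart set"
  assumes A: "smooth_atlas A" and W: "open W" and V: "open V" and bij: "bij_betw \<tau> W V"
    and \<tau>: "smooth_map_on A W C \<tau>" and \<sigma>: "smooth_map_on C V A (inv_into W \<tau>)"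
    and r: "r \<in> max_atlas C"
  shows "(W \<inter> \<tau> -` fst r, snd r \<circ> \<tau>) \<in> max_atlas A"
proof -
  let ?d = "(W \<inter> \<tau> -` fst r, snd r \<circ> \<tau>)"
  let ?\<sigma> = "inv_into W \<tau>"
  note ch = max_atlas_chart[OF r]
  have \<tau>\<sigma>: "\<tau> (?\<sigma> y) = y" "?\<sigma> y \<in> W" if "y \<in> V" for y
    using bij that by (auto simp: bij_betw_def f_inv_into_f inv_into_into)
  have \<sigma>\<tau>: "?\<sigma> (\<tau> x) = x" "\<tau> x \<in> V" if "x \<in> W" for x
    using bij that by (auto simp: bij_betw_def)
  have cont: "continuous_on W \<tau>" "continuous_on V ?\<sigma>"
    using \<tau> \<sigma> by (auto simp: smooth_map_on_def)
  have dom: "\<tau> ` (W \<inter> \<tau> -` fst r \<inter> U) = fst r \<inter> V \<inter> ?\<sigma> -` U" for U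
    using \<tau>\<sigma> \<sigma>\<tau> by force
  have img: "(snd r \<circ> \<tau>) ` (W \<inter> \<tau> -` fst r \<inter> U) = snd r ` (fst r \<inter> V \<inter> ?\<sigma> -` U)" for U
    by (simp only: image_comp[symmetric] dom)
  have img': "(snd r \<circ> \<tau>) ` (W \<inter> \<tau> -` fst r) = snd r ` (fst r \<inter> V)"
    using img[of UNIV] by simp
  have op: "open (W \<inter> \<tau> -` fst r)"
    by (rule continuous_open_preimage[OF cont(1) W is_chartD(1)[OF ch]])
  have oV: "open (snd r ` (fst r \<inter> V))"
    by (rule chart_image_open[OF ch V])
  have "homeomorphism (W \<inter> \<tau> -` fst r) (snd r ` (fst r \<inter> V)) (snd r \<circ> \<tau>) (?\<sigma> \<circ> chart_inv r)"
  proof (rule homeomorphismI)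
    show "continuous_on (W \<inter> \<tau> -` fst r) (snd r \<circ> \<tau>)"
      using cont(1) is_chartD(4)[OF ch]
      by (intro continuous_on_compose) (auto intro: continuous_on_subset)
    show "continuous_on (snd r ` (fst r \<inter> V)) (?\<sigma> \<circ> chart_inv r)"
      using cont(2) is_chartD(5)[OF ch] chart_inv_left[OF ch]
      by (intro continuous_on_compose) (auto intro!: continuous_on_subset[of V] intro: continuous_on_subset)
  qed (auto simp: chart_inv_left[OF ch] \<tau>\<sigma> \<sigma>\<tau>)
  then have d: "is_chart ?d"
    unfolding is_chart_def fst_conv snd_conv img' using op oV by blast
  have inv: "chart_inv ?d u = ?\<sigma> (chart_inv r u)" if u: "u \<in> snd r ` (fst r \<inter> V)" for u
  proof -
    obtain y where y: "y \<in> fst r" "y \<in> V" "u = snd r y" using u by blast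
    then have "snd ?d (?\<sigma> y) = u" "?\<sigma> y \<in> fst ?d" using \<tau>\<sigma> by auto
    then show ?thesis
      using chart_inv_left[OF d, of "?\<sigma> y"] chart_inv_left[OF ch y(1)] y(3) by simp
  qed
  have "compatible ?d b" if "b \<in> A" for b
  proof -
    have b: "b \<in> max_atlas A" using that atlas_subset_max[OF A] by blast
    have ob: "open (fst b)" using is_chartD(1)[OF max_atlas_chart[OF b]] .
    have o: "open (V \<inter> ?\<sigma> -` fst b)"
      by (rule continuous_open_preimage[OF cont(2) V ob])
    have 1: "smooth_on (snd r ` (fst r \<inter> V \<inter> ?\<sigma> -` fst b)) (snd b \<circ> ?\<sigma> \<circ> chart_inv r)"
      using \<sigma> r b unfolding smooth_map_on_def by blast
    have "smooth_on (snd r ` (fst r \<inter> V \<inter> ?\<sigma> -` fst b)) (snd b \<circ> chart_inv ?d)"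
    proof (rule smooth_on_cong[OF _ _ 1])
      show "open (snd r ` (fst r \<inter> V \<inter> ?\<sigma> -` fst b))"
        using chart_image_open[OF ch o] by (simp add: Int_assoc)
    qed (auto simp: inv)
    moreover have "smooth_on (snd b ` (fst b \<inter> W \<inter> \<tau> -` fst r)) (snd r \<circ> \<tau> \<circ> chart_inv b)"
      using \<tau> r b unfolding smooth_map_on_def by blast
    ultimately show ?thesis
      unfolding compatible_def fst_conv snd_conv img by (simp add: Int_ac comp_assoc)
  qed
  then show ?thesis using d by (simp add: max_atlas_def)
qed

lemma adapted_chartD:
  assumes "e \<in> adapted_charts B"
  shows "fst e \<in> max_atlas (base_atlas B)" "snd e \<in> max_atlas (total_atlas B)"
    and "p \<in> fst (snd e) \<Longrightarrow> proj B p \<in> fst (fst e)"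
    and "p \<in> fst (snd e) \<Longrightarrow> fst (snd (snd e) p) = snd (fst e) (proj B p)"
    and "is_chart (fst e)" "is_chart (snd e)"
  using assms max_atlas_chart unfolding adapted_charts_def by auto

text \<open>A product of a base chart and a fibre chart is pulled back along a local trivialisation.
  It is adapted because the trivialisation preserves the base point.\<close>

lemma adapted_chart_exists:
  fixes B :: "('m::{t2_space,second_countable_topology}, 'e::{t2_space,second_countable_topology},
               'q::{t2_space,second_countable_topology}, 'n::finite, 'k::finite) fbundle"
  assumes B: "smooth_fibre_bundle B"
  shows "\<exists>e\<in>adapted_charts B. p \<in> fst (snd e)"
proof -
  have A: "smooth_atlas (base_atlas B)" "smooth_atlas (total_atlas B)" "smooth_atlas (fibre_atlas B)"
    and pr: "continuous_on UNIV (proj B)"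
    using B unfolding smooth_fibre_bundle_def smooth_map_on_def by blast+
  obtain U \<tau> where U: "open U" "proj B p \<in> U"
    and bij: "bij_betw \<tau> (proj B -` U) (U \<times> (UNIV :: 'q set))"
    and fst: "\<And>p. proj B p \<in> U \<Longrightarrow> fst (\<tau> p) = proj B p"
    and \<tau>: "smooth_map_on (total_atlas B) (proj B -` U) (prod_atlas (base_atlas B) (fibre_atlas B)) \<tau>"
    and \<sigma>: "smooth_map_on (prod_atlas (base_atlas B) (fibre_atlas B)) (U \<times> UNIV) (total_atlas B)
          (inv_into (proj B -` U) \<tau>)"
    using B unfolding smooth_fibre_bundle_def by blast
  obtain c where c: "c \<in> base_atlas B" "proj B p \<in> fst c" using atlas_chart_around[OF A(1)] by metis
  obtain q where q: "q \<in> fibre_atlas B" "snd (\<tau> p) \<in> fst q" using atlas_chart_around[OF A(3)] by metis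
  let ?r = "(fst c \<times> fst q, map_prod (snd c) (snd q))"
  let ?d = "(proj B -` U \<inter> \<tau> -` fst ?r, snd ?r \<circ> \<tau>)"
  have "?r \<in> prod_atlas (base_atlas B) (fibre_atlas B)"
    using c q unfolding prod_atlas_def by blast
  then have r: "?r \<in> max_atlas (prod_atlas (base_atlas B) (fibre_atlas B))"
    using atlas_subset_max[OF prod_atlas_smooth[OF A(1,3)]] by blast
  have W: "open (proj B -` U)" using pr U(1) by (simp add: open_vimage)
  have d: "?d \<in> max_atlas (total_atlas B)"
    by (rule pullback_chart[OF A(2) W _ bij \<tau> \<sigma> r]) (use U in \<open>auto intro: open_Times\<close>)
  have "c \<in> max_atlas (base_atlas B)" using c atlas_subset_max[OF A(1)] by blast
  moreover have "proj B p \<in> fst c \<and> fst (snd ?d p) = snd c (proj B p)" if "p \<in> fst ?d" for p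
    using that fst[of p] by (simp add: mem_Times_iff)
  ultimately have "(c, ?d) \<in> adapted_charts B"
    using d unfolding adapted_charts_def by blast
  moreover have "p \<in> fst ?d" using c q U fst[OF U(2)] by (simp add: mem_Times_iff)
  ultimately show ?thesis by (intro bexI[of _ "(c, ?d)"]) auto
qed

section \<open>Local sections and jets\<close>

definition rep_section :: "('m, 'e, 'n::finite, 'k::finite) achart \<Rightarrow> (real^'n \<Rightarrow> real^'k) \<Rightarrow> 'm \<Rightarrow> 'e" where
  "rep_section e g y = chart_inv (snd e) (snd (fst e) y, g (snd (fst e) y))"

text \<open>The fibre coordinates in \<open>jet_coords\<close>, computed from a given section rather
  than from the representative chosen there.\<close>

definition jet_coeffs ::
  "nat \<Rightarrow> ('m, 'e, 'n::{finite,linorder}, 'k::finite) achart \<Rightarrow> ('m \<Rightarrow> 'e) \<Rightarrow> 'm \<Rightarrow> 'n multiset \<Rightarrow> (real, 'k) vec" where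
  "jet_coeffs k e s x M =
     (if size M \<le> k then partials (sorted_list_of_multiset M) (local_rep e s) (snd (fst e) x) else 0)"

text \<open>
  The velocity, in the chart \<open>e'\<close>, of a variation of sections with representative \<open>g\<close> and velocity
  \<open>g'\<close> in the chart \<open>e\<close>.
\<close>

definition transition_velocity ::
  "('m, 'e, 'n::finite, 'k::finite) achart \<Rightarrow> ('m, 'e, 'n, 'k) achart \<Rightarrow> (real^'n \<Rightarrow> real^'k) \<Rightarrow>
   (real^'n \<Rightarrow> real^'k) \<Rightarrow> real^'n \<Rightarrow> real^'k" where
  "transition_velocity e e' g g' u' = (let u = snd (fst e) (chart_inv (fst e') u') in
     snd (\<Sum>i\<in>Basis. ((0 :: real^'n, g' u) \<bullet> i) *\<^sub>R
       frechet_derivative (\<lambda>z. snd (snd e') (chart_inv (snd e) z)) (at (u, g u)) i))"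

context
  fixes B :: "('m::{t2_space,second_countable_topology}, 'e::{t2_space,second_countable_topology},
               'q::{t2_space,second_countable_topology}, 'n::{finite,linorder}, 'k::finite) fbundle"
  assumes B: "smooth_fibre_bundle B"
begin

lemma atlases: "smooth_atlas (base_atlas B)" "smooth_atlas (total_atlas B)"
  using B unfolding smooth_fibre_bundle_def by blast+

lemma local_section_proj: "local_section B x s \<Longrightarrow> proj B (s x) = x"
  unfolding local_section_def by blast

lemma local_section_base:
  "local_section B x s \<Longrightarrow> e \<in> adapted_charts B \<Longrightarrow> s x \<in> fst (snd e) \<Longrightarrow> x \<in> fst (fst e)"
  using adapted_chartD(3)[of e B "s x"] local_section_proj by simp

lemma local_section_value:
  assumes "local_section B x s" "e \<in> adapted_charts B" "s x \<in> fst (snd e)"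
  shows "snd (snd e) (s x) = (snd (fst e) x, local_rep e s (snd (fst e) x))"
  using adapted_chartD(4)[OF assms(2,3)] local_section_proj[OF assms(1)]
    chart_inv_left[OF adapted_chartD(5)[OF assms(2)] local_section_base[OF assms]]
  by (simp add: local_rep_def prod_eq_iff)

lemma local_section_open:
  assumes s: "local_section B x s" and e: "e \<in> adapted_charts B" and x: "s x \<in> fst (snd e)"
  obtains U where "open U" "x \<in> U" "\<And>y. y \<in> U \<Longrightarrow> local_section B y s \<and> s y \<in> fst (snd e)"
    "\<And>y. y \<in> U \<Longrightarrow> smooth_at (snd (fst e) y) (local_rep e s)"
proof -
  obtain U where U: "open U" "x \<in> U" and sm: "smooth_map_on (base_atlas B) U (total_atlas B) s"
    and pr: "\<And>y. y \<in> U \<Longrightarrow> proj B (s y) = y"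
    using s unfolding local_section_def by blast
  have sec: "local_section B y s" if "y \<in> U" for y
    unfolding local_section_def using U sm pr that by blast
  define V where "V = U \<inter> s -` fst (snd e)"
  have V: "open V"
    unfolding V_def using sm U(1) is_chartD(1)[OF adapted_chartD(6)[OF e]]
    by (intro continuous_open_preimage) (auto simp: smooth_map_on_def)
  have "smooth_at (snd (fst e) y) (local_rep e s)" if y: "y \<in> V" for y
  proof -
    have yc: "y \<in> fst (fst e)"
      using local_section_base[OF sec e] y by (simp add: V_def)
    have "smooth_on (snd (fst e) ` (fst (fst e) \<inter> U \<inter> s -` fst (snd e))) (snd (snd e) \<circ> s \<circ> chart_inv (fst e))"
      using sm adapted_chartD(1,2)[OF e] unfolding smooth_map_on_def by blast
    then have "smooth_on (snd (fst e) ` (fst (fst e) \<inter> V)) (snd (snd e) \<circ> s \<circ> chart_inv (fst e))"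
      by (simp add: V_def Int_assoc)
    then have "smooth_at (snd (fst e) y) (\<lambda>u. snd ((snd (snd e) \<circ> s \<circ> chart_inv (fst e)) u))"
      by (intro smooth_at_linear_compose[OF bounded_linear_snd]
          smooth_atI[OF chart_image_open[OF adapted_chartD(5)[OF e] V]])
        (use y yc in \<open>auto simp: comp_def\<close>)
    then show ?thesis by (simp add: local_rep_def[abs_def])
  qed
  then show ?thesis
    using that[of V] V U x sec by (simp add: V_def)
qed

lemma local_rep_smooth:
  assumes "local_section B x s" "e \<in> adapted_charts B" "s x \<in> fst (snd e)"
  shows "smooth_at (snd (fst e) x) (local_rep e s)"
  using local_section_open[OF assms] by metis

text \<open>The graph of \<open>g\<close> stays in the chart image on an open set, over which the
  inverse chart defines a section. In arbitrary charts this section is a base transition, followed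
  by the graph map and by a transition of the total space, hence smooth.\<close>

lemma rep_section:
  assumes e: "e \<in> adapted_charts B" and x: "x \<in> fst (fst e)" and g: "smooth_at (snd (fst e) x) g"
    and val: "(snd (fst e) x, g (snd (fst e) x)) \<in> snd (snd e) ` fst (snd e)"
  shows "local_section B x (rep_section e g)" "rep_section e g x \<in> fst (snd e)"
    "\<forall>\<^sub>F u in nhds (snd (fst e) x). local_rep e (rep_section e g) u = g u"
proof -
  let ?c = "fst e" and ?d = "snd e" and ?s = "rep_section e g"
  note ch = adapted_chartD(5,6)[OF e]
  note at = adapted_chartD(1,2)[OF e]
  obtain S where S: "open S" "snd ?c x \<in> S" "smooth_on S g"
    using g unfolding smooth_at_def by blast
  define V where "V = S \<inter> (\<lambda>u. (u, g u)) -` (snd ?d ` fst ?d)"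
  have "continuous_on S (\<lambda>u. (u, g u))"
    by (intro continuous_on_Pair continuous_on_id smooth_on_continuous S)
  then have V: "open V"
    unfolding V_def by (rule continuous_open_preimage[OF _ S(1) is_chartD(2)[OF ch(2)]])
  define U where "U = fst ?c \<inter> snd ?c -` V"
  have U: "open U"
    unfolding U_def by (rule continuous_open_preimage[OF is_chartD(4,1)[OF ch(1)] V])
  have xU: "x \<in> U" using x val S by (simp add: U_def V_def)
  have gV: "smooth_at u g" if "u \<in> V" for u
    using that S by (intro smooth_atI[OF S(1)]) (auto simp: V_def)
  have inU: "?s y \<in> fst ?d" "snd ?d (?s y) = (snd ?c y, g (snd ?c y))" if "y \<in> U" for y
  proof -
    have img: "(snd ?c y, g (snd ?c y)) \<in> snd ?d ` fst ?d"
      using that by (simp add: U_def V_def)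
    show "?s y \<in> fst ?d" "snd ?d (?s y) = (snd ?c y, g (snd ?c y))"
      unfolding rep_section_def by (rule chart_inv_in[OF img]) (rule chart_inv_right[OF img])
  qed
  \<comment> \<open>The first component of an adapted chart is the base coordinate of the projected
    point; injectivity of the base chart recovers the point itself.\<close>
  have pr: "proj B (?s y) = y" if "y \<in> U" for y
  proof -
    have "snd ?c (proj B (?s y)) = snd ?c y"
      using adapted_chartD(4)[OF e inU(1)[OF that]] inU(2)[OF that] by simp
    then show ?thesis
      using is_chartD(3)[OF ch(1)] adapted_chartD(3)[OF e inU(1)[OF that]] that
      by (auto simp: U_def dest: inj_onD)
  qed
  have "continuous_on V (\<lambda>u. (u, g u))"
    using \<open>continuous_on S (\<lambda>u. (u, g u))\<close> by (rule continuous_on_subset) (simp add: V_def)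
  then have "continuous_on V (\<lambda>u. chart_inv ?d (u, g u))"
    by (rule continuous_on_compose2[OF is_chartD(5)[OF ch(2)]]) (auto simp: V_def)
  then have cont: "continuous_on U ?s"
    unfolding rep_section_def
    by (rule continuous_on_compose2) (use is_chartD(4)[OF ch(1)] in \<open>auto simp: U_def intro: continuous_on_subset\<close>)
  have "smooth_on (snd c' ` (fst c' \<inter> U \<inter> ?s -` fst d')) (snd d' \<circ> ?s \<circ> chart_inv c')"
    if c': "c' \<in> max_atlas (base_atlas B)" and d': "d' \<in> max_atlas (total_atlas B)" for c' d'
  proof -
    note ch' = max_atlas_chart[OF c'] max_atlas_chart[OF d']
    have "open (U \<inter> ?s -` fst d')"
      by (rule continuous_open_preimage[OF cont U is_chartD(1)[OF ch'(2)]])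
    then have o: "open (snd c' ` (fst c' \<inter> U \<inter> ?s -` fst d'))"
      using chart_image_open[OF ch'(1)] by (simp add: Int_assoc)
    show ?thesis
      unfolding smooth_on_iff_smooth_at[OF o]
    proof safe
      fix y assume y: "y \<in> fst c'" "y \<in> U" "?s y \<in> fst d'"
      let ?\<phi> = "\<lambda>u'. snd ?c (chart_inv c' u')"
      have \<phi>: "smooth_at (snd c' y) ?\<phi>"
        by (rule transition_smooth_at[OF atlases(1) c' at(1) y(1)]) (use y in \<open>simp add: U_def\<close>)
      have \<phi>y: "?\<phi> (snd c' y) = snd ?c y"
        by (simp add: chart_inv_left[OF ch'(1) y(1)])
      have "smooth_at (snd c' y) (\<lambda>u'. g (?\<phi> u'))"
        by (rule smooth_at_compose[OF \<phi>]) (use gV y \<phi>y in \<open>simp add: U_def\<close>)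
      then have *: "smooth_at (snd c' y) (\<lambda>u'. (?\<phi> u', g (?\<phi> u')))"
        by (rule smooth_at_Pair[OF \<phi>])
      have "smooth_at (snd ?d (?s y)) (\<lambda>z. snd d' (chart_inv ?d z))"
        by (rule transition_smooth_at[OF atlases(2) at(2) d' inU(1)[OF y(2)] y(3)])
      then have "smooth_at (snd c' y) (\<lambda>u'. snd d' (chart_inv ?d (?\<phi> u', g (?\<phi> u'))))"
        by (intro smooth_at_compose[OF *, of "\<lambda>z. snd d' (chart_inv ?d z)"]) (simp add: inU y \<phi>y)
      then show "smooth_at (snd c' y) (snd d' \<circ> ?s \<circ> chart_inv c')"
        by (simp add: rep_section_def comp_def)
    qed
  qed
  then have "smooth_map_on (base_atlas B) U (total_atlas B) ?s"
    unfolding smooth_map_on_def using cont by blast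
  then show "local_section B x ?s"
    unfolding local_section_def using U xU pr by blast
  show "?s x \<in> fst (snd e)" using inU(1)[OF xU] .
  have "\<forall>\<^sub>F u in nhds (snd ?c x). u \<in> snd ?c ` fst ?c \<and> chart_inv ?c u \<in> U"
    by (rule chart_eventually_in[OF ch(1) U x xU])
  then show "\<forall>\<^sub>F u in nhds (snd ?c x). local_rep e ?s u = g u"
    by (rule eventually_mono) (auto simp: local_rep_def inU chart_inv_right)
qed

section \<open>Contact and jets\<close>

lemma contact_refl: "contact B k x s s"
  by (simp add: contact_def)

lemma contact_sym: "contact B k x s s' \<Longrightarrow> contact B k x s' s"
  by (auto simp: contact_def)

lemma contact_trans: "contact B k x s s' \<Longrightarrow> contact B k x s' s'' \<Longrightarrow> contact B k x s s''"
  by (auto simp: contact_def)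

lemma jet_eq_iff:
  assumes "local_section B x s" "local_section B x s'"
  shows "jet B k x s = jet B k x s' \<longleftrightarrow> contact B k x s s'"
  unfolding jet_def using assms contact_refl contact_sym contact_trans by blast

lemma jet_fst [simp]: "fst (jet B k x s) = x"
  by (simp add: jet_def)

lemma jet_some:
  assumes "local_section B x s"
  shows "local_section B x (SOME s'. s' \<in> snd (jet B k x s))"
    "contact B k x s (SOME s'. s' \<in> snd (jet B k x s))"
proof -
  have "s \<in> snd (jet B k x s)"
    using assms contact_refl by (simp add: jet_def)
  then have "(SOME s'. s' \<in> snd (jet B k x s)) \<in> snd (jet B k x s)"
    by (rule someI[where P = "\<lambda>s'. s' \<in> snd (jet B k x s)"])
  then show "local_section B x (SOME s'. s' \<in> snd (jet B k x s))"
    "contact B k x s (SOME s'. s' \<in> snd (jet B k x s))"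
    by (simp_all add: jet_def)
qed

lemma jet_target_jet: "local_section B x s \<Longrightarrow> jet_target (jet B k x s) = s x"
  using jet_some(2)[of x s k] by (simp add: jet_target_def contact_def)

lemma jet_in_space: "local_section B x s \<Longrightarrow> jet B k x s \<in> jet_space B k"
  unfolding jet_space_def by blast

lemma jet_in_dom: "local_section B x s \<Longrightarrow> jet B k x s \<in> jet_dom B k e \<longleftrightarrow> s x \<in> fst (snd e)"
  by (simp add: jet_dom_def jet_in_space jet_target_jet)

lemma jet_spaceE:
  assumes "j \<in> jet_space B k"
  obtains s where "local_section B (fst j) s" "j = jet B k (fst j) s"
  using assms unfolding jet_space_def by (auto simp: jet_def)

lemma jet_domE:
  assumes "j \<in> jet_dom B k e"
  obtains s where "local_section B (fst j) s" "j = jet B k (fst j) s" "s (fst j) \<in> fst (snd e)"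
proof -
  have "j \<in> jet_space B k" using assms by (simp add: jet_dom_def)
  then obtain s where s: "local_section B (fst j) s" "j = jet B k (fst j) s"
    by (rule jet_spaceE)
  then show ?thesis using that assms jet_in_dom[OF s(1), of k e] by simp
qed

text \<open>\<open>jet_coords\<close> chooses a representative of the class; contact makes its
  derivatives agree with those of \<open>s\<close> in every adapted chart around the common
  value.\<close>

lemma jet_coords_jet:
  assumes "local_section B x s" "e \<in> adapted_charts B" "s x \<in> fst (snd e)"
  shows "jet_coords k e (jet B k x s) = (snd (fst e) x, jet_coeffs k e s x)"
proof -
  let ?r = "SOME s'. s' \<in> snd (jet B k x s)"
  have "partials \<mu>s (local_rep e ?r) (snd (fst e) x) = partials \<mu>s (local_rep e s) (snd (fst e) x)"
    if "length \<mu>s \<le> k" for \<mu>s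
    using jet_some(2)[OF assms(1), of k] assms that unfolding contact_def by metis
  then show ?thesis
    by (auto simp: jet_coords_def Let_def jet_coeffs_def fun_eq_iff
        simp flip: size_mset)
qed

lemma partials_local_rep:
  assumes "local_section B x s" "e \<in> adapted_charts B" "s x \<in> fst (snd e)" "length \<mu>s \<le> k"
  shows "partials \<mu>s (local_rep e s) (snd (fst e) x) = jet_coeffs k e s x (mset \<mu>s)"
proof -
  obtain S where "open S" "snd (fst e) x \<in> S" "smooth_on S (local_rep e s)"
    using local_rep_smooth[OF assms(1-3)] unfolding smooth_at_def by blast
  then show ?thesis
    using assms(4) by (simp add: jet_coeffs_def partials_mset_cong[of S _ _ \<mu>s "sorted_list_of_multiset (mset \<mu>s)"]
        del: sorted_list_of_multiset_mset)
qed

lemma jet_coeffs_rep_section: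
  assumes e: "e \<in> adapted_charts B" "x \<in> fst (fst e)" "smooth_at (snd (fst e) x) g"
    "(snd (fst e) x, g (snd (fst e) x)) \<in> snd (snd e) ` fst (snd e)"
  shows "jet_coeffs k e (rep_section e g) x M =
    (if size M \<le> k then partials (sorted_list_of_multiset M) g (snd (fst e) x) else 0)"
  by (simp add: jet_coeffs_def partials_cong_eventually[OF rep_section(3)[OF assms]])

text \<open>Seen in \<open>e'\<close>, a section is the transition of the total space applied to the
  graph of its representative in \<open>e\<close>, precomposed with the base transition. The base
  transition is independent of \<open>t\<close>, so substitution, pairing, composition and
  projection of variations give the result.\<close>

lemma jet_variation_transition:
  assumes e: "e \<in> adapted_charts B" and e': "e' \<in> adapted_charts B"
    and s: "\<And>t. local_section B x (s t)" "\<And>t. s t x \<in> fst (snd e)" "\<And>t. s t x \<in> fst (snd e')"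
    and var: "jet_variation k (\<lambda>t. local_rep e (s t)) G' (snd (fst e) x)"
  shows "jet_variation k (\<lambda>t. local_rep e' (s t)) (transition_velocity e e' (local_rep e (s 0)) G')
    (snd (fst e') x)"
proof -
  let ?\<phi> = "\<lambda>u'. snd (fst e) (chart_inv (fst e') u')"
  let ?T = "\<lambda>z. snd (snd e') (chart_inv (snd e) z)"
  let ?u' = "snd (fst e') x"
  note ch = adapted_chartD(5,6)[OF e] and ch' = adapted_chartD(5,6)[OF e']
  have x: "x \<in> fst (fst e)" "x \<in> fst (fst e')"
    using local_section_base[OF s(1) e s(2)] local_section_base[OF s(1) e' s(3)] .
  have \<phi>: "smooth_at ?u' ?\<phi>"
    by (rule transition_smooth_at[OF atlases(1) adapted_chartD(1)[OF e'] adapted_chartD(1)[OF e] x(2,1)])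
  have \<phi>x: "?\<phi> ?u' = snd (fst e) x"
    by (simp add: chart_inv_left[OF ch'(1) x(2)])
  have lin: "bounded_linear (\<lambda>x::(real, 'k) vec. (0::(real, 'n) vec, x))"
    by (rule bounded_linear_Pair bounded_linear_zero bounded_linear_ident)+
  have lin': "bounded_linear (\<lambda>x::(real, 'n) vec. (x, 0::(real, 'k) vec))"
    by (rule bounded_linear_Pair bounded_linear_zero bounded_linear_ident)+
  have "jet_variation k (\<lambda>t u'. (?\<phi> u', 0) + (0, local_rep e (s t) (?\<phi> u')))
      (\<lambda>u'. 0 + (0, G' (?\<phi> u'))) ?u'"
    by (rule jet_variation_add[OF jet_variation_const[OF smooth_at_linear_compose[OF lin' \<phi>]]
          jet_variation_linear[OF lin jet_variation_precompose[OF \<phi> \<phi>x var]]])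
  then have pair: "jet_variation k (\<lambda>t u'. (?\<phi> u', local_rep e (s t) (?\<phi> u'))) (\<lambda>u'. (0, G' (?\<phi> u'))) ?u'"
    by simp
  have T: "smooth_at (?\<phi> ?u', local_rep e (s t) (?\<phi> ?u')) ?T" for t
    using transition_smooth_at[OF atlases(2) adapted_chartD(2)[OF e] adapted_chartD(2)[OF e'] s(2,3)]
    unfolding local_section_value[OF s(1) e s(2)] \<phi>x .
  note snd = jet_variation_linear[OF bounded_linear_snd jet_variation_compose[OF pair T]]
  \<comment> \<open>The coordinate formula represents the section where it stays in the domain of
    \<open>e\<close>; equality near the point suffices for germs.\<close>
  have near: "\<forall>\<^sub>F u' in nhds ?u'. snd (?T (?\<phi> u', local_rep e (s t) (?\<phi> u'))) = local_rep e' (s t) u'" for t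
  proof -
    obtain U where U: "open U" "x \<in> U" and sec: "\<And>y. y \<in> U \<Longrightarrow> local_section B y (s t) \<and> s t y \<in> fst (snd e)"
      using local_section_open[OF s(1) e s(2)] by metis
    have "snd (?T (snd (fst e) y, local_rep e (s t) (snd (fst e) y))) = snd (snd (snd e') (s t y))"
      if "y \<in> U" for y
      using sec[OF that] local_section_value[of y "s t" e] e chart_inv_left[OF ch(2)] by metis
    with eventually_mono[OF chart_eventually_in[OF ch'(1) U(1) x(2) U(2)]]
    show ?thesis by (auto simp: local_rep_def[of e'] elim!: eventually_mono)
  qed
  show ?thesis
    by (rule jet_variation_cong[OF snd near]) (simp add: transition_velocity_def Let_def)
qed

lemma contactI:
  assumes s: "local_section B x s" and s': "local_section B x s'" and eq: "s x = s' x"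
    and e: "e \<in> adapted_charts B" and x: "s x \<in> fst (snd e)"
    and coeffs: "jet_coeffs k e s x = jet_coeffs k e s' x"
  shows "contact B k x s s'"
  unfolding contact_def
proof (intro conjI ballI allI impI)
  fix e' and \<mu>s :: "'n list"
  assume e': "e' \<in> adapted_charts B" and x': "s x \<in> fst (snd e')" and len: "length \<mu>s \<le> k"
  define S where "S t = (if t = 0 then s else s')" for t :: real
  have S: "local_section B x (S t)" "S t x \<in> fst (snd e)" "S t x \<in> fst (snd e')" for t
    using s s' eq x x' by (auto simp: S_def)
  have const: "partials \<nu>s (local_rep e (S t)) (snd (fst e) x) = jet_coeffs k e s x (mset \<nu>s)"
    if "length \<nu>s \<le> k" for \<nu>s t
    using partials_local_rep[OF S(1) e S(2) that, of t] coeffs by (auto simp: S_def)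
  have "jet_variation k (\<lambda>t. local_rep e (S t)) (\<lambda>u. 0) (snd (fst e) x)"
    unfolding jet_variation_def
    using local_rep_smooth[OF S(1) e S(2)] by (simp add: smooth_at_const const partials_zero has_vector_derivative_const)
  from jet_variation_transition[OF e e' S this]
  have "((\<lambda>t. partials \<mu>s (local_rep e' (S t)) (snd (fst e') x)) has_vector_derivative
     partials \<mu>s (transition_velocity e e' (local_rep e (S 0)) (\<lambda>u. 0)) (snd (fst e') x)) (at 0)"
    using len unfolding jet_variation_def by blast
  \<comment> \<open>The family is \<open>s\<close> at \<open>0\<close> and \<open>s'\<close>
    elsewhere; continuity at \<open>0\<close> in the chart \<open>e'\<close> therefore forces equal
    derivatives.\<close>
  then have "isCont (\<lambda>t. partials \<mu>s (local_rep e' (S t)) (snd (fst e') x)) 0"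
    by (rule has_vector_derivative_continuous)
  then have "(\<lambda>t. partials \<mu>s (local_rep e' (S t)) (snd (fst e') x)) \<midarrow>0\<rightarrow>
      partials \<mu>s (local_rep e' s) (snd (fst e') x)"
    by (simp add: isCont_def S_def)
  moreover have "(\<lambda>t. partials \<mu>s (local_rep e' (S t)) (snd (fst e') x)) \<midarrow>0\<rightarrow>
      partials \<mu>s (local_rep e' s') (snd (fst e') x)"
    by (rule tendsto_eventually) (auto simp: S_def eventually_at_filter)
  ultimately show "partials \<mu>s (local_rep e' s) (snd (fst e') x) = partials \<mu>s (local_rep e' s') (snd (fst e') x)"
    by (rule tendsto_unique[OF at_neq_bot])
qed (fact eq)

text \<open>Equal coordinates give the same base point, then the same value, and
  \<open>contactI\<close> turns agreement of the coefficients in this single chart into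
  contact.\<close>

lemma jet_coords_inj:
  assumes e: "e \<in> adapted_charts B"
  shows "inj_on (jet_coords k e) (jet_dom B k e)"
proof (rule inj_onI)
  fix j j' assume j: "j \<in> jet_dom B k e" "j' \<in> jet_dom B k e" and eq: "jet_coords k e j = jet_coords k e j'"
  obtain s where s: "local_section B (fst j) s" "j = jet B k (fst j) s" "s (fst j) \<in> fst (snd e)"
    using j(1) by (rule jet_domE)
  obtain s' where s': "local_section B (fst j') s'" "j' = jet B k (fst j') s'" "s' (fst j') \<in> fst (snd e)"
    using j(2) by (rule jet_domE)
  have c: "snd (fst e) (fst j) = snd (fst e) (fst j')" and co: "jet_coeffs k e s (fst j) = jet_coeffs k e s' (fst j')"
    using eq jet_coords_jet[OF s(1) e s(3), of k] jet_coords_jet[OF s'(1) e s'(3), of k] s(2) s'(2) by simp_all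
  then have x: "fst j = fst j'"
    using is_chartD(3)[OF adapted_chartD(5)[OF e]] local_section_base[OF s(1) e s(3)]
      local_section_base[OF s'(1) e s'(3)] by (auto dest: inj_onD)
  have "local_rep e s (snd (fst e) (fst j)) = local_rep e s' (snd (fst e) (fst j'))"
    using fun_cong[OF co, of "{#}"] by (simp add: jet_coeffs_def)
  then have "snd (snd e) (s (fst j)) = snd (snd e) (s' (fst j))"
    using local_section_value[OF s(1) e s(3)] local_section_value[OF s'(1) e s'(3)] x by simp
  then have "s (fst j) = s' (fst j)"
    using is_chartD(3)[OF adapted_chartD(6)[OF e]] s(3) s'(3) x by (auto dest: inj_onD)
  then have "contact B k (fst j) s s'"
    using contactI[OF s(1) _ _ e s(3)] s'(1) co x by simp
  then show "j = j'"
    using s s' x jet_eq_iff[of "fst j" s s' k] by simp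
qed

text \<open>Coordinates of order 1 to \<open>k\<close> are unrestricted: the polynomial with
  coefficients \<open>snd z\<close> represents a local section with exactly this jet.\<close>

lemma jet_image_iff:
  assumes e: "e \<in> adapted_charts B"
  shows "z \<in> jet_image B k e \<longleftrightarrow>
    (fst z, snd z {#}) \<in> snd (snd e) ` fst (snd e) \<and> (\<forall>M. k < size M \<longrightarrow> snd z M = 0)"
    (is "?L \<longleftrightarrow> ?R")
proof
  assume ?L
  then obtain j where j: "j \<in> jet_dom B k e" "z = jet_coords k e j"
    unfolding jet_image_def by blast
  obtain s where s: "local_section B (fst j) s" "j = jet B k (fst j) s" "s (fst j) \<in> fst (snd e)"
    using j(1) by (rule jet_domE)
  have z: "z = (snd (fst e) (fst j), jet_coeffs k e s (fst j))"
    using j(2) jet_coords_jet[OF s(1) e s(3), of k] s(2) by simp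
  then have "(fst z, snd z {#}) = snd (snd e) (s (fst j))"
    using local_section_value[OF s(1) e s(3)] by (simp add: jet_coeffs_def)
  then show ?R using s(3) by (auto simp: z jet_coeffs_def)
next
  assume R: ?R
  then obtain p where p: "p \<in> fst (snd e)" "snd (snd e) p = (fst z, snd z {#})" by auto
  define x where "x = proj B p"
  have x: "x \<in> fst (fst e)" "snd (fst e) x = fst z"
    using adapted_chartD(3,4)[OF e p(1)] p(2) by (simp_all add: x_def)
  define g where "g = jet_polynomial k (fst z) (snd z)"
  have g: "smooth_at (snd (fst e) x) g" unfolding g_def by (rule smooth_at_jet_polynomial)
  have par: "partials \<mu>s g (fst z) = (if length \<mu>s \<le> k then snd z (mset \<mu>s) else 0)" for \<mu>s
    unfolding g_def by (rule partials_jet_polynomial)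
  have val: "(snd (fst e) x, g (snd (fst e) x)) \<in> snd (snd e) ` fst (snd e)"
    using R par[of "[]"] x by simp
  note rep = rep_section[OF e x(1) g val]
  have "jet_coeffs k e (rep_section e g) x = snd z"
    using R by (auto simp: fun_eq_iff jet_coeffs_rep_section[OF e x(1) g val] x par simp flip: size_mset)
  then have "jet_coords k e (jet B k x (rep_section e g)) = z"
    using jet_coords_jet[OF rep(1) e rep(2)] x by simp
  moreover have "jet B k x (rep_section e g) \<in> jet_dom B k e"
    using jet_in_dom[OF rep(1)] rep(2) by simp
  ultimately show ?L unfolding jet_image_def by blast
qed

lemma jet_point_image:
  "z \<in> jet_image B k e \<Longrightarrow> jet_point B k e z \<in> jet_dom B k e"
  "z \<in> jet_image B k e \<Longrightarrow> jet_coords k e (jet_point B k e z) = z"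
  unfolding jet_image_def jet_point_def by (rule inv_into_into f_inv_into_f, assumption)+

lemma jet_point_coords:
  "e \<in> adapted_charts B \<Longrightarrow> j \<in> jet_dom B k e \<Longrightarrow> jet_point B k e (jet_coords k e j) = j"
  unfolding jet_point_def using jet_coords_inj by (rule inv_into_f_f)

end

section \<open>Vertical vectors and momenta\<close>

definition orderings :: "'n multiset \<Rightarrow> real" where
  "orderings M = real (card {\<nu>s. mset \<nu>s = M})"

lemma finite_orderings: "finite {\<nu>s. mset \<nu>s = M}"
  by (rule finite_subset[of _ "{xs. set xs \<subseteq> set_mset M \<and> length xs \<le> size M}"])
    (auto intro: finite_lists_length_le)

lemma orderings_pos: "orderings M > 0"
proof -
  have "{\<nu>s. mset \<nu>s = M} \<noteq> {}" using ex_mset[of M] by blast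
  then show ?thesis
    using finite_orderings[of M] by (simp add: orderings_def card_gt_0_iff)
qed

lemma sum_lists_multisets:
  fixes f :: "'n::finite multiset \<Rightarrow> real"
  shows "(\<Sum>\<mu>s | length \<mu>s \<le> k. f (mset \<mu>s)) = (\<Sum>M | size M \<le> k. orderings M * f M)"
proof -
  have "(\<Sum>\<mu>s | length \<mu>s \<le> k. f (mset \<mu>s)) =
      (\<Sum>M\<in>mset ` {\<mu>s. length \<mu>s \<le> k}. \<Sum>\<mu>s\<in>{\<mu>s \<in> {\<mu>s. length \<mu>s \<le> k}. mset \<mu>s = M}. f (mset \<mu>s))"
    by (rule sum.image_gen[OF finite_lists_le])
  also have "\<dots> = (\<Sum>M | size M \<le> k. orderings M * f M)"
    unfolding multisets_size_le_eq[symmetric]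
  proof (rule sum.cong[OF refl])
    fix M :: "'n multiset" assume "M \<in> {M. size M \<le> k}"
    then have "{\<mu>s \<in> {\<mu>s. length \<mu>s \<le> k}. mset \<mu>s = M} = {\<mu>s. mset \<mu>s = M}"
      by (auto simp flip: size_mset)
    then show "(\<Sum>\<mu>s\<in>{\<mu>s \<in> {\<mu>s. length \<mu>s \<le> k}. mset \<mu>s = M}. f (mset \<mu>s)) = orderings M * f M"
      by (simp add: orderings_def)
  qed
  finally show ?thesis .
qed

lemma jet_polynomial_linear:
  "jet_polynomial k v (\<lambda>M. r *\<^sub>R a M + s *\<^sub>R b M) u = r *\<^sub>R jet_polynomial k v a u + s *\<^sub>R jet_polynomial k v b u"
  by (simp add: jet_polynomial_def scaleR_right_distrib sum.distrib scaleR_sum_right mult.commute)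

lemma transition_velocity_linear:
  "transition_velocity e e' g (\<lambda>u. r *\<^sub>R a u + s *\<^sub>R b u) u' =
    r *\<^sub>R transition_velocity e e' g a u' + s *\<^sub>R transition_velocity e e' g b u'"
  by (simp add: transition_velocity_def Let_def inner_prod_def inner_add_right scaleR_left_distrib
      inner_add_left sum.distrib scaleR_sum_right snd_sum)

lemma jet_coords_beyond: "k < size M \<Longrightarrow> snd (jet_coords k e j) M = 0"
  by (simp add: jet_coords_def Let_def)

lemma vertical_spaceD:
  fixes B :: "('m::topological_space, 'e::topological_space, 'q, 'n::{finite,linorder}, 'k::finite) fbundle"
  assumes "v \<in> vertical_space B k j"
  obtains \<gamma> :: "real \<Rightarrow> ('m, 'e) jet" where "\<gamma> 0 = j" "\<And>t. \<gamma> t \<in> jet_space B k" "\<And>t. fst (\<gamma> t) = fst j"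
    "\<And>e. e \<in> adapted_charts B \<Longrightarrow> j \<in> jet_dom B k e \<Longrightarrow> \<forall>\<^sub>F t in nhds 0. \<gamma> t \<in> jet_dom B k e"
    "\<And>e M. e \<in> adapted_charts B \<Longrightarrow> j \<in> jet_dom B k e \<Longrightarrow>
      ((\<lambda>t. snd (jet_coords k e (\<gamma> t)) M) has_vector_derivative v e M) (at 0)"
proof -
  obtain \<gamma> :: "real \<Rightarrow> ('m, 'e) jet" where \<gamma>: "\<gamma> 0 = j" "\<forall>t. \<gamma> t \<in> jet_space B k \<and> fst (\<gamma> t) = fst j"
    and e: "\<forall>e\<in>adapted_charts B. j \<in> jet_dom B k e \<longrightarrow>
        (\<forall>\<^sub>F t in at 0. \<gamma> t \<in> jet_dom B k e) \<and>
        (\<forall>M. (\<lambda>t. snd (jet_coords k e (\<gamma> t)) M) differentiable (at 0))"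
    and v: "v = (\<lambda>e M. if e \<in> adapted_charts B \<and> j \<in> jet_dom B k e
                then vector_derivative (\<lambda>t. snd (jet_coords k e (\<gamma> t)) M) (at 0) else 0)"
    using assms unfolding vertical_space_def by blast
  show ?thesis
  proof (rule that[of \<gamma>])
    show "\<forall>\<^sub>F t in nhds 0. \<gamma> t \<in> jet_dom B k e" if "e \<in> adapted_charts B" "j \<in> jet_dom B k e" for e
      using e \<gamma>(1) that by (simp add: eventually_nhds_conv_at)
    show "((\<lambda>t. snd (jet_coords k e (\<gamma> t)) M) has_vector_derivative v e M) (at 0)"
      if "e \<in> adapted_charts B" "j \<in> jet_dom B k e" for e M
      using e that by (simp add: v vector_derivative_works)
  qed (use \<gamma> in auto)
qed

lemma vertical_space_outside:
  "v \<in> vertical_space B k j \<Longrightarrow> \<not> (e \<in> adapted_charts B \<and> j \<in> jet_dom B k e) \<Longrightarrow> v e M = 0"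
  unfolding vertical_space_def by auto

lemma vertical_space_beyond:
  fixes B :: "('m::topological_space, 'e::topological_space, 'q, 'n::{finite,linorder}, 'k::finite) fbundle"
  assumes v: "v \<in> vertical_space B k j" and M: "k < size M"
  shows "v e M = 0"
proof (cases "e \<in> adapted_charts B \<and> j \<in> jet_dom B k e")
  case True
  have "\<exists>\<gamma> :: real \<Rightarrow> ('m, 'e) jet. ((\<lambda>t. snd (jet_coords k e (\<gamma> t)) M) has_vector_derivative v e M) (at 0)"
    by (rule vertical_spaceD[OF v]) (use True in blast)
  then have "((\<lambda>t. 0 :: (real, 'k) vec) has_vector_derivative v e M) (at (0 :: real))"
    using M by (simp add: jet_coords_beyond)
  from vector_derivative_unique_at[OF this has_vector_derivative_const] show ?thesis .
qed (use vertical_space_outside[OF v] in simp)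

context
  fixes B :: "('m::{t2_space,second_countable_topology}, 'e::{t2_space,second_countable_topology},
               'q::{t2_space,second_countable_topology}, 'n::{finite,linorder}, 'k::finite) fbundle"
  assumes B: "smooth_fibre_bundle B"
begin

text \<open>The curve of jets is represented by sections, whose representatives in \<open>e\<close>
  form a variation with velocity germ the polynomial with coefficients \<open>v e\<close>. Transport
  gives the velocity in \<open>e'\<close>, so that \<open>v e'\<close> is computed from
  \<open>v e\<close> without reference to the curve.\<close>

lemma vertical_transition:
  fixes s :: "'m \<Rightarrow> 'e" and x k defines "j \<equiv> jet B k x s"
  assumes s: "local_section B x s" and v: "v \<in> vertical_space B k j"
    and e: "e \<in> adapted_charts B" "s x \<in> fst (snd e)" and e': "e' \<in> adapted_charts B" "s x \<in> fst (snd e')"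
  defines "tv \<equiv> transition_velocity e e' (local_rep e s) (jet_polynomial k (snd (fst e) x) (v e))"
  shows "smooth_at (snd (fst e') x) tv"
    and "length \<mu>s \<le> k \<Longrightarrow> partials \<mu>s tv (snd (fst e') x) = v e' (mset \<mu>s)"
proof -
  obtain \<gamma> where \<gamma>: "\<gamma> 0 = j" "\<And>t. \<gamma> t \<in> jet_space B k" "\<And>t. fst (\<gamma> t) = fst j"
    and dom: "\<And>e. e \<in> adapted_charts B \<Longrightarrow> j \<in> jet_dom B k e \<Longrightarrow> \<forall>\<^sub>F t in nhds 0. \<gamma> t \<in> jet_dom B k e"
    and der: "\<And>e M. e \<in> adapted_charts B \<Longrightarrow> j \<in> jet_dom B k e \<Longrightarrow>
      ((\<lambda>t. snd (jet_coords k e (\<gamma> t)) M) has_vector_derivative v e M) (at 0)"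
    by (rule vertical_spaceD[OF v]) (rule that, assumption+)
  have x: "fst j = x" by (simp add: j_def jet_fst[OF B])
  have "\<exists>s. local_section B x s \<and> \<gamma> t = jet B k x s" for t
    using jet_spaceE[OF B \<gamma>(2)[of t]] \<gamma>(3)[of t] x by metis
  then obtain s\<^sub>0 where s\<^sub>0: "\<And>t. local_section B x (s\<^sub>0 t)" "\<And>t. \<gamma> t = jet B k x (s\<^sub>0 t)"
    by metis
  \<comment> \<open>Variations require sections with values in both charts for every
    \<open>t\<close>. The family is therefore altered away from \<open>0\<close>, and the section at
    \<open>0\<close> is taken to be \<open>s\<close> itself.\<close>
  define S where "S t = (if t = 0 \<or> s\<^sub>0 t x \<notin> fst (snd e) \<inter> fst (snd e') then s else s\<^sub>0 t)" for t
  have S: "local_section B x (S t)" "S t x \<in> fst (snd e)" "S t x \<in> fst (snd e')" for t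
    using s s\<^sub>0 e e' by (auto simp: S_def)
  have jdom: "j \<in> jet_dom B k e" "j \<in> jet_dom B k e'"
    using s e(2) e'(2) by (simp_all add: j_def jet_in_dom[OF B])
  have ev: "\<forall>\<^sub>F t in nhds 0. \<gamma> t = jet B k x (S t)"
    using eventually_conj[OF dom[OF e(1) jdom(1)] dom[OF e'(1) jdom(2)]]
  proof (rule eventually_mono)
    fix t assume "\<gamma> t \<in> jet_dom B k e \<and> \<gamma> t \<in> jet_dom B k e'"
    then show "\<gamma> t = jet B k x (S t)"
      using \<gamma>(1) by (cases "t = 0") (auto simp: S_def s\<^sub>0(2)[of t] jet_in_dom[OF B s\<^sub>0(1)] j_def)
  qed
  have partials: "((\<lambda>t. partials \<mu>s (local_rep a (S t)) (snd (fst a) x)) has_vector_derivative v a (mset \<mu>s)) (at 0)"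
    if "a \<in> {e, e'}" "length \<mu>s \<le> k" for a \<mu>s
  proof (rule has_vector_derivative_eventually_cong)
    have a: "a \<in> adapted_charts B" "\<And>t. S t x \<in> fst (snd a)" "j \<in> jet_dom B k a"
      using that e e' S jdom by auto
    show "((\<lambda>t. snd (jet_coords k a (\<gamma> t)) (mset \<mu>s)) has_vector_derivative v a (mset \<mu>s)) (at 0)"
      by (rule der[OF a(1,3)])
    show "\<forall>\<^sub>F t in nhds 0. snd (jet_coords k a (\<gamma> t)) (mset \<mu>s) = partials \<mu>s (local_rep a (S t)) (snd (fst a) x)"
      using ev by (rule eventually_mono)
        (simp add: jet_coords_jet[OF B S(1) a(1,2)] partials_local_rep[OF B S(1) a(1,2) that(2)])
  qed
  have "jet_variation k (\<lambda>t. local_rep e (S t)) (jet_polynomial k (snd (fst e) x) (v e)) (snd (fst e) x)"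
    unfolding jet_variation_def
    using local_rep_smooth[OF B S(1) e(1) S(2)] partials[of e]
    by (simp add: smooth_at_jet_polynomial partials_jet_polynomial)
  from jet_variation_transition[OF B e(1) e'(1) S this]
  have var: "jet_variation k (\<lambda>t. local_rep e' (S t)) tv (snd (fst e') x)"
    by (simp add: tv_def S_def)
  then show "smooth_at (snd (fst e') x) tv" by (rule jet_variation_smooth(2))
  show "partials \<mu>s tv (snd (fst e') x) = v e' (mset \<mu>s)" if "length \<mu>s \<le> k"
    using var partials[of e' \<mu>s] that unfolding jet_variation_def
    by (auto intro: vector_derivative_unique_at)
qed

text \<open>The representative of \<open>s\<close> is moved linearly along the polynomial with
  coefficients \<open>a\<close>. A vertical curve must be differentiable in every adapted chart
  around its jet, which \<open>jet_variation_transition\<close> supplies.\<close>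

lemma vertical_space_surj:
  assumes s: "local_section B x s" and e: "e \<in> adapted_charts B" "s x \<in> fst (snd e)"
    and a: "\<And>M. k < size M \<Longrightarrow> a M = 0"
  shows "\<exists>v\<in>vertical_space B k (jet B k x s). v e = a"
proof -
  let ?j = "jet B k x s" and ?u = "snd (fst e) x" and ?g = "local_rep e s"
  let ?h = "jet_polynomial k ?u a"
  let ?z = "\<lambda>t. (?u, ?g ?u + t *\<^sub>R ?h ?u)"
  define g where "g t u = ?g u + t *\<^sub>R ?h u" for t u
  define S where "S t = (if t = 0 \<or> ?z t \<notin> snd (snd e) ` fst (snd e) then s else rep_section e (g t))" for t
  note ch = adapted_chartD(5,6)[OF e(1)]
  have x: "x \<in> fst (fst e)" by (rule local_section_base[OF B s e])
  have z0: "?z 0 = snd (snd e) (s x)" using local_section_value[OF B s e] by simp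
  have "((\<lambda>t. ?z t) \<longlongrightarrow> ?z 0) (nhds 0)"
    by (intro tendsto_intros filterlim_ident)
  then have lim: "((\<lambda>t. ?z t) \<longlongrightarrow> snd (snd e) (s x)) (nhds 0)" unfolding z0 .
  have g: "smooth_at ?u (g t)" for t
    unfolding g_def
    by (intro smooth_at_add local_rep_smooth[OF B s e] smooth_at_linear_compose[OF bounded_linear_scaleR_right]
        smooth_at_jet_polynomial)
  have rep: "local_section B x (rep_section e (g t))" "rep_section e (g t) x \<in> fst (snd e)"
    "\<forall>\<^sub>F u in nhds ?u. local_rep e (rep_section e (g t)) u = g t u"
    if "?z t \<in> snd (snd e) ` fst (snd e)" for t
    using rep_section[OF B e(1) x g, of t] that by (simp_all add: g_def)
  have S: "local_section B x (S t)" "S t x \<in> fst (snd e)" for t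
    using rep s e by (auto simp: S_def)
  have near: "\<forall>\<^sub>F t in nhds 0. ?z t \<in> snd (snd e) ` fst (snd e) \<and> S t x \<in> U" if "open U" "s x \<in> U" for U
    using eventually_compose_filterlim[OF chart_eventually_in[OF ch(2) that(1) e(2) that(2)] lim]
    by (rule eventually_mono) (use that in \<open>auto simp: S_def rep_section_def g_def\<close>)
  have parts: "partials \<mu>s (local_rep e (S t)) ?u = partials \<mu>s ?g ?u + t *\<^sub>R partials \<mu>s ?h ?u"
    if "?z t \<in> snd (snd e) ` fst (snd e)" for t \<mu>s
  proof (cases "t = 0")
    case False
    have "partials \<mu>s (local_rep e (S t)) ?u = partials \<mu>s (g t) ?u"
      using partials_cong_eventually[OF rep(3)[OF that]] that False by (simp add: S_def)
    also have "\<dots> = partials \<mu>s ?g ?u + partials \<mu>s (\<lambda>u. t *\<^sub>R ?h u) ?u"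
      unfolding g_def by (intro partials_add local_rep_smooth[OF B s e]
          smooth_at_linear_compose[OF bounded_linear_scaleR_right] smooth_at_jet_polynomial)
    also have "partials \<mu>s (\<lambda>u. t *\<^sub>R ?h u) ?u = t *\<^sub>R partials \<mu>s ?h ?u"
      by (rule partials_linear_compose[OF bounded_linear_scaleR_right smooth_at_jet_polynomial])
    finally show ?thesis .
  qed (simp add: S_def)
  have var: "\<exists>S' G'. jet_variation k (\<lambda>t. local_rep e' (S' t)) G' (snd (fst e') x) \<and>
      (\<forall>t. local_section B x (S' t) \<and> S' t x \<in> fst (snd e')) \<and> (\<forall>\<^sub>F t in nhds 0. S' t = S t)"
    if e': "e' \<in> adapted_charts B" "s x \<in> fst (snd e')" for e'
  proof -
    \<comment> \<open>Each chart needs its own modification, since the times for which the value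
      stays in its domain depend on the chart; near \<open>0\<close> nothing changes.\<close>
    define S' where "S' t = (if S t x \<in> fst (snd e') then S t else s)" for t
    have S': "local_section B x (S' t)" "S' t x \<in> fst (snd e)" "S' t x \<in> fst (snd e')" for t
      using S s e e' by (auto simp: S'_def)
    have ev: "\<forall>\<^sub>F t in nhds 0. ?z t \<in> snd (snd e) ` fst (snd e) \<and> S' t = S t"
      using near[OF is_chartD(1)[OF adapted_chartD(6)[OF e'(1)]] e'(2)]
      by (rule eventually_mono) (auto simp: S'_def)
    have "((\<lambda>t. partials \<mu>s (local_rep e (S' t)) ?u) has_vector_derivative partials \<mu>s ?h ?u) (at 0)" for \<mu>s
    proof (rule has_vector_derivative_eventually_cong)
      show "((\<lambda>t. partials \<mu>s ?g ?u + t *\<^sub>R partials \<mu>s ?h ?u) has_vector_derivative partials \<mu>s ?h ?u) (at 0)"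
        by (auto intro!: derivative_eq_intros)
      show "\<forall>\<^sub>F t in nhds 0. partials \<mu>s ?g ?u + t *\<^sub>R partials \<mu>s ?h ?u = partials \<mu>s (local_rep e (S' t)) ?u"
        using ev by (rule eventually_mono) (simp add: parts)
    qed
    then have var: "jet_variation k (\<lambda>t. local_rep e (S' t)) ?h ?u"
      unfolding jet_variation_def
      using local_rep_smooth[OF B S'(1) e(1) S'(2)] by (simp add: smooth_at_jet_polynomial)
    have "\<forall>\<^sub>F t in nhds 0. S' t = S t"
      using ev by (rule eventually_mono) simp
    then show ?thesis
      using S'(1,3) jet_variation_transition[OF B e(1) e'(1) S' var] by (intro exI[of _ S'] exI conjI) simp_all
  qed
  define \<gamma> where "\<gamma> t = jet B k x (S t)" for t
  define v where "v = (\<lambda>e M. if e \<in> adapted_charts B \<and> ?j \<in> jet_dom B k e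
                then vector_derivative (\<lambda>t. snd (jet_coords k e (\<gamma> t)) M) (at 0) else 0)"
  have \<gamma>0: "\<gamma> 0 = ?j" by (simp add: \<gamma>_def S_def)
  have dom: "\<forall>\<^sub>F t in nhds 0. \<gamma> t \<in> jet_dom B k e'"
    and diff: "(\<lambda>t. snd (jet_coords k e' (\<gamma> t)) M) differentiable (at 0)"
    if e': "e' \<in> adapted_charts B" "?j \<in> jet_dom B k e'" for e' M
  proof -
    have sx: "s x \<in> fst (snd e')" using e'(2) jet_in_dom[OF B s] by simp
    obtain S' G' where S': "jet_variation k (\<lambda>t. local_rep e' (S' t)) G' (snd (fst e') x)"
      "\<And>t. local_section B x (S' t)" "\<And>t. S' t x \<in> fst (snd e')" "\<forall>\<^sub>F t in nhds 0. S' t = S t"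
      using var[OF e'(1) sx] by blast
    show "\<forall>\<^sub>F t in nhds 0. \<gamma> t \<in> jet_dom B k e'"
      using S'(4) by (rule eventually_mono) (metis S'(2,3) \<gamma>_def jet_in_dom[OF B])
    show "(\<lambda>t. snd (jet_coords k e' (\<gamma> t)) M) differentiable (at 0)"
    proof (cases "size M \<le> k")
      case True
      have "((\<lambda>t. snd (jet_coords k e' (\<gamma> t)) M) has_vector_derivative
          partials (sorted_list_of_multiset M) G' (snd (fst e') x)) (at 0)"
      proof (rule has_vector_derivative_eventually_cong)
        show "((\<lambda>t. partials (sorted_list_of_multiset M) (local_rep e' (S' t)) (snd (fst e') x))
            has_vector_derivative partials (sorted_list_of_multiset M) G' (snd (fst e') x)) (at 0)"
          using S'(1) True unfolding jet_variation_def by (simp flip: size_mset)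
        show "\<forall>\<^sub>F t in nhds 0. partials (sorted_list_of_multiset M) (local_rep e' (S' t)) (snd (fst e') x) =
            snd (jet_coords k e' (\<gamma> t)) M"
          using S'(4)
        proof (rule eventually_mono)
          fix t assume "S' t = S t"
          then have "S t = S' t" by simp
          then show "partials (sorted_list_of_multiset M) (local_rep e' (S' t)) (snd (fst e') x) =
            snd (jet_coords k e' (\<gamma> t)) M"
            using True by (simp add: \<gamma>_def jet_coeffs_def jet_coords_jet[OF B S'(2) e'(1) S'(3)])
        qed
      qed
      then show ?thesis by (rule differentiableI_vector)
    qed (simp add: jet_coords_beyond)
  qed
  have "v e M = a M" for M
  proof -
    have jd: "?j \<in> jet_dom B k e" using jet_in_dom[OF B s] e by simp
    have "((\<lambda>t. snd (jet_coords k e (\<gamma> t)) M) has_vector_derivative a M) (at 0)"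
    proof (cases "size M \<le> k")
      case True
      let ?\<mu>s = "sorted_list_of_multiset M"
      show ?thesis
      proof (rule has_vector_derivative_eventually_cong)
        show "((\<lambda>t. partials ?\<mu>s ?g ?u + t *\<^sub>R a M) has_vector_derivative a M) (at 0)"
          by (auto intro!: derivative_eq_intros)
        have "partials ?\<mu>s ?h ?u = a M"
          using True by (simp add: partials_jet_polynomial flip: size_mset)
        then have "partials ?\<mu>s ?g ?u + t *\<^sub>R a M = snd (jet_coords k e (\<gamma> t)) M"
          if "?z t \<in> snd (snd e) ` fst (snd e)" for t
          using parts[OF that, of ?\<mu>s] True
          by (simp add: \<gamma>_def jet_coords_jet[OF B S(1) e(1) S(2)] jet_coeffs_def)
        then show "\<forall>\<^sub>F t in nhds 0. partials ?\<mu>s ?g ?u + t *\<^sub>R a M = snd (jet_coords k e (\<gamma> t)) M"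
          using near[OF open_UNIV UNIV_I] by (auto elim!: eventually_mono)
      qed
    qed (simp add: jet_coords_beyond a has_vector_derivative_const)
    then show ?thesis
      using e jd by (simp add: v_def vector_derivative_at)
  qed
  moreover have "v \<in> vertical_space B k ?j"
    unfolding vertical_space_def
  proof (intro CollectI exI[of _ \<gamma>] conjI allI ballI impI)
    show "\<gamma> t \<in> jet_space B k" "fst (\<gamma> t) = fst ?j" for t
      unfolding \<gamma>_def using jet_in_space[OF B S(1)] by (simp_all add: jet_fst[OF B])
    show "\<forall>\<^sub>F t in at 0. \<gamma> t \<in> jet_dom B k e'" if "e' \<in> adapted_charts B" "?j \<in> jet_dom B k e'" for e'
      using dom[OF that] by (simp add: eventually_nhds_conv_at)
  qed (use \<gamma>0 diff v_def in auto)
  ultimately show ?thesis by (intro bexI[of _ v]) auto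
qed

lemma vertical_vector_eq:
  assumes s: "local_section B x s" and v: "v \<in> vertical_space B k (jet B k x s)"
    and e: "e \<in> adapted_charts B" "s x \<in> fst (snd e)"
    and e': "e' \<in> adapted_charts B" "s x \<in> fst (snd e')"
  shows "v e' M = (if size M \<le> k then partials (sorted_list_of_multiset M)
    (transition_velocity e e' (local_rep e s) (jet_polynomial k (snd (fst e) x) (v e))) (snd (fst e') x) else 0)"
  using vertical_transition(2)[OF s v e e', of "sorted_list_of_multiset M"] vertical_space_beyond[OF v, of M e']
  by (auto simp flip: size_mset)

lemma vertical_vector_eqI:
  assumes s: "local_section B x s" and e: "e \<in> adapted_charts B" "s x \<in> fst (snd e)"
    and v: "v \<in> vertical_space B k (jet B k x s)" "w \<in> vertical_space B k (jet B k x s)" "v e = w e"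
  shows "v = w"
proof (intro ext)
  fix e' M
  show "v e' M = w e' M"
  proof (cases "e' \<in> adapted_charts B \<and> jet B k x s \<in> jet_dom B k e'")
    case True
    then have e': "e' \<in> adapted_charts B" "s x \<in> fst (snd e')"
      using jet_in_dom[OF B s] by auto
    show ?thesis
      unfolding vertical_vector_eq[OF s v(1) e e'] vertical_vector_eq[OF s v(2) e e'] v(3) ..
  next
    case False
    then show ?thesis
      using vertical_space_outside[OF v(1) False] vertical_space_outside[OF v(2) False] by simp
  qed
qed

text \<open>As for tangent vectors, the combination is realised in one chart;
  \<open>transition_velocity\<close> is linear in the velocity germ, and the polynomial is linear in
  its coefficients.\<close>

lemma vertical_space_linear:
  assumes s: "local_section B x s"
    and v: "v \<in> vertical_space B k (jet B k x s)" "w \<in> vertical_space B k (jet B k x s)"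
  shows "(\<lambda>e M. a *\<^sub>R v e M + b *\<^sub>R w e M) \<in> vertical_space B k (jet B k x s)"
proof -
  obtain e where e: "e \<in> adapted_charts B" "s x \<in> fst (snd e)"
    using adapted_chart_exists[OF B] by blast
  obtain z where z: "z \<in> vertical_space B k (jet B k x s)" "z e = (\<lambda>M. a *\<^sub>R v e M + b *\<^sub>R w e M)"
    using vertical_space_surj[OF s e, of k "\<lambda>M. a *\<^sub>R v e M + b *\<^sub>R w e M"]
      vertical_space_beyond[OF v(1)] vertical_space_beyond[OF v(2)] by auto
  have "z e' M = a *\<^sub>R v e' M + b *\<^sub>R w e' M" for e' M
  proof (cases "e' \<in> adapted_charts B \<and> jet B k x s \<in> jet_dom B k e'")
    case True
    then have e': "e' \<in> adapted_charts B" "s x \<in> fst (snd e')"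
      using jet_in_dom[OF B s] by auto
    let ?u = "snd (fst e) x" and ?u' = "snd (fst e') x"
    let ?tv = "\<lambda>v. transition_velocity e e' (local_rep e s) (jet_polynomial k ?u (v e))"
    have "?tv z = (\<lambda>u. a *\<^sub>R ?tv v u + b *\<^sub>R ?tv w u)"
      unfolding z(2) jet_polynomial_linear[abs_def] transition_velocity_linear[abs_def] ..
    moreover have "partials \<mu>s (\<lambda>u. a *\<^sub>R ?tv v u + b *\<^sub>R ?tv w u) ?u' =
        a *\<^sub>R partials \<mu>s (?tv v) ?u' + b *\<^sub>R partials \<mu>s (?tv w) ?u'" for \<mu>s
      by (simp only: partials_add[OF smooth_at_linear_compose[OF bounded_linear_scaleR_right vertical_transition(1)[OF s v(1) e e']]
            smooth_at_linear_compose[OF bounded_linear_scaleR_right vertical_transition(1)[OF s v(2) e e']]]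
          partials_linear_compose[OF bounded_linear_scaleR_right vertical_transition(1)[OF s v(1) e e']]
          partials_linear_compose[OF bounded_linear_scaleR_right vertical_transition(1)[OF s v(2) e e']])
    ultimately show ?thesis
      unfolding vertical_vector_eq[OF s v(1) e e'] vertical_vector_eq[OF s v(2) e e'] vertical_vector_eq[OF s z(1) e e']
      by simp
  next
    case False
    then show ?thesis
      using vertical_space_outside[OF v(1) False] vertical_space_outside[OF v(2) False]
        vertical_space_outside[OF z(1) False] by simp
  qed
  then have "z = (\<lambda>e M. a *\<^sub>R v e M + b *\<^sub>R w e M)" by (intro ext)
  then show ?thesis using z(1) by simp
qed

end

section \<open>Momenta of points of the phase bundle\<close>

definition pairing ::
  "nat \<Rightarrow> ('n::finite multiset \<Rightarrow> 'k::finite \<Rightarrow> 'n \<Rightarrow> real) \<Rightarrow> ('n multiset \<Rightarrow> real^'k) \<Rightarrow> real^'n" where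
  "pairing k P a = (\<chi> \<kappa>. \<Sum>\<mu>s | length \<mu>s \<le> k. \<Sum>A\<in>UNIV. P (mset \<mu>s) A \<kappa> * a (mset \<mu>s) $ A)"

lemma pairing_multisets:
  "pairing k P a $ \<kappa> = (\<Sum>M | size M \<le> k. \<Sum>A\<in>UNIV. orderings M * P M A \<kappa> * a M $ A)"
proof -
  have "pairing k P a $ \<kappa> = (\<Sum>M | size M \<le> k. orderings M * (\<Sum>A\<in>UNIV. P M A \<kappa> * a M $ A))"
    unfolding pairing_def using sum_lists_multisets[of "\<lambda>M. \<Sum>A\<in>UNIV. P M A \<kappa> * a M $ A" k] by simp
  then show ?thesis by (simp add: sum_distrib_left mult.assoc)
qed

text \<open>The sum over index lists meets the multiset \<open>M\<close> once for each of its
  orderings.\<close>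

lemma pairing_unit:
  assumes "size M \<le> k"
  shows "pairing k P (\<lambda>N. if N = M then axis A 1 else 0) $ \<kappa> = orderings M * P M A \<kappa>"
proof -
  have "(\<Sum>A'\<in>UNIV. orderings N * P N A' \<kappa> * (if N = M then axis A (1::real) else 0) $ A') =
      (if N = M then orderings M * P M A \<kappa> else 0)" for N
    by (auto simp: axis_def if_distrib[of "\<lambda>x. _ * x"] cong: if_cong)
  then show ?thesis
    using assms by (simp add: pairing_multisets sum.delta finite_multisets_size_le)
qed

lemma sub_form_sum:
  fixes A :: "('m::topological_space, (real, 'n::{finite,linorder}) vec) chart set"
  shows "sub_form A c x (\<Sum>i\<in>I. r i *\<^sub>R a i) vs = (\<Sum>i\<in>I. r i * sub_form A c x (a i) vs)"
proof (cases "length vs = CARD('n) - 1 \<and> set vs \<subseteq> tangent_space A x")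
  case True
  then show ?thesis
    by (simp add: sub_form_def sum_distrib_right sum_distrib_left sum.swap[of _ I] mult.assoc)
next
  case False
  then have "sub_form A c x b vs = 0" for b by (simp only: sub_form_def if_False)
  then show ?thesis by simp
qed

text \<open>The property under the \<open>THE\<close> of \<open>momenta\<close>, named so that
  uniqueness and existence can be treated separately.\<close>

definition is_momenta ::
  "('m::topological_space, 'e::topological_space, 'q, 'n::{finite,linorder}, 'k::finite) fbundle \<Rightarrow>
   nat \<Rightarrow> ('m, 'e, 'n, 'k) achart \<Rightarrow> ('m, 'e) jet \<Rightarrow> (('m, 'e, 'n, 'k) vvec \<Rightarrow> ('m, (real, 'n) vec) form) \<Rightarrow>
   ('n multiset \<Rightarrow> 'k \<Rightarrow> 'n \<Rightarrow> real) \<Rightarrow> bool" where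
  "is_momenta B k e j p P \<longleftrightarrow> (\<forall>M A \<kappa>. size M > k \<longrightarrow> P M A \<kappa> = 0) \<and>
     (\<forall>v\<in>vertical_space B k j. p v = sub_form (base_atlas B) (fst e) (fst j) (pairing k P (v e)))"

lemma momenta_eq_THE: "momenta B k e (j, p) = (THE P. is_momenta B k e j p P)"
  by (simp add: momenta_def is_momenta_def pairing_def)

context
  fixes B :: "('m::{t2_space,second_countable_topology}, 'e::{t2_space,second_countable_topology},
               'q::{t2_space,second_countable_topology}, 'n::{finite,linorder}, 'k::finite) fbundle"
  assumes B: "smooth_fibre_bundle B"
begin

text \<open>Vertical vectors with a single unit component exist, and \<open>sub_form\<close> is
  injective in its coefficients; this isolates each momentum up to the positive factor
  \<open>orderings M\<close>.\<close>

lemma momenta_unique: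
  assumes s: "local_section B x s" and e: "e \<in> adapted_charts B" "s x \<in> fst (snd e)"
    and P: "is_momenta B k e (jet B k x s) p P" and Q: "is_momenta B k e (jet B k x s) p Q"
  shows "P = Q"
proof (intro ext)
  fix M A \<kappa>
  show "P M A \<kappa> = Q M A \<kappa>"
  proof (cases "size M \<le> k")
    case True
    have "\<exists>v\<in>vertical_space B k (jet B k x s). v e = (\<lambda>N. if N = M then axis A 1 else 0)"
      by (rule vertical_space_surj[OF B s e]) (use True in auto)
    then obtain v where v: "v \<in> vertical_space B k (jet B k x s)" "v e = (\<lambda>N. if N = M then axis A 1 else 0)"
      by blast
    have "pairing k P (v e) = pairing k Q (v e)"
      using P Q v(1) unfolding is_momenta_def
      by (intro sub_form_inj[OF atlases(1)[OF B] adapted_chartD(1)[OF e(1)] local_section_base[OF B s e]])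
        (simp add: jet_fst[OF B])
    then have "orderings M * P M A \<kappa> = orderings M * Q M A \<kappa>"
      unfolding v(2) using pairing_unit[OF True] by metis
    then show ?thesis using orderings_pos[of M] by simp
  next
    case False
    then show ?thesis using P Q by (simp add: is_momenta_def)
  qed
qed

lemma momenta_eqI:
  assumes "local_section B x s" "e \<in> adapted_charts B" "s x \<in> fst (snd e)"
    and "is_momenta B k e (jet B k x s) p P"
  shows "momenta B k e (jet B k x s, p) = P"
  unfolding momenta_eq_THE using assms(4) momenta_unique[OF assms(1-3)] by blast

lemma phase_space_sum:
  assumes s: "local_section B x s" and p: "(jet B k x s, p) \<in> phase_space B k"
    and W: "\<And>i. i \<in> I \<Longrightarrow> W i \<in> vertical_space B k (jet B k x s)" and fin: "finite I"
  shows "(\<lambda>e M. \<Sum>i\<in>I. r i *\<^sub>R W i e M) \<in> vertical_space B k (jet B k x s) \<and>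
    p (\<lambda>e M. \<Sum>i\<in>I. r i *\<^sub>R W i e M) = (\<lambda>vs. \<Sum>i\<in>I. r i * p (W i) vs)"
  using fin W
proof (induction I rule: finite_induct)
  have lin: "p (\<lambda>e M. a *\<^sub>R v e M + b *\<^sub>R w e M) = (\<lambda>vs. a * p v vs + b * p w vs)"
    if "v \<in> vertical_space B k (jet B k x s)" "w \<in> vertical_space B k (jet B k x s)" for v w a b
    using p that unfolding phase_space_def by blast
  {
    case empty
    \<comment> \<open>\<open>phase_space\<close> speaks of combinations of two vectors; the empty
      sum is obtained as \<open>0 v + 0 v\<close> for some vertical \<open>v\<close>.\<close>
    obtain e where e: "e \<in> adapted_charts B" "s x \<in> fst (snd e)"
      using adapted_chart_exists[OF B] by blast
    obtain v where "v \<in> vertical_space B k (jet B k x s)"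
      using vertical_space_surj[OF B s e, of k "\<lambda>M. 0"] by auto
    then show ?case
      using vertical_space_linear[OF B s, of v k v 0 0] lin[of v v 0 0] by simp
  next
    case (insert i I)
    let ?S = "\<lambda>e M. \<Sum>i\<in>I. r i *\<^sub>R W i e M"
    have IH: "?S \<in> vertical_space B k (jet B k x s)" "p ?S = (\<lambda>vs. \<Sum>i\<in>I. r i * p (W i) vs)"
      using insert by auto
    have Wi: "W i \<in> vertical_space B k (jet B k x s)" using insert by simp
    show ?case
      using insert.hyps vertical_space_linear[OF B s Wi IH(1), of "r i" 1] lin[OF Wi IH(1), of "r i" 1] IH(2)
      by simp
  }
qed

text \<open>Each vertical vector is a combination of vectors with one unit component in the chart;
  linearity of \<open>p\<close> and \<open>forms_at_eq_sub_form\<close> on these vectors give the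
  coefficients.\<close>

lemma momenta_exists:
  assumes s: "local_section B x s" and e: "e \<in> adapted_charts B" "s x \<in> fst (snd e)"
    and p: "(jet B k x s, p) \<in> phase_space B k"
  shows "is_momenta B k e (jet B k x s) p (momenta B k e (jet B k x s, p))"
proof -
  let ?j = "jet B k x s" and ?A = "base_atlas B"
  let ?u = "\<lambda>i N. if N = fst i then axis (snd i) (1::real) else 0 :: (real, 'k) vec"
  let ?I = "{M :: 'n multiset. size M \<le> k} \<times> (UNIV :: 'k set)"
  have fin: "finite ?I" by (intro finite_cartesian_product finite_multisets_size_le finite)
  have "\<exists>v\<in>vertical_space B k ?j. v e = ?u i" if "i \<in> ?I" for i
    using that by (intro vertical_space_surj[OF B s e]) auto
  then obtain W where W: "\<And>i. i \<in> ?I \<Longrightarrow> W i \<in> vertical_space B k ?j" "\<And>i. i \<in> ?I \<Longrightarrow> W i e = ?u i"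
    by metis
  have "\<exists>a. p (W i) = sub_form ?A (fst e) x a" if "i \<in> ?I" for i
  proof (rule forms_at_eq_sub_form[OF atlases(1)[OF B] adapted_chartD(1)[OF e(1)] local_section_base[OF B s e]])
    show "p (W i) \<in> forms_at ?A (CARD('n) - 1) x"
      using p W(1)[OF that] unfolding phase_space_def by (auto simp: jet_fst[OF B])
  qed
  then obtain a where a: "\<And>i. i \<in> ?I \<Longrightarrow> p (W i) = sub_form ?A (fst e) x (a i)"
    by metis
  \<comment> \<open>\<open>pairing\<close> counts each multiset once per ordering, so the
    coefficient of the form assigned to a unit vector is divided by
    \<open>orderings M\<close>.\<close>
  define P where "P M A \<kappa> = (if size M \<le> k then a (M, A) $ \<kappa> / orderings M else 0)" for M A \<kappa>
  have "p v = sub_form ?A (fst e) x (pairing k P (v e))" if v: "v \<in> vertical_space B k ?j" for v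
  proof -
    let ?r = "\<lambda>i. v e (fst i) $ snd i"
    let ?S = "\<lambda>e M. \<Sum>i\<in>?I. ?r i *\<^sub>R W i e M"
    have S: "?S \<in> vertical_space B k ?j \<and> p ?S = (\<lambda>vs. \<Sum>i\<in>?I. ?r i * p (W i) vs)"
      by (rule phase_space_sum[OF s p _ fin]) (rule W(1))
    have "v e M = ?S e M" for M
    proof (cases "size M \<le> k")
      case True
      have "?S e M = (\<Sum>i\<in>?I. if fst i = M then (v e M $ snd i) *\<^sub>R axis (snd i) 1 else 0)"
        by (rule sum.cong) (auto simp: W(2))
      also have "\<dots> = (\<Sum>N | size N \<le> k. \<Sum>A\<in>UNIV. if N = M then (v e M $ A) *\<^sub>R axis A 1 else 0)"
        by (simp add: sum.cartesian_product split_beta)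
      also have "\<dots> = (\<Sum>N | size N \<le> k. if N = M then (\<Sum>A\<in>UNIV. (v e M $ A) *\<^sub>R axis A 1) else 0)"
        by (rule sum.cong) auto
      also have "\<dots> = (\<Sum>A\<in>UNIV. (v e M $ A) *\<^sub>R axis A 1)"
        using True by (simp add: sum.delta finite_multisets_size_le)
      also have "\<dots> = v e M"
        using basis_expansion[of "v e M"] by (simp add: scalar_mult_eq_scaleR)
      finally show ?thesis ..
    next
      case False
      then have "W i e M = 0" if "i \<in> ?I" for i
        using vertical_space_beyond[OF W(1)[OF that], of M e] by simp
      then show ?thesis
        using vertical_space_beyond[OF v, of M e] False by simp
    qed
    then have ve: "v e = ?S e" by (rule ext)
    have "v = ?S"
      by (rule vertical_vector_eqI[OF B s e v]) (rule conjunct1[OF S], rule ve)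
    then have "p v = p ?S" by (rule arg_cong)
    also have "\<dots> = (\<lambda>vs. \<Sum>i\<in>?I. ?r i * p (W i) vs)"
      by (rule conjunct2[OF S])
    also have "\<dots> = sub_form ?A (fst e) x (\<Sum>i\<in>?I. ?r i *\<^sub>R a i)"
      by (intro ext) (simp add: sub_form_sum a cong: sum.cong)
    also have "(\<Sum>i\<in>?I. ?r i *\<^sub>R a i) = pairing k P (v e)"
    proof (rule vec_eq_iff[THEN iffD2], rule allI)
      fix \<kappa>
      have "pairing k P (v e) $ \<kappa> = (\<Sum>M | size M \<le> k. \<Sum>A\<in>UNIV. v e M $ A * a (M, A) $ \<kappa>)"
        unfolding pairing_multisets
        by (intro sum.cong refl) (auto simp: P_def orderings_pos[THEN less_imp_neq, symmetric])
      also have "\<dots> = (\<Sum>i\<in>?I. ?r i *\<^sub>R a i) $ \<kappa>"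
        by (simp add: sum.cartesian_product split_beta)
      finally show "(\<Sum>i\<in>?I. ?r i *\<^sub>R a i) $ \<kappa> = pairing k P (v e) $ \<kappa>" ..
    qed
    finally show ?thesis .
  qed
  then have "is_momenta B k e ?j p P"
    by (simp add: is_momenta_def P_def jet_fst[OF B])
  then show ?thesis
    using momenta_eqI[OF s e] by simp
qed

lemma phase_point_eqI:
  assumes s: "local_section B x s" and e: "e \<in> adapted_charts B" "s x \<in> fst (snd e)"
    and p: "(jet B k x s, p) \<in> phase_space B k" and q: "(jet B k x s, q) \<in> phase_space B k"
    and eq: "\<And>M A \<kappa>. size M \<le> k \<Longrightarrow> momenta B k e (jet B k x s, p) M A \<kappa> = momenta B k e (jet B k x s, q) M A \<kappa>"
  shows "p = q"
proof
  fix v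
  note P = momenta_exists[OF s e p] and Q = momenta_exists[OF s e q]
  have "momenta B k e (jet B k x s, p) M A \<kappa> = momenta B k e (jet B k x s, q) M A \<kappa>" for M A \<kappa>
    using eq P Q unfolding is_momenta_def by (metis linorder_not_le)
  then have *: "momenta B k e (jet B k x s, p) = momenta B k e (jet B k x s, q)"
    by (intro ext)
  show "p v = q v"
  proof (cases "v \<in> vertical_space B k (jet B k x s)")
    case True
    then show ?thesis using P Q unfolding is_momenta_def * by metis
  next
    case False
    then show ?thesis using p q unfolding phase_space_def by simp
  qed
qed

end

section \<open>Calculus of functions of jet coordinates\<close>

type_synonym ('n, 'k) jet_index = "'n + 'n multiset \<times> 'k"

text \<open>Base and fibre coordinates as one family of real numbers, so that \<open>dx\<close> and
  \<open>dphi_indep\<close> become derivatives by a single kind of index.\<close>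

definition of_coords :: "(('n::finite, 'k::finite) jet_index \<Rightarrow> real) \<Rightarrow> ('n, 'k) jcoord" where
  "of_coords y = (\<chi> \<mu>. y (Inl \<mu>), \<lambda>M. \<chi> A. y (Inr (M, A)))"

definition coord :: "('n::finite, 'k::finite) jcoord \<Rightarrow> ('n, 'k) jet_index \<Rightarrow> real" where
  "coord z i = (case i of Inl \<mu> \<Rightarrow> fst z $ \<mu> | Inr (M, A) \<Rightarrow> snd z M $ A)"

definition jet_indices :: "nat \<Rightarrow> ('n::finite, 'k::finite) jet_index set" where
  "jet_indices k = range Inl \<union> Inr ` ({M. size M \<le> k} \<times> UNIV)"

definition jet_deriv ::
  "('n::finite, 'k::finite) jet_index \<Rightarrow> (('n, 'k) jcoord \<Rightarrow> real) \<Rightarrow> ('n, 'k) jcoord \<Rightarrow> real" where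
  "jet_deriv i G = (case i of Inl \<mu> \<Rightarrow> dx \<mu> G | Inr (N, A) \<Rightarrow> dphi_indep N A G)"

text \<open>A box in the finitely many coordinates by which \<open>jet_Ck_on k\<close>
  differentiates; all others are frozen.\<close>

definition jet_near ::
  "nat \<Rightarrow> real \<Rightarrow> (('n::finite, 'k::finite) jet_index \<Rightarrow> real) \<Rightarrow> (('n, 'k) jet_index \<Rightarrow> real) \<Rightarrow> bool" where
  "jet_near k \<delta> y w \<longleftrightarrow> (\<forall>i\<in>jet_indices k. \<bar>w i - y i\<bar> < \<delta>) \<and> (\<forall>i. i \<notin> jet_indices k \<longrightarrow> w i = y i)"

text \<open>Openness relative to the active coordinates: a nonempty set of jet coordinates whose
  entries beyond order \<open>k\<close> vanish is not open in the product topology.\<close>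

definition jet_open :: "nat \<Rightarrow> ('n::finite, 'k::finite) jcoord set \<Rightarrow> bool" where
  "jet_open k D \<longleftrightarrow> (\<forall>y. of_coords y \<in> D \<longrightarrow> (\<exists>\<delta>>0. \<forall>w. jet_near k \<delta> y w \<longrightarrow> of_coords w \<in> D))"

lemma of_coords_coord [simp]: "of_coords (coord z) = z"
  by (simp add: of_coords_def coord_def prod_eq_iff fun_eq_iff vec_eq_iff)

lemma finite_jet_indices: "finite (jet_indices k)"
  unfolding jet_indices_def
  by (intro finite_UnI finite_imageI finite_cartesian_product finite_multisets_size_le finite)

lemma jet_indices_simps [simp]: "Inl \<mu> \<in> jet_indices k" "Inr (M, A) \<in> jet_indices k \<longleftrightarrow> size M \<le> k"
  by (auto simp: jet_indices_def)

lemma sum_jet_indices: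
  "(\<Sum>i\<in>jet_indices k. f i) = (\<Sum>\<mu>\<in>UNIV. f (Inl \<mu>)) + (\<Sum>M | size M \<le> k. \<Sum>A\<in>UNIV. f (Inr (M, A)))"
proof -
  have "(\<Sum>i\<in>jet_indices k. f i) = (\<Sum>i\<in>range Inl. f i) + (\<Sum>i\<in>Inr ` ({M. size M \<le> k} \<times> UNIV). f i)"
    unfolding jet_indices_def
    by (rule sum.union_disjoint) (auto intro!: finite_imageI finite_cartesian_product finite_multisets_size_le)
  also have "(\<Sum>i\<in>range Inl. f i) = (\<Sum>\<mu>\<in>UNIV. f (Inl \<mu>))"
    by (subst sum.reindex) auto
  also have "(\<Sum>i\<in>Inr ` ({M. size M \<le> k} \<times> UNIV). f i) = (\<Sum>i\<in>{M. size M \<le> k} \<times> UNIV. f (Inr i))"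
    by (subst sum.reindex) auto
  also have "\<dots> = (\<Sum>M | size M \<le> k. \<Sum>A\<in>UNIV. f (Inr (M, A)))"
    by (simp add: sum.cartesian_product)
  finally show ?thesis .
qed

lemma of_coords_shift:
  "of_coords (y(Inl \<mu> := y (Inl \<mu>) + t)) = (fst (of_coords y) + t *\<^sub>R axis \<mu> 1, snd (of_coords y))"
  "of_coords (y(Inr (N, A) := y (Inr (N, A)) + t)) =
    (fst (of_coords y), (snd (of_coords y))(N := snd (of_coords y) N + t *\<^sub>R axis A 1))"
  by (auto simp: of_coords_def vec_eq_iff axis_def fun_eq_iff)

lemma jet_near_upd:
  "jet_near k \<delta> y w \<Longrightarrow> i \<in> jet_indices k \<Longrightarrow> \<bar>t - y i\<bar> < \<delta> \<Longrightarrow> jet_near k \<delta> y (w(i := t))"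
  by (auto simp: jet_near_def)

lemma jet_near_refl: "\<delta> > 0 \<Longrightarrow> jet_near k \<delta> y y"
  by (auto simp: jet_near_def)

lemma jet_near_mono: "jet_near k \<delta> y w \<Longrightarrow> \<delta> \<le> \<epsilon> \<Longrightarrow> jet_near k \<epsilon> y w"
  by (fastforce simp: jet_near_def)

lemma jet_Ck_on_continuous: "jet_Ck_on k r D G \<Longrightarrow> continuous_on D G"
  by (cases r) auto

lemma jet_Ck_on_deriv: "jet_Ck_on k (Suc r) D G \<Longrightarrow> i \<in> jet_indices k \<Longrightarrow> jet_Ck_on k r D (jet_deriv i G)"
  by (auto simp: jet_deriv_def jet_indices_def)

lemma jet_smooth_on_deriv: "jet_smooth_on k D G \<Longrightarrow> i \<in> jet_indices k \<Longrightarrow> jet_smooth_on k D (jet_deriv i G)"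
  unfolding jet_smooth_on_def using jet_Ck_on_deriv by blast

lemma jet_deriv_eq: "jet_deriv i G (of_coords y) = deriv (\<lambda>t. G (of_coords (y(i := y i + t)))) 0"
  by (auto simp: jet_deriv_def dx_def dphi_indep_def of_coords_shift split: sum.split prod.split)

lemma jet_Ck_on_has_deriv:
  assumes G: "jet_Ck_on k (Suc r) D G" and y: "of_coords y \<in> D" and i: "i \<in> jet_indices k"
  shows "((\<lambda>t. G (of_coords (y(i := t)))) has_real_derivative jet_deriv i G (of_coords y)) (at (y i))"
proof -
  have "(\<lambda>t. G (of_coords (y(i := y i + t)))) differentiable (at 0)"
    using G y i by (cases i) (auto simp: of_coords_shift)
  then have "((\<lambda>t. G (of_coords (y(i := y i + t)))) has_real_derivative jet_deriv i G (of_coords y)) (at 0)"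
    unfolding jet_deriv_eq by (simp add: DERIV_deriv_iff_real_differentiable)
  then show ?thesis
    using DERIV_shift[of "\<lambda>t. G (of_coords (y(i := t)))" "jet_deriv i G (of_coords y)" 0 "y i"]
    by (simp add: add.commute)
qed

section \<open>Differentiability from continuous partial derivatives\<close>

lemma tendsto_fun_coordinatewise:
  fixes f :: "'a \<Rightarrow> 'i \<Rightarrow> 'b::topological_space"
  assumes "\<And>i. ((\<lambda>n. f n i) \<longlongrightarrow> l i) F"
  shows "(f \<longlongrightarrow> l) F"
proof -
  have "limitin (product_topology (\<lambda>i. euclidean) UNIV) f l F"
    unfolding limitin_componentwise using assms by (auto simp: extensional_def)
  then show ?thesis
    by (simp add: euclidean_product_topology)
qed

lemma tendsto_of_coords:
  assumes "\<And>i. ((\<lambda>n. w n i) \<longlongrightarrow> y i) F"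
  shows "((\<lambda>n. of_coords (w n)) \<longlongrightarrow> of_coords y) F"
  unfolding of_coords_def
  by (intro tendsto_Pair tendsto_vec_lambda tendsto_fun_coordinatewise assms)

text \<open>Continuity refers to the product topology. If no box worked, counterexamples from boxes
  of sizes shrinking to \<open>0\<close> would converge coordinatewise to \<open>y\<close> and
  contradict continuity.\<close>

lemma jet_continuous_near:
  assumes D: "jet_open k D" and G: "continuous_on D G" and y: "of_coords y \<in> D" and \<eta>: "\<eta> > (0::real)"
  shows "\<exists>\<delta>>0. \<forall>w. jet_near k \<delta> y w \<longrightarrow> of_coords w \<in> D \<and> \<bar>G (of_coords w) - G (of_coords y)\<bar> < \<eta>"
proof -
  obtain \<epsilon> where \<epsilon>: "\<epsilon> > 0" "\<And>w. jet_near k \<epsilon> y w \<Longrightarrow> of_coords w \<in> D"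
    using D y unfolding jet_open_def by blast
  show ?thesis
  proof (rule ccontr)
    assume "\<not> ?thesis"
    then have "\<exists>w. jet_near k (\<epsilon> * inverse (Suc n)) y w \<and>
        \<not> (of_coords w \<in> D \<and> \<bar>G (of_coords w) - G (of_coords y)\<bar> < \<eta>)" for n
      using \<epsilon>(1) by (metis mult_pos_pos of_nat_0_less_iff positive_imp_inverse_positive zero_less_Suc)
    then obtain w where w: "\<And>n. jet_near k (\<epsilon> * inverse (Suc n)) y (w n)"
      "\<And>n. \<not> (of_coords (w n) \<in> D \<and> \<bar>G (of_coords (w n)) - G (of_coords y)\<bar> < \<eta>)"
      by metis
    have "\<epsilon> * inverse (Suc n) \<le> \<epsilon>" for n
      using \<epsilon>(1) by (simp add: field_simps)
    then have inD: "of_coords (w n) \<in> D" for n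
      using \<epsilon>(2) jet_near_mono[OF w(1)] by blast
    have lim0: "(\<lambda>n. \<epsilon> * inverse (real (Suc n))) \<longlonglongrightarrow> 0"
      using tendsto_mult_right_zero[OF LIMSEQ_inverse_real_of_nat] by simp
    have "(\<lambda>n. w n i) \<longlonglongrightarrow> y i" for i
    proof (cases "i \<in> jet_indices k")
      case True
      then have "norm (w n i - y i) \<le> \<epsilon> * inverse (real (Suc n))" for n
        using w(1)[of n] by (auto simp: jet_near_def intro: less_imp_le)
      then have "(\<lambda>n. w n i - y i) \<longlonglongrightarrow> 0"
        by (intro Lim_null_comparison[OF _ lim0]) simp
      then show ?thesis by (simp add: LIM_zero_iff)
    next
      case False
      then have "w n i = y i" for n using w(1)[of n] by (simp add: jet_near_def)
      then show ?thesis by simp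
    qed
    then have "(\<lambda>n. of_coords (w n)) \<longlonglongrightarrow> of_coords y"
      by (rule tendsto_of_coords)
    then have "(\<lambda>n. G (of_coords (w n))) \<longlonglongrightarrow> G (of_coords y)"
      by (rule continuous_on_tendsto_compose[OF G _ y]) (simp add: inD)
    then have "\<forall>\<^sub>F n in sequentially. dist (G (of_coords (w n))) (G (of_coords y)) < \<eta>"
      using \<eta> by (rule tendstoD)
    then obtain n where "dist (G (of_coords (w n))) (G (of_coords y)) < \<eta>"
      using eventually_happens trivial_limit_sequentially by blast
    then show False using w(2)[of n] inD[of n] by (simp add: dist_real_def)
  qed
qed

text \<open>Coordinates are moved one at a time; each step is a mean value of one partial
  derivative, which inside a small box differs from its value at \<open>y\<close> by less than
  \<open>\<eta>\<close>.\<close>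

lemma jet_linear_approximation:
  assumes D: "jet_open k D" and G: "jet_Ck_on k (Suc 0) D G" and y: "of_coords y \<in> D" and \<eta>: "\<eta> > 0"
  shows "\<exists>\<delta>>0. \<forall>w. jet_near k \<delta> y w \<longrightarrow>
    \<bar>G (of_coords w) - G (of_coords y) - (\<Sum>i\<in>jet_indices k. jet_deriv i G (of_coords y) * (w i - y i))\<bar>
      \<le> \<eta> * (\<Sum>i\<in>jet_indices k. \<bar>w i - y i\<bar>)"
proof -
  let ?c = "\<lambda>i. jet_deriv i G (of_coords y)"
  have "\<exists>\<delta>>0. \<forall>w. jet_near k \<delta> y w \<longrightarrow> of_coords w \<in> D \<and> \<bar>jet_deriv i G (of_coords w) - ?c i\<bar> < \<eta>"
    if "i \<in> jet_indices k" for i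
    by (rule jet_continuous_near[OF D jet_Ck_on_continuous[OF jet_Ck_on_deriv[OF G that]] y \<eta>])
  then obtain d where d: "\<And>i. i \<in> jet_indices k \<Longrightarrow> d i > 0"
    "\<And>i w. i \<in> jet_indices k \<Longrightarrow> jet_near k (d i) y w \<Longrightarrow>
      of_coords w \<in> D \<and> \<bar>jet_deriv i G (of_coords w) - ?c i\<bar> < \<eta>"
    by metis
  define \<delta> where "\<delta> = Min (d ` jet_indices k)"
  have fin: "finite (d ` jet_indices k)" by (intro finite_imageI finite_jet_indices)
  have ne: "d ` jet_indices k \<noteq> {}" using jet_indices_simps(1) by blast
  have \<delta>: "\<delta> > 0" "\<And>i. i \<in> jet_indices k \<Longrightarrow> \<delta> \<le> d i"
    unfolding \<delta>_def using d(1) by (auto simp: Min_gr_iff[OF fin ne] intro: Min_le[OF fin])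
  have near: "of_coords w \<in> D" "\<bar>jet_deriv i G (of_coords w) - ?c i\<bar> < \<eta>"
    if "jet_near k \<delta> y w" "i \<in> jet_indices k" for w i
    using d(2)[OF that(2) jet_near_mono[OF that(1) \<delta>(2)[OF that(2)]]] by blast+
  show ?thesis
  proof (intro exI[of _ \<delta>] conjI allI impI \<delta>(1))
    fix w assume w: "jet_near k \<delta> y w"
    let ?w = "\<lambda>J i. if i \<in> J then w i else y i"
    have nearJ: "jet_near k \<delta> y (?w J)" for J
      using w \<delta>(1) by (auto simp: jet_near_def)
    have "\<bar>G (of_coords (?w J)) - G (of_coords y) - (\<Sum>i\<in>J. ?c i * (w i - y i))\<bar> \<le> \<eta> * (\<Sum>i\<in>J. \<bar>w i - y i\<bar>)"
      if "finite J" "J \<subseteq> jet_indices k" for J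
      using that
    proof (induction J rule: finite_induct)
      case (insert i J)
      then have i: "i \<in> jet_indices k" by simp
      let ?g = "\<lambda>t. G (of_coords ((?w J)(i := t)))"
      have wi: "(?w J)(i := w i) = ?w (insert i J)" "(?w J)(i := y i) = ?w J"
        using insert.hyps by (auto simp: fun_eq_iff)
      have inbox: "jet_near k \<delta> y ((?w J)(i := t))" if "\<bar>t - y i\<bar> \<le> \<bar>w i - y i\<bar>" for t
      proof (rule jet_near_upd[OF nearJ i])
        have "\<bar>w i - y i\<bar> < \<delta>" using w i by (simp add: jet_near_def)
        then show "\<bar>t - y i\<bar> < \<delta>" using that by simp
      qed
      have der: "(?g has_real_derivative jet_deriv i G (of_coords ((?w J)(i := t)))) (at t)"
        if "\<bar>t - y i\<bar> \<le> \<bar>w i - y i\<bar>" for t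
        using jet_Ck_on_has_deriv[OF G near(1)[OF inbox[OF that] i] i] by simp
      have "\<exists>t. \<bar>t - y i\<bar> \<le> \<bar>w i - y i\<bar> \<and>
          ?g (w i) - ?g (y i) = (w i - y i) * jet_deriv i G (of_coords ((?w J)(i := t)))"
      proof (cases "w i" "y i" rule: linorder_cases)
        case less
        then have "\<exists>t. w i < t \<and> t < y i \<and> ?g (y i) - ?g (w i) = (y i - w i) * jet_deriv i G (of_coords ((?w J)(i := t)))"
          by (intro MVT2 der) auto
        then obtain t where "w i < t" "t < y i" "?g (y i) - ?g (w i) = (y i - w i) * jet_deriv i G (of_coords ((?w J)(i := t)))"
          by blast
        then show ?thesis by (intro exI[of _ t]) (auto simp: algebra_simps)
      next
        case greater
        then have "\<exists>t. y i < t \<and> t < w i \<and> ?g (w i) - ?g (y i) = (w i - y i) * jet_deriv i G (of_coords ((?w J)(i := t)))"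
          by (intro MVT2 der) auto
        then obtain t where "y i < t" "t < w i" "?g (w i) - ?g (y i) = (w i - y i) * jet_deriv i G (of_coords ((?w J)(i := t)))"
          by blast
        then show ?thesis by (intro exI[of _ t]) auto
      qed auto
      then obtain t where t: "\<bar>t - y i\<bar> \<le> \<bar>w i - y i\<bar>"
        "?g (w i) - ?g (y i) = (w i - y i) * jet_deriv i G (of_coords ((?w J)(i := t)))"
        by blast
      have "\<bar>?g (w i) - ?g (y i) - ?c i * (w i - y i)\<bar> =
          \<bar>w i - y i\<bar> * \<bar>jet_deriv i G (of_coords ((?w J)(i := t))) - ?c i\<bar>"
        unfolding t(2) abs_mult[symmetric] by (simp add: algebra_simps)
      also have "\<dots> \<le> \<bar>w i - y i\<bar> * \<eta>"
        using near(2)[OF inbox[OF t(1)] i] by (intro mult_left_mono) auto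
      finally have "\<bar>G (of_coords (?w (insert i J))) - G (of_coords (?w J)) - ?c i * (w i - y i)\<bar> \<le> \<bar>w i - y i\<bar> * \<eta>"
        unfolding wi .
      moreover have "\<bar>G (of_coords (?w J)) - G (of_coords y) - (\<Sum>i\<in>J. ?c i * (w i - y i))\<bar> \<le> \<eta> * (\<Sum>i\<in>J. \<bar>w i - y i\<bar>)"
        using insert by simp
      moreover have "(\<Sum>i\<in>insert i J. ?c i * (w i - y i)) = ?c i * (w i - y i) + (\<Sum>i\<in>J. ?c i * (w i - y i))"
        "\<eta> * (\<Sum>i\<in>insert i J. \<bar>w i - y i\<bar>) = \<bar>w i - y i\<bar> * \<eta> + \<eta> * (\<Sum>i\<in>J. \<bar>w i - y i\<bar>)"
        using insert.hyps by (simp_all add: algebra_simps)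
      ultimately show ?case by linarith
    qed simp
    from this[OF finite_jet_indices order_refl]
    have "\<bar>G (of_coords (?w (jet_indices k))) - G (of_coords y) - (\<Sum>i\<in>jet_indices k. ?c i * (w i - y i))\<bar>
       \<le> \<eta> * (\<Sum>i\<in>jet_indices k. \<bar>w i - y i\<bar>)" .
    moreover have "?w (jet_indices k) = w"
      using w by (auto simp: jet_near_def fun_eq_iff)
    ultimately show "\<bar>G (of_coords w) - G (of_coords y) - (\<Sum>i\<in>jet_indices k. ?c i * (w i - y i))\<bar>
       \<le> \<eta> * (\<Sum>i\<in>jet_indices k. \<bar>w i - y i\<bar>)" by simp
  qed
qed

lemma has_derivative_imp_Lipschitz_at:
  fixes f :: "'a::real_normed_vector \<Rightarrow> real"
  assumes "(f has_derivative f') (at a)"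
  shows "\<exists>K\<ge>0. \<forall>\<^sub>F b in nhds a. \<bar>f b - f a\<bar> \<le> K * norm (b - a)"
proof -
  obtain d where d: "d > 0" "\<And>b. norm (b - a) < d \<Longrightarrow> norm (f b - f a - f' (b - a)) \<le> 1 * norm (b - a)"
    using assms unfolding has_derivative_at_alt by (metis zero_less_one)
  obtain K where K: "K \<ge> 0" "\<And>v. norm (f' v) \<le> norm v * K"
    using bounded_linear.nonneg_bounded[OF has_derivative_bounded_linear[OF assms]] by blast
  have "\<bar>f b - f a\<bar> \<le> (K + 1) * norm (b - a)" if "norm (b - a) < d" for b
    using d(2)[OF that] K(2)[of "b - a"] by (simp add: algebra_simps)
  then show ?thesis
    using d(1) K(1) by (intro exI[of _ "K + 1"]) (auto simp: eventually_nhds_metric dist_norm)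
qed

text \<open>The remainder of the linear approximation is small compared with the coordinate changes,
  and these are bounded by a multiple of \<open>norm (b - a)\<close>; what is left is affine in the
  coordinate functions.\<close>

lemma jet_chain_rule:
  fixes y :: "'a::real_normed_vector \<Rightarrow> ('n::finite, 'k::finite) jet_index \<Rightarrow> real"
  assumes D: "jet_open k D" and G: "jet_Ck_on k (Suc 0) D G" and a: "of_coords (y a) \<in> D"
    and y: "\<And>i. i \<in> jet_indices k \<Longrightarrow> ((\<lambda>b. y b i) has_derivative y' i) (at a)"
    and const: "\<forall>\<^sub>F b in nhds a. \<forall>i. i \<notin> jet_indices k \<longrightarrow> y b i = y a i"
  shows "((\<lambda>b. G (of_coords (y b))) has_derivative
    (\<lambda>v. \<Sum>i\<in>jet_indices k. jet_deriv i G (of_coords (y a)) * y' i v)) (at a)"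
proof -
  let ?I = "jet_indices k :: ('n, 'k) jet_index set" and ?c = "\<lambda>i. jet_deriv i G (of_coords (y a))"
  define R where "R b = G (of_coords (y b)) - G (of_coords (y a)) - (\<Sum>i\<in>?I. ?c i * (y b i - y a i))" for b
  obtain K where K: "\<And>i. i \<in> ?I \<Longrightarrow> K i \<ge> 0"
    "\<And>i. i \<in> ?I \<Longrightarrow> \<forall>\<^sub>F b in nhds a. \<bar>y b i - y a i\<bar> \<le> K i * norm (b - a)"
    using has_derivative_imp_Lipschitz_at[OF y] by metis
  \<comment> \<open>The added \<open>1\<close> makes the bound positive, so that
    \<open>e / K'\<close> can serve as the tolerance.\<close>
  define K' where "K' = (\<Sum>i\<in>?I. K i) + 1"
  have K': "K' > 0" unfolding K'_def using sum_nonneg[of ?I K] K(1) by fastforce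
  have "(R has_derivative (\<lambda>v. 0)) (at a)"
    unfolding has_derivative_at_alt
  proof (intro conjI allI impI)
    fix e :: real assume e: "e > 0"
    obtain \<delta> where \<delta>: "\<delta> > 0" "\<And>w. jet_near k \<delta> (y a) w \<Longrightarrow>
        \<bar>G (of_coords w) - G (of_coords (y a)) - (\<Sum>i\<in>?I. ?c i * (w i - y a i))\<bar> \<le> (e / K') * (\<Sum>i\<in>?I. \<bar>w i - y a i\<bar>)"
      using jet_linear_approximation[OF D G a divide_pos_pos[OF e K']] by blast
    have "\<forall>\<^sub>F b in nhds a. \<bar>y b i - y a i\<bar> < \<delta>" if "i \<in> ?I" for i
    proof -
      have "((\<lambda>b. y b i) \<longlongrightarrow> y a i) (nhds a)"
        using has_derivative_continuous[OF y[OF that]] by (simp add: isCont_def tendsto_nhds_iff)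
      from tendstoD[OF this \<delta>(1)] show ?thesis by (simp add: dist_real_def)
    qed
    then have "\<forall>\<^sub>F b in nhds a. \<forall>i\<in>?I. \<bar>y b i - y a i\<bar> < \<delta>"
      by (intro eventually_ball_finite finite_jet_indices) blast
    moreover have "\<forall>\<^sub>F b in nhds a. \<forall>i\<in>?I. \<bar>y b i - y a i\<bar> \<le> K i * norm (b - a)"
      using K(2) by (intro eventually_ball_finite finite_jet_indices) blast
    ultimately have "\<forall>\<^sub>F b in nhds a. norm (R b - R a - 0) \<le> e * norm (b - a)"
      using const
    proof eventually_elim
      case (elim b)
      have "norm (R b - R a - 0) = \<bar>R b\<bar>" by (simp add: R_def)
      also have "\<dots> \<le> (e / K') * (\<Sum>i\<in>?I. \<bar>y b i - y a i\<bar>)"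
        unfolding R_def by (rule \<delta>(2)) (use elim in \<open>auto simp: jet_near_def\<close>)
      also have "\<dots> \<le> (e / K') * (\<Sum>i\<in>?I. K i * norm (b - a))"
        using e K' elim by (intro mult_left_mono sum_mono) auto
      also have "\<dots> = (e / K') * ((\<Sum>i\<in>?I. K i) * norm (b - a))"
        by (simp add: sum_distrib_right)
      also have "\<dots> \<le> (e / K') * (K' * norm (b - a))"
        using e K' by (intro mult_left_mono mult_right_mono) (auto simp: K'_def)
      also have "\<dots> = e * norm (b - a)" using K' by simp
      finally show ?case .
    qed
    then show "\<exists>d>0. \<forall>b. norm (b - a) < d \<longrightarrow> norm (R b - R a - 0) \<le> e * norm (b - a)"
      by (auto simp: eventually_nhds_metric dist_norm)
  qed simp
  moreover have "((\<lambda>b. G (of_coords (y a)) + (\<Sum>i\<in>?I. ?c i * (y b i - y a i))) has_derivative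
      (\<lambda>v. \<Sum>i\<in>?I. ?c i * y' i v)) (at a)"
    by (auto intro!: derivative_eq_intros y)
  ultimately have "((\<lambda>b. R b + (G (of_coords (y a)) + (\<Sum>i\<in>?I. ?c i * (y b i - y a i)))) has_derivative
      (\<lambda>v. 0 + (\<Sum>i\<in>?I. ?c i * y' i v))) (at a)"
    by (rule has_derivative_add)
  then show ?thesis by (simp add: R_def)
qed

text \<open>As for composites of ordinary maps, the induction runs over \<open>G\<close>: by the
  chain rule the derivative is a sum of products of \<open>jet_deriv i G\<close> along
  \<open>y\<close> with derivatives of the coordinates.\<close>

lemma jet_smooth_compose:
  fixes y :: "'a::real_normed_vector \<Rightarrow> ('n::finite, 'k::finite) jet_index \<Rightarrow> real"
  assumes D: "jet_open k D" and G: "jet_smooth_on k D G" and S: "open S"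
    and inD: "\<And>b. b \<in> S \<Longrightarrow> of_coords (y b) \<in> D"
    and y: "\<And>i. i \<in> jet_indices k \<Longrightarrow> smooth_on S (\<lambda>b. y b i)"
    and const: "\<And>b i. i \<notin> jet_indices k \<Longrightarrow> y b i = 0"
  shows "smooth_on S (\<lambda>b. G (of_coords (y b)))"
proof -
  have "Ck_on r S (\<lambda>b. G (of_coords (y b)))" if "jet_Ck_on k r D G" for r G
    using that
  proof (induction r arbitrary: G)
    case 0
    have "continuous_on S (\<lambda>b. y b i)" for i
      using smooth_on_continuous[OF y, of i] const[of i] by (cases "i \<in> jet_indices k") auto
    then have "continuous_on S (\<lambda>b. of_coords (y b))"
      unfolding continuous_on_def using tendsto_of_coords[of y] by blast
    then show ?case
      using continuous_on_compose2[of D G S "\<lambda>b. of_coords (y b)"] 0 inD by auto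
  next
    case (Suc r)
    have G1: "jet_Ck_on k (Suc 0) D G"
      using Suc.prems jet_Ck_on_continuous[of k r D] by auto
    show ?case
    proof (rule Ck_on_SucI[OF S])
      fix b assume b: "b \<in> S"
      show "((\<lambda>b. G (of_coords (y b))) has_derivative (\<lambda>v. \<Sum>i\<in>jet_indices k.
          jet_deriv i G (of_coords (y b)) * frechet_derivative (\<lambda>b. y b i) (at b) v)) (at b)"
        by (rule jet_chain_rule[OF D G1 inD[OF b] smooth_on_derivative[OF S y b]]) (simp_all add: const)
    next
      fix v
      have "Ck_on r S (\<lambda>b. frechet_derivative (\<lambda>b. y b i) (at b) v)" if "i \<in> jet_indices k" for i
        using smooth_on_frechet[OF y[OF that]] by (simp add: smooth_on_def)
      then show "Ck_on r S (\<lambda>b. \<Sum>i\<in>jet_indices k.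
          jet_deriv i G (of_coords (y b)) * frechet_derivative (\<lambda>b. y b i) (at b) v)"
        by (intro Ck_on_sum[OF S] Ck_on_bilinear[OF S bounded_bilinear_mult] Suc.IH jet_Ck_on_deriv[OF Suc.prems])
    qed
  qed
  then show ?thesis using G by (simp add: smooth_on_def jet_smooth_on_def)
qed

text \<open>With all but two coordinates fixed this is the statement on two real parameters. Boxes
  keep the two-parameter family in \<open>D\<close>, and continuity of the second derivatives comes
  from smoothness.\<close>

lemma jet_deriv_commute:
  assumes D: "jet_open k D" and G: "jet_smooth_on k D G" and z: "z \<in> D"
    and i: "i \<in> jet_indices k" and j: "j \<in> jet_indices k"
  shows "jet_deriv i (jet_deriv j G) z = jet_deriv j (jet_deriv i G) z"
proof (cases "i = j")
  case False
  define y where "y = coord z"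
  have y: "of_coords y \<in> D" using z by (simp add: y_def)
  obtain \<delta> where \<delta>: "\<delta> > 0" "\<And>w. jet_near k \<delta> y w \<Longrightarrow> of_coords w \<in> D"
    using D y unfolding jet_open_def by blast
  let ?w = "\<lambda>s t. y(i := y i + s, j := y j + t)"
  have near: "of_coords (?w s t) \<in> D" if "\<bar>s\<bar> < \<delta>" "\<bar>t\<bar> < \<delta>" for s t
    by (rule \<delta>(2), intro jet_near_upd jet_near_refl) (use i j that \<delta> in auto)
  have C1: "jet_Ck_on k (Suc 0) D F" if "jet_smooth_on k D F" for F
    using that by (simp only: jet_smooth_on_def)
  have ds: "((\<lambda>s. F (of_coords (?w s t))) has_real_derivative jet_deriv i F (of_coords (?w s t))) (at s)"
    if F: "jet_smooth_on k D F" and st: "\<bar>s\<bar> < \<delta>" "\<bar>t\<bar> < \<delta>" for F s t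
  proof -
    have "((\<lambda>r. F (of_coords ((?w s t)(i := r)))) has_real_derivative jet_deriv i F (of_coords (?w s t))) (at (s + y i))"
      using jet_Ck_on_has_deriv[OF C1[OF F] near[OF st] i] False by (simp add: add.commute)
    then have "((\<lambda>r. F (of_coords ((?w s t)(i := r + y i)))) has_real_derivative jet_deriv i F (of_coords (?w s t))) (at s)"
      by (simp add: DERIV_shift)
    moreover have "(?w s t)(i := r + y i) = ?w r t" for r
      using False by (auto simp: fun_eq_iff)
    ultimately show ?thesis by simp
  qed
  have dt: "((\<lambda>t. F (of_coords (?w s t))) has_real_derivative jet_deriv j F (of_coords (?w s t))) (at t)"
    if F: "jet_smooth_on k D F" and st: "\<bar>s\<bar> < \<delta>" "\<bar>t\<bar> < \<delta>" for F s t
  proof -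
    have "((\<lambda>r. F (of_coords ((?w s t)(j := r)))) has_real_derivative jet_deriv j F (of_coords (?w s t))) (at (t + y j))"
      using jet_Ck_on_has_deriv[OF C1[OF F] near[OF st] j] False by (simp add: add.commute)
    then have "((\<lambda>r. F (of_coords ((?w s t)(j := r + y j)))) has_real_derivative jet_deriv j F (of_coords (?w s t))) (at t)"
      by (simp add: DERIV_shift)
    moreover have "(?w s t)(j := r + y j) = ?w s r" for r
      using False by (auto simp: fun_eq_iff)
    ultimately show ?thesis by simp
  qed
  have lim: "((\<lambda>p::real \<times> real. of_coords (?w (fst p) (snd p))) \<longlongrightarrow> of_coords (?w 0 0)) (nhds (0, 0))"
  proof (rule tendsto_of_coords)
    fix l
    have "continuous_on UNIV (\<lambda>p::real \<times> real. ?w (fst p) (snd p) l)"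
      by (cases "l = j"; cases "l = i") (auto intro!: continuous_intros)
    then have "isCont (\<lambda>p::real \<times> real. ?w (fst p) (snd p) l) (0, 0)"
      by (simp add: continuous_on_eq_continuous_at)
    then show "((\<lambda>p::real \<times> real. ?w (fst p) (snd p) l) \<longlongrightarrow> ?w 0 0 l) (nhds (0, 0))"
      unfolding isCont_def tendsto_nhds_iff by (simp del: fun_upd_apply)
  qed
  have evD: "\<forall>\<^sub>F p in nhds (0::real, 0::real). of_coords (?w (fst p) (snd p)) \<in> D"
    unfolding eventually_nhds_metric
  proof (intro exI[of _ \<delta>] conjI allI impI \<delta>(1) near)
    fix p :: "real \<times> real" assume p: "dist p (0, 0) < \<delta>"
    show "\<bar>fst p\<bar> < \<delta>" "\<bar>snd p\<bar> < \<delta>"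
      using p dist_fst_le[of p "(0, 0)"] dist_snd_le[of p "(0, 0)"] by (auto simp: dist_real_def)
  qed
  have w0: "?w 0 0 = y" by (auto simp: fun_eq_iff)
  have cont: "((\<lambda>p. F (of_coords (?w (fst p) (snd p)))) \<longlongrightarrow> F (of_coords (?w 0 0))) (nhds (0, 0))"
    if "jet_smooth_on k D F" for F
    by (rule continuous_on_tendsto_compose[OF jet_Ck_on_continuous[OF C1[OF that]] lim _ evD])
      (use near[of 0 0] \<delta>(1) in simp)
  note Gi = jet_smooth_on_deriv[OF G i] and Gj = jet_smooth_on_deriv[OF G j]
  have "jet_deriv j (jet_deriv i G) (of_coords (?w 0 0)) = jet_deriv i (jet_deriv j G) (of_coords (?w 0 0))"
    by (rule mixed_derivatives_eq_real[where H = "\<lambda>s t. G (of_coords (?w s t))", OF \<delta>(1) ds[OF G] dt[OF G]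
          dt[OF Gi] ds[OF Gj] cont[OF jet_smooth_on_deriv[OF Gi j]] cont[OF jet_smooth_on_deriv[OF Gj i]]])
  then show ?thesis unfolding w0 by (simp add: y_def)
qed simp

section \<open>The symmetrised momenta and the derivatives of the total divergence\<close>

text \<open>Among the orderings of \<open>N\<close>, those with \<open>\<kappa>\<close> in the first
  place form the fraction \<open>count N \<kappa> / size N\<close> and correspond to the orderings
  of \<open>N - {#\<kappa>#}\<close>.\<close>

lemma orderings_remove:
  assumes "\<kappa> \<in># N"
  shows "orderings (N - {#\<kappa>#}) * real (size N) = orderings N * real (count N \<kappa>)"
proof -
  have "orderings M = real (card (permutations_of_multiset M))" for M :: "'a multiset"
    by (simp add: orderings_def permutations_of_multiset_def)
  then show ?thesis
    using card_permutations_of_multiset_remove_aux[OF assms] by (metis mult.commute of_nat_mult)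
qed

lemma sum_list_map_count:
  fixes f :: "'n::finite \<Rightarrow> real"
  shows "sum_list (map f xs) = (\<Sum>x\<in>UNIV. real (count (mset xs) x) * f x)"
proof (induction xs)
  case (Cons a xs)
  have "real (count (mset (a # xs)) x) * f x = (if x = a then f x else 0) + real (count (mset xs) x) * f x" for x
    by (simp add: distrib_right)
  then show ?case using Cons by (simp add: sum.distrib)
qed simp

text \<open>A summand depends on the permutation only through the entry that becomes last, and every
  position becomes last equally often; the positions are then counted by their index.\<close>

lemma symmetrise_eq:
  fixes \<mu>s :: "'n::finite list"
  assumes "\<mu>s \<noteq> []"
  shows "symmetrise P \<mu>s A =
    (\<Sum>\<kappa>\<in>UNIV. real (count (mset \<mu>s) \<kappa>) * P (mset \<mu>s - {#\<kappa>#}) A \<kappa>) / real (length \<mu>s)"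
proof -
  let ?m = "length \<mu>s"
  let ?\<Pi> = "{\<pi>. \<pi> permutes {..<?m}}"
  define h where "h i = P (mset \<mu>s - {#\<mu>s ! i#}) A (\<mu>s ! i)" for i
  define T where "T = (\<Sum>\<pi>\<in>?\<Pi>. h (\<pi> (?m - 1)))"
  have m: "?m > 0" using assms by simp
  have summand: "(let \<nu>s = permute_list \<pi> \<mu>s in P (mset (butlast \<nu>s)) A (last \<nu>s)) = h (\<pi> (?m - 1))"
    if "\<pi> permutes {..<?m}" for \<pi>
  proof -
    let ?\<nu> = "permute_list \<pi> \<mu>s"
    have ne: "?\<nu> \<noteq> []" using assms by (metis length_0_conv length_permute_list)
    have last: "last ?\<nu> = \<mu>s ! \<pi> (?m - 1)"
      using ne m by (simp add: last_conv_nth permute_list_def)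
    have "mset ?\<nu> = add_mset (last ?\<nu>) (mset (butlast ?\<nu>))"
      by (subst append_butlast_last_id[OF ne, symmetric]) (simp del: append_butlast_last_id)
    then have "mset (butlast ?\<nu>) = mset \<mu>s - {#last ?\<nu>#}"
      using mset_permute_list[OF that] by (metis add_mset_remove_trivial)
    then show ?thesis by (simp add: Let_def h_def last)
  qed
  \<comment> \<open>Composing with a transposition lets any argument \<open>a\<close> stand in for
    the last one. Summed over all \<open>a\<close>, each permutation contributes the full sum of
    \<open>h\<close> over positions.\<close>
  have T: "T = (\<Sum>\<pi>\<in>?\<Pi>. h (\<pi> a))" if "a < ?m" for a
  proof -
    have q: "Transposition.transpose a (?m - 1) permutes {..<?m}"
      by (rule permutes_swap_id) (use that m in auto)
    show ?thesis
      unfolding T_def sum_permutations_compose_right[OF q, of "\<lambda>\<pi>. h (\<pi> (?m - 1))"] by simp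
  qed
  have "real ?m * T = (\<Sum>a<?m. T)" by simp
  also have "\<dots> = (\<Sum>a<?m. \<Sum>\<pi>\<in>?\<Pi>. h (\<pi> a))"
    by (intro sum.cong refl T) simp
  also have "\<dots> = (\<Sum>\<pi>\<in>?\<Pi>. \<Sum>a<?m. h (\<pi> a))"
    by (rule sum.swap)
  also have "\<dots> = (\<Sum>\<pi>\<in>?\<Pi>. \<Sum>a<?m. h a)"
    by (rule sum.cong[OF refl]) (use sum.permute[of _ "{..<?m}" h] in \<open>auto simp: comp_def\<close>)
  also have "\<dots> = fact ?m * (\<Sum>a<?m. h a)"
    by (simp add: card_permutations[OF refl])
  also have "(\<Sum>a<?m. h a) = (\<Sum>\<kappa>\<in>UNIV. real (count (mset \<mu>s) \<kappa>) * P (mset \<mu>s - {#\<kappa>#}) A \<kappa>)"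
    (is "_ = ?R")
  proof -
    have "(\<Sum>a<?m. h a) = sum_list (map (\<lambda>\<kappa>. P (mset \<mu>s - {#\<kappa>#}) A \<kappa>) \<mu>s)"
      by (simp add: sum_list_sum_nth h_def atLeast0LessThan)
    also have "\<dots> = ?R"
      by (rule sum_list_map_count)
    finally show ?thesis .
  qed
  finally have "T / fact ?m = ?R / real ?m"
    using m by (simp add: field_simps)
  moreover have "symmetrise P \<mu>s A = T / fact ?m"
    unfolding symmetrise_def T_def by (intro arg_cong2[where f = "(/)"] sum.cong refl summand) simp
  ultimately show ?thesis by simp
qed

text \<open>The divisor \<open>orderings M\<close> in \<open>dphi\<close> cancels against the number
  of lists with multiset \<open>M\<close>.\<close>

lemma total_div_multisets:
  "total_div k G z = (\<Sum>\<kappa>\<in>UNIV. dx \<kappa> (\<lambda>z. G z $ \<kappa>) (jet_truncate k z) +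
     (\<Sum>M | size M \<le> k. \<Sum>A\<in>UNIV.
        dphi_indep M A (\<lambda>z. G z $ \<kappa>) (jet_truncate k z) * snd z (add_mset \<kappa> M) $ A))"
proof -
  have "(\<Sum>\<mu>s | length \<mu>s \<le> k. \<Sum>A\<in>UNIV. dphi \<mu>s A F y * snd z (mset (\<mu>s @ [\<kappa>])) $ A) =
      (\<Sum>M | size M \<le> k. \<Sum>A\<in>UNIV. dphi_indep M A F y * snd z (add_mset \<kappa> M) $ A)" for F y \<kappa>
  proof -
    have "(\<Sum>\<mu>s | length \<mu>s \<le> k. \<Sum>A\<in>UNIV. dphi \<mu>s A F y * snd z (mset (\<mu>s @ [\<kappa>])) $ A) =
        (\<Sum>\<mu>s | length \<mu>s \<le> k. (\<lambda>M. \<Sum>A\<in>UNIV. dphi_indep M A F y / orderings M * snd z (add_mset \<kappa> M) $ A) (mset \<mu>s))"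
      by (simp add: dphi_def orderings_def)
    also have "\<dots> = (\<Sum>M | size M \<le> k. orderings M * (\<Sum>A\<in>UNIV. dphi_indep M A F y / orderings M * snd z (add_mset \<kappa> M) $ A))"
      by (rule sum_lists_multisets)
    also have "\<dots> = (\<Sum>M | size M \<le> k. \<Sum>A\<in>UNIV. dphi_indep M A F y * snd z (add_mset \<kappa> M) $ A)"
      by (intro sum.cong refl) (simp add: sum_distrib_left orderings_pos[THEN less_imp_neq, symmetric])
    finally show ?thesis .
  qed
  then show ?thesis unfolding total_div_def by simp
qed

lemma jet_deriv_simps [simp]:
  "jet_deriv (Inl \<mu>) G = dx \<mu> G" "jet_deriv (Inr (M, A)) G = dphi_indep M A G"
  by (simp_all add: jet_deriv_def)

lemma dphi_indep_total_div:
  fixes G :: "('n::finite, 'k::finite) jcoord \<Rightarrow> real^'n"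
  assumes D: "jet_open k D" and G: "\<And>\<kappa>. jet_smooth_on k D (\<lambda>z. G z $ \<kappa>)"
    and z: "jet_truncate k z \<in> D" and N: "size N \<le> Suc k"
  shows "dphi_indep N A (total_div k G) z = (\<Sum>\<kappa>\<in>UNIV.
    (if size N \<le> k then dx \<kappa> (dphi_indep N A (\<lambda>z. G z $ \<kappa>)) (jet_truncate k z) +
       (\<Sum>M | size M \<le> k. \<Sum>A'\<in>UNIV.
          dphi_indep M A' (dphi_indep N A (\<lambda>z. G z $ \<kappa>)) (jet_truncate k z) * snd z (add_mset \<kappa> M) $ A')
     else 0) +
    (if \<kappa> \<in># N then dphi_indep (N - {#\<kappa>#}) A (\<lambda>z. G z $ \<kappa>) (jet_truncate k z) else 0))"
proof -
  let ?G = "\<lambda>\<kappa> z. G z $ \<kappa>" and ?y = "jet_truncate k z"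
  define zt where "zt t = (fst z, (snd z)(N := snd z N + t *\<^sub>R axis A 1))" for t :: real
  have zt0: "zt 0 = z" by (simp add: zt_def)
  \<comment> \<open>For \<open>size N = Suc k\<close> the truncation removes the varied coordinate,
    so the coefficients in the divergence are constant and contribute nothing.\<close>
  have F: "((\<lambda>t. F (jet_truncate k (zt t))) has_real_derivative (if size N \<le> k then dphi_indep N A F ?y else 0)) (at 0)"
    if "jet_smooth_on k D F" for F
  proof (cases "size N \<le> k")
    case True
    have "jet_truncate k (zt t) = (fst ?y, (snd ?y)(N := snd ?y N + t *\<^sub>R axis A 1))" for t
      using True by (auto simp: jet_truncate_def zt_def fun_eq_iff)
    moreover have "jet_Ck_on k (Suc 0) D F" using that by (simp only: jet_smooth_on_def)
    then have "(\<lambda>t. F (fst ?y, (snd ?y)(N := snd ?y N + t *\<^sub>R axis A 1))) differentiable (at 0)"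
      using True z by auto
    ultimately show ?thesis
      using True by (simp add: dphi_indep_def DERIV_deriv_iff_real_differentiable)
  next
    case False
    then have "jet_truncate k (zt t) = ?y" for t
      by (auto simp: jet_truncate_def zt_def fun_eq_iff)
    then show ?thesis using False by simp
  qed
  have phi: "((\<lambda>t. snd (zt t) M $ A') has_real_derivative (if M = N \<and> A' = A then 1 else 0)) (at 0)" for M A'
    by (cases "M = N"; cases "A' = A") (auto simp: zt_def axis_def intro!: derivative_eq_intros)
  let ?d = "\<lambda>F. if size N \<le> k then dphi_indep N A F ?y else 0"
  have "((\<lambda>t. total_div k G (zt t)) has_real_derivative
     (\<Sum>\<kappa>\<in>UNIV. ?d (dx \<kappa> (?G \<kappa>)) +
       (\<Sum>M | size M \<le> k. \<Sum>A'\<in>UNIV. ?d (dphi_indep M A' (?G \<kappa>)) * snd (zt 0) (add_mset \<kappa> M) $ A' +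
          (if add_mset \<kappa> M = N \<and> A' = A then 1 else 0) * dphi_indep M A' (?G \<kappa>) (jet_truncate k (zt 0))))) (at 0)"
    unfolding total_div_multisets
  proof (intro DERIV_sum DERIV_add DERIV_mult F phi)
    show "jet_smooth_on k D (dx \<kappa> (?G \<kappa>))" for \<kappa>
      using jet_smooth_on_deriv[OF G, of "Inl \<kappa>"] by simp
    show "jet_smooth_on k D (dphi_indep M A' (?G \<kappa>))" if "M \<in> {M. size M \<le> k}" for M A' \<kappa>
      using jet_smooth_on_deriv[OF G, of "Inr (M, A')"] that by simp
  qed
  then have der: "dphi_indep N A (total_div k G) z =
     (\<Sum>\<kappa>\<in>UNIV. ?d (dx \<kappa> (?G \<kappa>)) +
       (\<Sum>M | size M \<le> k. \<Sum>A'\<in>UNIV. ?d (dphi_indep M A' (?G \<kappa>)) * snd z (add_mset \<kappa> M) $ A' +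
          (if add_mset \<kappa> M = N \<and> A' = A then 1 else 0) * dphi_indep M A' (?G \<kappa>) ?y))"
    unfolding dphi_indep_def[of N A "total_div k G"] zt0 zt_def[symmetric] by (rule DERIV_imp_deriv)
  have last: "(\<Sum>M | size M \<le> k. \<Sum>A'\<in>UNIV. (if add_mset \<kappa> M = N \<and> A' = A then 1 else 0) * dphi_indep M A' (?G \<kappa>) ?y) =
      (if \<kappa> \<in># N then dphi_indep (N - {#\<kappa>#}) A (?G \<kappa>) ?y else 0)" for \<kappa>
  proof -
    \<comment> \<open>The explicit factor is the varied coordinate exactly when \<open>M\<close> is
      \<open>N\<close> with one \<open>\<kappa>\<close> removed; since
      \<open>size N \<le> Suc k\<close>, this \<open>M\<close> lies in the range of the sum.\<close>
    have eq: "add_mset \<kappa> M = N \<longleftrightarrow> \<kappa> \<in># N \<and> M = N - {#\<kappa>#}" for M by auto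
    have "(\<Sum>A'\<in>UNIV. (if add_mset \<kappa> M = N \<and> A' = A then 1 else 0) * dphi_indep M A' (?G \<kappa>) ?y) =
        (if M = N - {#\<kappa>#} then (if \<kappa> \<in># N then dphi_indep M A (?G \<kappa>) ?y else 0) else 0)" for M
      unfolding eq by (auto simp: if_distrib[of "\<lambda>x. x * _"] cong: if_cong)
    moreover have "size (N - {#\<kappa>#}) \<le> k" if "\<kappa> \<in># N"
      using N that by (simp add: size_Diff_singleton)
    ultimately show ?thesis
      by (auto simp: sum.delta finite_multisets_size_le)
  qed
  \<comment> \<open>For \<open>size N \<le> k\<close> both directions belong to the coordinates on
    which \<open>G\<close> is smooth; exchanging the derivatives makes these terms the total
    divergence of the derivative by \<open>N\<close>.\<close>
  have comm: "dphi_indep N A (dx \<kappa> (?G \<kappa>)) ?y = dx \<kappa> (dphi_indep N A (?G \<kappa>)) ?y"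
    "size M \<le> k \<Longrightarrow> dphi_indep N A (dphi_indep M A' (?G \<kappa>)) ?y = dphi_indep M A' (dphi_indep N A (?G \<kappa>)) ?y"
    if "size N \<le> k" for \<kappa> M A'
    using jet_deriv_commute[OF D G z, of "Inr (N, A)" "Inl \<kappa>" \<kappa>]
      jet_deriv_commute[OF D G z, of "Inr (N, A)" "Inr (M, A')" \<kappa>] that by simp_all
  show ?thesis
    unfolding der
  proof (rule sum.cong[OF refl])
    fix \<kappa>
    have "(\<Sum>M | size M \<le> k. \<Sum>A'\<in>UNIV. ?d (dphi_indep M A' (?G \<kappa>)) * snd z (add_mset \<kappa> M) $ A' +
          (if add_mset \<kappa> M = N \<and> A' = A then 1 else 0) * dphi_indep M A' (?G \<kappa>) ?y) =
      (\<Sum>M | size M \<le> k. \<Sum>A'\<in>UNIV. ?d (dphi_indep M A' (?G \<kappa>)) * snd z (add_mset \<kappa> M) $ A') +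
      (if \<kappa> \<in># N then dphi_indep (N - {#\<kappa>#}) A (?G \<kappa>) ?y else 0)"
      unfolding last[symmetric] by (simp only: sum.distrib)
    then show "?d (dx \<kappa> (?G \<kappa>)) +
       (\<Sum>M | size M \<le> k. \<Sum>A'\<in>UNIV. ?d (dphi_indep M A' (?G \<kappa>)) * snd z (add_mset \<kappa> M) $ A' +
          (if add_mset \<kappa> M = N \<and> A' = A then 1 else 0) * dphi_indep M A' (?G \<kappa>) ?y) =
      (if size N \<le> k then dx \<kappa> (dphi_indep N A (?G \<kappa>)) ?y +
       (\<Sum>M | size M \<le> k. \<Sum>A'\<in>UNIV.
          dphi_indep M A' (dphi_indep N A (?G \<kappa>)) ?y * snd z (add_mset \<kappa> M) $ A')
       else 0) +
      (if \<kappa> \<in># N then dphi_indep (N - {#\<kappa>#}) A (?G \<kappa>) ?y else 0)"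
      by (auto simp: comm)
  qed
qed

text \<open>The weight of \<open>\<kappa>\<close> in the symmetrisation turns the divisor
  \<open>orderings (mset \<mu>s - {#\<kappa>#})\<close> into \<open>orderings (mset \<mu>s)\<close>,
  the divisor that \<open>dphi\<close> carries for the list \<open>\<mu>s\<close>.\<close>

lemma symmetrise_momenta:
  fixes \<mu>s :: "'n::finite list"
  assumes "\<mu>s \<noteq> []" and P: "\<And>M \<kappa>. Suc (size M) = length \<mu>s \<Longrightarrow> P M A \<kappa> = H \<kappa> M / orderings M"
  shows "symmetrise P \<mu>s A =
    (\<Sum>\<kappa>\<in>UNIV. if \<kappa> \<in># mset \<mu>s then H \<kappa> (mset \<mu>s - {#\<kappa>#}) else 0) / orderings (mset \<mu>s)"
proof -
  let ?N = "mset \<mu>s"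
  have m: "real (length \<mu>s) > 0" using assms by simp
  have "real (count ?N \<kappa>) * P (?N - {#\<kappa>#}) A \<kappa> / real (length \<mu>s) =
      (if \<kappa> \<in># ?N then H \<kappa> (?N - {#\<kappa>#}) else 0) / orderings ?N" for \<kappa>
  proof (cases "\<kappa> \<in># ?N")
    case True
    have "P (?N - {#\<kappa>#}) A \<kappa> = H \<kappa> (?N - {#\<kappa>#}) / orderings (?N - {#\<kappa>#})"
      using True assms(1) by (intro P) (simp add: size_Diff_singleton)
    then have H: "H \<kappa> (?N - {#\<kappa>#}) = P (?N - {#\<kappa>#}) A \<kappa> * orderings (?N - {#\<kappa>#})"
      using orderings_pos[of "?N - {#\<kappa>#}"] by simp
    have o: "orderings (?N - {#\<kappa>#}) = orderings ?N * real (count ?N \<kappa>) / real (length \<mu>s)"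
      using orderings_remove[OF True] m by (simp add: eq_divide_eq)
    show ?thesis
      using True orderings_pos[of ?N] unfolding H o by simp
  next
    case False
    then show ?thesis by (simp add: not_in_iff[THEN iffD1])
  qed
  then show ?thesis
    unfolding symmetrise_eq[OF assms(1)] by (simp add: sum_divide_distrib)
qed

lemma jet_open_image:
  fixes B :: "('m::{t2_space,second_countable_topology}, 'e::{t2_space,second_countable_topology},
               'q::{t2_space,second_countable_topology}, 'n::{finite,linorder}, 'k::finite) fbundle"
  assumes B: "smooth_fibre_bundle B" and e: "e \<in> adapted_charts B"
  shows "jet_open k (jet_image B k e)"
  unfolding jet_open_def
proof (intro allI impI)
  fix y :: "('n, 'k) jet_index \<Rightarrow> real" assume y: "of_coords y \<in> jet_image B k e"
  let ?W = "snd (snd e) ` fst (snd e)"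
  let ?p = "\<lambda>y :: ('n, 'k) jet_index \<Rightarrow> real. (fst (of_coords y), snd (of_coords y) {#})"
  have "open ?W" "?p y \<in> ?W"
    using is_chartD(2)[OF adapted_chartD(6)[OF e]] y by (auto simp: jet_image_iff[OF B e])
  then obtain \<epsilon> where \<epsilon>: "\<epsilon> > 0" "\<And>q. dist q (?p y) < \<epsilon> \<Longrightarrow> q \<in> ?W"
    unfolding open_dist by blast
  \<comment> \<open>The number of coordinates that determine the base point and the value of the
    jet; moving each by less than \<open>\<epsilon> / n\<close> keeps the point within distance
    \<open>\<epsilon>\<close>.\<close>
  define n where "n = real CARD('n) + real CARD('k)"
  have n: "n > 0" unfolding n_def by (simp add: add_pos_pos)
  show "\<exists>\<delta>>0. \<forall>w. jet_near k \<delta> y w \<longrightarrow> of_coords w \<in> jet_image B k e"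
  proof (intro exI[of _ "\<epsilon> / n"] conjI allI impI)
    fix w assume w: "jet_near k (\<epsilon> / n) y w"
    have 1: "dist (fst (of_coords w)) (fst (of_coords y)) < real CARD('n) * (\<epsilon> / n)"
    proof -
      have "dist (fst (of_coords w)) (fst (of_coords y)) \<le> (\<Sum>\<mu>\<in>UNIV. \<bar>w (Inl \<mu>) - y (Inl \<mu>)\<bar>)"
        using norm_le_l1_cart[of "fst (of_coords w) - fst (of_coords y)"] by (simp add: dist_norm of_coords_def)
      also have "\<dots> < (\<Sum>\<mu>\<in>(UNIV :: 'n set). \<epsilon> / n)"
        using w by (intro sum_strict_mono) (auto simp: jet_near_def)
      finally show ?thesis by simp
    qed
    have 2: "dist (snd (of_coords w) {#}) (snd (of_coords y) {#}) < real CARD('k) * (\<epsilon> / n)"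
    proof -
      have "dist (snd (of_coords w) {#}) (snd (of_coords y) {#}) \<le> (\<Sum>A\<in>UNIV. \<bar>w (Inr ({#}, A)) - y (Inr ({#}, A))\<bar>)"
        using norm_le_l1_cart[of "snd (of_coords w) {#} - snd (of_coords y) {#}"] by (simp add: dist_norm of_coords_def)
      also have "\<dots> < (\<Sum>A\<in>(UNIV :: 'k set). \<epsilon> / n)"
        using w by (intro sum_strict_mono) (auto simp: jet_near_def)
      finally show ?thesis by simp
    qed
    have "dist (?p w) (?p y) \<le> dist (fst (of_coords w)) (fst (of_coords y)) + dist (snd (of_coords w) {#}) (snd (of_coords y) {#})"
      by (simp add: dist_Pair_Pair sqrt_sum_squares_le_sum)
    also have "\<dots> < real CARD('n) * (\<epsilon> / n) + real CARD('k) * (\<epsilon> / n)"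
      using 1 2 by (rule add_strict_mono)
    also have "\<dots> = n * (\<epsilon> / n)" by (simp only: n_def distrib_right)
    also have "\<dots> = \<epsilon>" using n by simp
    finally have "?p w \<in> ?W" by (rule \<epsilon>(2))
    moreover have "snd (of_coords w) M = 0" if "k < size M" for M
    proof -
      have "snd (of_coords w) M = snd (of_coords y) M"
        using w that by (auto simp: jet_near_def of_coords_def vec_eq_iff)
      then show ?thesis using y that by (simp add: jet_image_iff[OF B e])
    qed
    ultimately show "of_coords w \<in> jet_image B k e"
      by (simp add: jet_image_iff[OF B e])
  qed (use \<epsilon> n in simp)
qed

section \<open>The phase section of a section\<close>

text \<open>The jet of \<open>f\<close> as a function of the base coordinates alone, so that total
  derivatives become ordinary derivatives along it.\<close>

definition prolongation ::
  "nat \<Rightarrow> ('m, 'e, 'n::{finite,linorder}, 'k::finite) achart \<Rightarrow> ('m \<Rightarrow> 'e) \<Rightarrow> (real, 'n) vec \<Rightarrow> ('n, 'k) jcoord" where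
  "prolongation k e f u =
     (u, \<lambda>M. if size M \<le> k then partials (sorted_list_of_multiset M) (local_rep e f) u else 0)"

definition divergence_momenta ::
  "('m::topological_space, 'e::topological_space, 'q, 'n::{finite,linorder}, 'k::finite) fbundle \<Rightarrow>
   nat \<Rightarrow> (('m, 'e) jet \<Rightarrow> ('m, (real, 'n) vec) form) \<Rightarrow> ('m, 'e, 'n, 'k) achart \<Rightarrow> ('m, 'e) jet \<Rightarrow>
   'n multiset \<Rightarrow> 'k \<Rightarrow> 'n \<Rightarrow> real" where
  "divergence_momenta B k F e j M A \<kappa> = (if size M \<le> k
     then dphi_indep M A (\<lambda>z. sub_local B k F e z $ \<kappa>) (jet_coords k e j) / orderings M else 0)"

text \<open>One arbitrary chart around the jet is used; for smooth \<open>F\<close> the value does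
  not depend on it by \<open>divergence_momenta_chart_independent\<close>. Off the vertical vectors
  it is zero, as \<open>phase_space\<close> demands.\<close>

definition phase_of_jet ::
  "('m::topological_space, 'e::topological_space, 'q, 'n::{finite,linorder}, 'k::finite) fbundle \<Rightarrow>
   nat \<Rightarrow> (('m, 'e) jet \<Rightarrow> ('m, (real, 'n) vec) form) \<Rightarrow> ('m, 'e) jet \<Rightarrow>
   ('m, 'e, 'n, 'k) vvec \<Rightarrow> ('m, (real, 'n) vec) form" where
  "phase_of_jet B k F j v =
     (let e = (SOME e. e \<in> adapted_charts B \<and> j \<in> jet_dom B k e) in
      if v \<in> vertical_space B k j
      then sub_form (base_atlas B) (fst e) (fst j) (pairing k (divergence_momenta B k F e j) (v e))
      else (\<lambda>_. 0))"

definition phase_section ::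
  "('m::topological_space, 'e::topological_space, 'q, 'n::{finite,linorder}, 'k::finite) fbundle \<Rightarrow>
   nat \<Rightarrow> (('m, 'e) jet \<Rightarrow> ('m, (real, 'n) vec) form) \<Rightarrow> ('m \<Rightarrow> 'e) \<Rightarrow>
   'm \<Rightarrow> ('m, 'e, 'n, 'k) phase_point" where
  "phase_section B k F f x = (jet B k x f, phase_of_jet B k F (jet B k x f))"

lemma pairing_linear:
  "pairing k P (\<lambda>M. r *\<^sub>R a M + s *\<^sub>R b M) = r *\<^sub>R pairing k P a + s *\<^sub>R pairing k P b"
  by (simp add: vec_eq_iff pairing_multisets sum_distrib_left sum.distrib[symmetric] algebra_simps)

lemma sub_form_linear:
  fixes A :: "('m::topological_space, (real, 'n::{finite,linorder}) vec) chart set"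
  shows "sub_form A c x (r *\<^sub>R a + s *\<^sub>R b) vs = r * sub_form A c x a vs + s * sub_form A c x b vs"
  by (simp add: sub_form_def sum_distrib_left sum.distrib[symmetric] algebra_simps)

context
  fixes B :: "('m::{t2_space,second_countable_topology}, 'e::{t2_space,second_countable_topology},
               'q::{t2_space,second_countable_topology}, 'n::{finite,linorder}, 'k::finite) fbundle"
  assumes B: "smooth_fibre_bundle B"
begin

section \<open>Sections in adapted charts and their prolongations\<close>

lemma section_local: "f \<in> sections B \<Longrightarrow> local_section B x f"
  unfolding sections_def local_section_def using open_UNIV by blast

lemma section_continuous: "f \<in> sections B \<Longrightarrow> continuous_on UNIV f"
  unfolding sections_def smooth_map_on_def by blast

lemma section_image:
  assumes f: "f \<in> sections B" and e: "e \<in> adapted_charts B"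
  shows "open (snd (fst e) ` {x. f x \<in> fst (snd e)})"
    and "u \<in> snd (fst e) ` {x. f x \<in> fst (snd e)} \<Longrightarrow>
      f (chart_inv (fst e) u) \<in> fst (snd e) \<and> snd (fst e) (chart_inv (fst e) u) = u"
    and "smooth_on (snd (fst e) ` {x. f x \<in> fst (snd e)}) (local_rep e f)"
proof -
  let ?U = "{x. f x \<in> fst (snd e)}"
  have "open (f -` fst (snd e))"
    using section_continuous[OF f] is_chartD(1)[OF adapted_chartD(6)[OF e]] by (simp add: open_vimage)
  then have U: "open ?U" by (simp add: vimage_def)
  have sub: "fst (fst e) \<inter> ?U = ?U"
    using local_section_base[OF B section_local[OF f] e] by blast
  show o: "open (snd (fst e) ` ?U)"
    using chart_image_open[OF adapted_chartD(5)[OF e] U] by (simp add: sub)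
  show "f (chart_inv (fst e) u) \<in> fst (snd e) \<and> snd (fst e) (chart_inv (fst e) u) = u"
    if "u \<in> snd (fst e) ` ?U"
    using that chart_inv_left[OF adapted_chartD(5)[OF e]] local_section_base[OF B section_local[OF f] e] by auto
  show "smooth_on (snd (fst e) ` ?U) (local_rep e f)"
    unfolding smooth_on_iff_smooth_at[OF o]
    using local_rep_smooth[OF B section_local[OF f] e] by blast
qed

lemma prolongation_eq:
  assumes f: "f \<in> sections B" and e: "e \<in> adapted_charts B" and x: "f x \<in> fst (snd e)"
  shows "jet_coords k e (jet B k x f) = prolongation k e f (snd (fst e) x)"
  by (auto simp: jet_coords_jet[OF B section_local[OF f] e x] prolongation_def jet_coeffs_def fun_eq_iff)

lemma prolongation_in_image:
  assumes f: "f \<in> sections B" and e: "e \<in> adapted_charts B" and u: "u \<in> snd (fst e) ` {x. f x \<in> fst (snd e)}"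
  shows "prolongation k e f u \<in> jet_image B k e"
proof -
  obtain x where x: "f x \<in> fst (snd e)" "u = snd (fst e) x" using u by blast
  then have "jet_coords k e (jet B k x f) \<in> jet_image B k e"
    unfolding jet_image_def using jet_in_dom[OF B section_local[OF f]] by blast
  then show ?thesis using prolongation_eq[OF f e x(1)] x(2) by simp
qed

lemma coord_prolongation:
  "coord (prolongation k e f u) (Inl \<mu>) = u $ \<mu>"
  "coord (prolongation k e f u) (Inr (M, A)) =
    (if size M \<le> k then partials (sorted_list_of_multiset M) (local_rep e f) u $ A else 0)"
  by (simp_all add: coord_def prolongation_def)

lemma coord_prolongation_outside:
  "i \<notin> jet_indices k \<Longrightarrow> coord (prolongation k e f u) i = 0"
  by (cases i) (auto simp: coord_prolongation)

lemma smooth_on_prolongation: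
  assumes f: "f \<in> sections B" and e: "e \<in> adapted_charts B"
    and G: "jet_smooth_on k (jet_image B k e) G"
  shows "smooth_on (snd (fst e) ` {x. f x \<in> fst (snd e)}) (\<lambda>u. G (prolongation k e f u))"
proof -
  let ?S = "snd (fst e) ` {x. f x \<in> fst (snd e)}"
  note S = section_image[OF f e]
  have y: "smooth_on ?S (\<lambda>u. coord (prolongation k e f u) i)" if "i \<in> jet_indices k" for i
  proof (cases i)
    case (Inl \<mu>)
    then show ?thesis
      using smooth_on_linear[OF S(1) bounded_linear_vec_nth] by (simp add: coord_prolongation)
  next
    case (Inr p)
    then show ?thesis
      using that smooth_on_linear_compose[OF S(1) bounded_linear_vec_nth smooth_on_partials[OF S(1,3)]]
      by (cases p) (simp add: coord_prolongation)
  qed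
  have "smooth_on ?S (\<lambda>u. G (of_coords (coord (prolongation k e f u))))"
    by (rule jet_smooth_compose[OF jet_open_image[OF B e] G S(1)])
      (simp_all add: y coord_prolongation_outside prolongation_in_image[OF f e])
  then show ?thesis by simp
qed

text \<open>Chain rule along the prolongation. Differentiating the coordinate labelled by
  \<open>M\<close> in direction \<open>\<kappa>\<close> gives the one labelled by
  \<open>add_mset \<kappa> M\<close>, which for \<open>size M = k\<close> belongs to the jet of
  order \<open>Suc k\<close>; the result is a formal total derivative.\<close>

lemma partial_prolongation:
  assumes f: "f \<in> sections B" and e: "e \<in> adapted_charts B"
    and G: "jet_smooth_on k (jet_image B k e) G" and u: "u \<in> snd (fst e) ` {x. f x \<in> fst (snd e)}"
  shows "partial \<kappa> (\<lambda>u. G (prolongation k e f u)) u = dx \<kappa> G (prolongation k e f u) +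
    (\<Sum>M | size M \<le> k. \<Sum>A\<in>UNIV. dphi_indep M A G (prolongation k e f u) *
       snd (prolongation (Suc k) e f u) (add_mset \<kappa> M) $ A)"
proof -
  let ?S = "snd (fst e) ` {x. f x \<in> fst (snd e)}" and ?g = "local_rep e f"
  note S = section_image[OF f e]
  let ?y = "\<lambda>u. coord (prolongation k e f u)"
  define y' where "y' i v = (case i of Inl \<mu> \<Rightarrow> v $ \<mu> | Inr (M, A) \<Rightarrow>
    frechet_derivative (partials (sorted_list_of_multiset M) ?g) (at u) v $ A)" for i v
  have "((\<lambda>b. ?y b i) has_derivative y' i) (at u)" if "i \<in> jet_indices k" for i
  proof (cases i)
    case (Inl \<mu>)
    then show ?thesis
      using bounded_linear_imp_has_derivative[OF bounded_linear_vec_nth]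
      by (simp add: coord_prolongation y'_def[abs_def])
  next
    case (Inr p)
    then show ?thesis
      using that bounded_linear.has_derivative[OF bounded_linear_vec_nth
          smooth_on_derivative[OF S(1) smooth_on_partials[OF S(1,3)] u]]
      by (cases p) (simp add: coord_prolongation y'_def[abs_def])
  qed
  moreover have "jet_Ck_on k (Suc 0) (jet_image B k e) G" using G by (simp only: jet_smooth_on_def)
  ultimately have "((\<lambda>b. G (of_coords (?y b))) has_derivative
      (\<lambda>v. \<Sum>i\<in>jet_indices k. jet_deriv i G (of_coords (?y u)) * y' i v)) (at u)"
    using prolongation_in_image[OF f e u]
    by (intro jet_chain_rule[OF jet_open_image[OF B e]]) (simp_all add: coord_prolongation_outside)
  from has_derivative_partial(2)[OF this, of \<kappa>]
  have "partial \<kappa> (\<lambda>u. G (prolongation k e f u)) u =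
      (\<Sum>i\<in>jet_indices k. jet_deriv i G (prolongation k e f u) * y' i (axis \<kappa> 1))"
    by simp
  also have "\<dots> = (\<Sum>\<mu>\<in>UNIV. dx \<mu> G (prolongation k e f u) * (axis \<kappa> 1 $ \<mu>)) +
      (\<Sum>M | size M \<le> k. \<Sum>A\<in>UNIV. dphi_indep M A G (prolongation k e f u) *
        frechet_derivative (partials (sorted_list_of_multiset M) ?g) (at u) (axis \<kappa> 1) $ A)"
    by (simp add: sum_jet_indices y'_def)
  also have "(\<Sum>\<mu>\<in>UNIV. dx \<mu> G (prolongation k e f u) * (axis \<kappa> 1 $ \<mu>)) = dx \<kappa> G (prolongation k e f u)"
    by (simp add: axis_def if_distrib[of "\<lambda>x. _ * x"] cong: if_cong)
  also have "(\<Sum>M | size M \<le> k. \<Sum>A\<in>UNIV. dphi_indep M A G (prolongation k e f u) *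
        frechet_derivative (partials (sorted_list_of_multiset M) ?g) (at u) (axis \<kappa> 1) $ A) =
      (\<Sum>M | size M \<le> k. \<Sum>A\<in>UNIV. dphi_indep M A G (prolongation k e f u) *
       snd (prolongation (Suc k) e f u) (add_mset \<kappa> M) $ A)"
  proof (rule sum.cong[OF refl])
    fix M :: "'n multiset" assume M: "M \<in> {M. size M \<le> k}"
    have "frechet_derivative (partials (sorted_list_of_multiset M) ?g) (at u) (axis \<kappa> 1) =
        partials (\<kappa> # sorted_list_of_multiset M) ?g u"
      using partial_eq_frechet[OF S(1) smooth_on_partials[OF S(1,3)] u] by simp
    also have "\<dots> = partials (sorted_list_of_multiset (add_mset \<kappa> M)) ?g u"
      by (rule partials_mset_cong[OF S(1,3) u]) simp
    also have "\<dots> = snd (prolongation (Suc k) e f u) (add_mset \<kappa> M)"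
      using M by (simp add: prolongation_def)
    finally show "(\<Sum>A\<in>UNIV. dphi_indep M A G (prolongation k e f u) *
        frechet_derivative (partials (sorted_list_of_multiset M) ?g) (at u) (axis \<kappa> 1) $ A) =
      (\<Sum>A\<in>UNIV. dphi_indep M A G (prolongation k e f u) *
        snd (prolongation (Suc k) e f u) (add_mset \<kappa> M) $ A)" by simp
  qed
  finally show ?thesis .
qed

section \<open>The vertical derivative of the form-valued function\<close>

lemma sub_local_smooth:
  "smooth_sub_valued B k F \<Longrightarrow> e \<in> adapted_charts B \<Longrightarrow>
    jet_smooth_on k (jet_image B k e) (\<lambda>z. sub_local B k F e z $ \<kappa>)"
  unfolding smooth_sub_valued_def by blast

lemma sub_local_deriv_smooth:
  "smooth_sub_valued B k F \<Longrightarrow> e \<in> adapted_charts B \<Longrightarrow> size M \<le> k \<Longrightarrow>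
    jet_smooth_on k (jet_image B k e) (dphi_indep M A (\<lambda>z. sub_local B k F e z $ \<kappa>))"
  using jet_smooth_on_deriv[OF sub_local_smooth, of k F e "Inr (M, A)"] by simp

lemma sub_form_sub_local:
  assumes F: "smooth_sub_valued B k F" and e: "e \<in> adapted_charts B" and j: "j \<in> jet_dom B k e"
  shows "F j = sub_form (base_atlas B) (fst e) (fst j) (sub_local B k F e (jet_coords k e j))"
proof -
  obtain s where s: "local_section B (fst j) s" "s (fst j) \<in> fst (snd e)"
    using jet_domE[OF B j] by metis
  note A = atlases(1)[OF B] adapted_chartD(1)[OF e] local_section_base[OF B s(1) e s(2)]
  have "F j \<in> forms_at (base_atlas B) (CARD('n) - 1) (fst j)"
    using F j unfolding smooth_sub_valued_def jet_dom_def by blast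
  then obtain a where a: "F j = sub_form (base_atlas B) (fst e) (fst j) a"
    using forms_at_eq_sub_form[OF A] by blast
  then have "sub_local B k F e (jet_coords k e j) = a"
    by (simp add: sub_local_def jet_point_coords[OF B e j] sub_coeff_sub_form[OF A])
  then show ?thesis using a by simp
qed

lemma has_derivative_along_vertical_curve:
  assumes F: "smooth_sub_valued B k F" and e: "e \<in> adapted_charts B" and j: "j \<in> jet_dom B k e"
    and \<gamma>: "\<gamma> 0 = j" "\<And>t. fst (\<gamma> t) = fst j" "\<forall>\<^sub>F t in nhds 0. \<gamma> t \<in> jet_dom B k e"
    and der: "\<And>M. ((\<lambda>t. snd (jet_coords k e (\<gamma> t)) M) has_vector_derivative v M) (at 0)"
  shows "((\<lambda>t. F (\<gamma> t) vs) has_vector_derivative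
    sub_form (base_atlas B) (fst e) (fst j) (pairing k (divergence_momenta B k F e j) v) vs) (at 0)"
proof (cases "length vs = CARD('n) - 1 \<and> set vs \<subseteq> tangent_space (base_atlas B) (fst j)")
  case True
  let ?A = "base_atlas B" and ?c = "fst e" and ?x = "fst j"
  define K where "K \<kappa> = det_list (axis \<kappa> 1 # map (\<lambda>v. v ?c) vs)" for \<kappa>
  have sub: "sub_form ?A ?c ?x a vs = (\<Sum>\<kappa>\<in>UNIV. a $ \<kappa> * K \<kappa>)" for a
    using True by (simp add: sub_form_def K_def)
  let ?y = "\<lambda>t. coord (jet_coords k e (\<gamma> t))"
  \<comment> \<open>The base coordinates do not move because the curve stays over one point, so only
    the derivatives by fibre coordinates contribute.\<close>
  define y' where "y' i t = (case i of Inl \<mu> \<Rightarrow> 0 | Inr (M, A) \<Rightarrow> t * v M $ A)"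
    for i :: "('n, 'k) jet_index" and t :: real
  have fst_coords: "fst (jet_coords k e (\<gamma> t)) = snd ?c ?x" for t
    using \<gamma>(2) by (simp add: jet_coords_def Let_def)
  have y: "((\<lambda>t. ?y t i) has_derivative y' i) (at 0)" for i
  proof (cases i)
    case (Inl \<mu>)
    then show ?thesis by (simp add: coord_def y'_def[abs_def] fst_coords)
  next
    case (Inr p)
    show ?thesis
      using bounded_linear.has_derivative[OF bounded_linear_vec_nth der[of "fst p", unfolded has_vector_derivative_def]]
      by (simp add: Inr coord_def y'_def[abs_def] split_beta)
  qed
  have out: "?y t i = ?y 0 i" if "i \<notin> jet_indices k" for t i
    using that by (cases i) (auto simp: coord_def jet_coords_beyond)
  have "((\<lambda>t. sub_local B k F e (jet_coords k e (\<gamma> t)) $ \<kappa>) has_vector_derivative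
      pairing k (divergence_momenta B k F e j) v $ \<kappa>) (at 0)" for \<kappa>
  proof -
    let ?G = "\<lambda>z. sub_local B k F e z $ \<kappa>"
    have "jet_Ck_on k (Suc 0) (jet_image B k e) ?G"
      using sub_local_smooth[OF F e] by (simp only: jet_smooth_on_def)
    moreover have "jet_coords k e j \<in> jet_image B k e"
      using j by (simp add: jet_image_def)
    ultimately have "((\<lambda>t. ?G (of_coords (?y t))) has_derivative
        (\<lambda>t. \<Sum>i\<in>jet_indices k. jet_deriv i ?G (of_coords (?y 0)) * y' i t)) (at 0)"
      using out by (intro jet_chain_rule[OF jet_open_image[OF B e] _ _ y]) (simp_all add: \<gamma>(1))
    moreover have "(\<Sum>i\<in>jet_indices k. jet_deriv i ?G (of_coords (?y 0)) * y' i t) =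
        t *\<^sub>R pairing k (divergence_momenta B k F e j) v $ \<kappa>" for t
      unfolding sum_jet_indices pairing_multisets
      by (simp add: y'_def \<gamma>(1) sum_distrib_left divergence_momenta_def mult.left_commute)
        (intro sum.cong refl, simp add: orderings_pos[THEN less_imp_neq, symmetric])
    ultimately show ?thesis by (simp add: has_vector_derivative_def)
  qed
  then have "((\<lambda>t. \<Sum>\<kappa>\<in>UNIV. sub_local B k F e (jet_coords k e (\<gamma> t)) $ \<kappa> * K \<kappa>) has_vector_derivative
      (\<Sum>\<kappa>\<in>UNIV. pairing k (divergence_momenta B k F e j) v $ \<kappa> * K \<kappa>)) (at 0)"
    by (intro has_vector_derivative_sum has_vector_derivative_mult_left)
  then show ?thesis
    unfolding sub
  proof (rule has_vector_derivative_eventually_cong)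
    show "\<forall>\<^sub>F t in nhds 0. (\<Sum>\<kappa>\<in>UNIV. sub_local B k F e (jet_coords k e (\<gamma> t)) $ \<kappa> * K \<kappa>) = F (\<gamma> t) vs"
      using \<gamma>(3)
    proof (rule eventually_mono)
      fix t assume "\<gamma> t \<in> jet_dom B k e"
      from sub_form_sub_local[OF F e this]
      show "(\<Sum>\<kappa>\<in>UNIV. sub_local B k F e (jet_coords k e (\<gamma> t)) $ \<kappa> * K \<kappa>) = F (\<gamma> t) vs"
        by (simp add: \<gamma>(2) sub)
    qed
  qed
next
  case False
  \<comment> \<open>On arguments that are not lists of \<open>CARD('n) - 1\<close> tangent vectors
    both the form and its proposed derivative vanish.\<close>
  have zero: "sub_form (base_atlas B) (fst e) (fst j) a vs = 0" for a
    using False by (simp only: sub_form_def if_False)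
  show ?thesis
    unfolding zero
  proof (rule has_vector_derivative_eventually_cong[OF has_vector_derivative_const])
    show "\<forall>\<^sub>F t in nhds 0. 0 = F (\<gamma> t) vs"
      using \<gamma>(3)
    proof (rule eventually_mono)
      fix t assume "\<gamma> t \<in> jet_dom B k e"
      from sub_form_sub_local[OF F e this] show "0 = F (\<gamma> t) vs"
        by (simp add: \<gamma>(2) zero)
    qed
  qed
qed

lemma divergence_momenta_chart_independent:
  assumes F: "smooth_sub_valued B k F" and v: "v \<in> vertical_space B k j"
    and e: "e \<in> adapted_charts B" "j \<in> jet_dom B k e" and e': "e' \<in> adapted_charts B" "j \<in> jet_dom B k e'"
  shows "sub_form (base_atlas B) (fst e) (fst j) (pairing k (divergence_momenta B k F e j) (v e)) =
    sub_form (base_atlas B) (fst e') (fst j) (pairing k (divergence_momenta B k F e' j) (v e'))"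
proof
  fix vs
  obtain \<gamma> where \<gamma>: "\<gamma> 0 = j" "\<And>t. \<gamma> t \<in> jet_space B k" "\<And>t. fst (\<gamma> t) = fst j"
    and dom: "\<And>e. e \<in> adapted_charts B \<Longrightarrow> j \<in> jet_dom B k e \<Longrightarrow> \<forall>\<^sub>F t in nhds 0. \<gamma> t \<in> jet_dom B k e"
    and der: "\<And>e M. e \<in> adapted_charts B \<Longrightarrow> j \<in> jet_dom B k e \<Longrightarrow>
      ((\<lambda>t. snd (jet_coords k e (\<gamma> t)) M) has_vector_derivative v e M) (at 0)"
    by (rule vertical_spaceD[OF v]) (rule that, assumption+)
  show "sub_form (base_atlas B) (fst e) (fst j) (pairing k (divergence_momenta B k F e j) (v e)) vs =
    sub_form (base_atlas B) (fst e') (fst j) (pairing k (divergence_momenta B k F e' j) (v e')) vs"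
    by (rule vector_derivative_unique_at[OF
          has_derivative_along_vertical_curve[OF F e \<gamma>(1,3) dom[OF e] der[OF e]]
          has_derivative_along_vertical_curve[OF F e' \<gamma>(1,3) dom[OF e'] der[OF e']]])
qed

lemma phase_of_jet_is_momenta:
  assumes F: "smooth_sub_valued B k F" and e: "e \<in> adapted_charts B" "j \<in> jet_dom B k e"
  shows "is_momenta B k e j (phase_of_jet B k F j) (divergence_momenta B k F e j)"
proof -
  let ?e = "SOME e. e \<in> adapted_charts B \<and> j \<in> jet_dom B k e"
  have "?e \<in> adapted_charts B \<and> j \<in> jet_dom B k ?e"
    using e by (intro someI[where P = "\<lambda>e. e \<in> adapted_charts B \<and> j \<in> jet_dom B k e"]) blast
  then show ?thesis
    unfolding is_momenta_def
    using divergence_momenta_chart_independent[OF F _ _ _ e, of _ ?e]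
    by (simp add: phase_of_jet_def Let_def divergence_momenta_def)
qed

lemma phase_of_jet_in_phase_space:
  assumes F: "smooth_sub_valued B k F" and s: "local_section B x s"
  shows "(jet B k x s, phase_of_jet B k F (jet B k x s)) \<in> phase_space B k"
proof -
  let ?j = "jet B k x s" and ?p = "phase_of_jet B k F (jet B k x s)"
  obtain e where e: "e \<in> adapted_charts B" "s x \<in> fst (snd e)"
    using adapted_chart_exists[OF B] by blast
  then have j: "?j \<in> jet_dom B k e" using jet_in_dom[OF B s] by simp
  note P = phase_of_jet_is_momenta[OF F e(1) j, unfolded is_momenta_def, THEN conjunct2, rule_format]
  show ?thesis
    unfolding phase_space_def
  proof (intro CollectI case_prodI conjI ballI allI impI)
    show "?j \<in> jet_space B k" by (rule jet_in_space[OF B s])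
    show "?p v \<in> forms_at (base_atlas B) (CARD('n) - 1) (fst ?j)" if "v \<in> vertical_space B k ?j" for v
      unfolding P[OF that] by (rule sub_form_in_forms_at[OF atlases(1)[OF B]])
    show "?p (\<lambda>e M. a *\<^sub>R v e M + b *\<^sub>R w e M) = (\<lambda>vs. a * ?p v vs + b * ?p w vs)"
      if v: "v \<in> vertical_space B k ?j" "w \<in> vertical_space B k ?j" for v w a b
      unfolding P[OF v(1)] P[OF v(2)] P[OF vertical_space_linear[OF B s v]]
      by (rule ext) (simp only: pairing_linear sub_form_linear)
    show "?p v = (\<lambda>_. 0)" if "v \<notin> vertical_space B k ?j" for v
      using that by (simp add: phase_of_jet_def)
  qed
qed

section \<open>The phase section and its uniqueness\<close>

lemma momenta_phase_section:
  assumes F: "smooth_sub_valued B k F" and f: "f \<in> sections B"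
    and e: "e \<in> adapted_charts B" "f x \<in> fst (snd e)"
  shows "momenta B k e (phase_section B k F f x) = divergence_momenta B k F e (jet B k x f)"
  unfolding phase_section_def
  using e jet_in_dom[OF B section_local[OF f], of k x e]
  by (intro momenta_eqI[OF B section_local[OF f] e] phase_of_jet_is_momenta[OF F]) auto

lemma phase_section_in_phase_sections:
  assumes F: "smooth_sub_valued B k F" and f: "f \<in> sections B"
  shows "phase_section B k F f \<in> phase_sections B k"
proof -
  let ?\<sigma> = "phase_section B k F f"
  have "smooth_on S (\<lambda>u. snd (jet_coords k e (fst (?\<sigma> (chart_inv (fst e) u)))) M) \<and>
      smooth_on S (\<lambda>u. momenta B k e (?\<sigma> (chart_inv (fst e) u)) M A \<kappa>)"
    if e: "e \<in> adapted_charts B" and S: "S = snd (fst e) ` {x. fst (?\<sigma> x) \<in> jet_dom B k e}" for e M A \<kappa> S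
  proof -
    have S: "S = snd (fst e) ` {x. f x \<in> fst (snd e)}"
      unfolding S phase_section_def using jet_in_dom[OF B section_local[OF f]] by simp
    note im = section_image[OF f e, folded S]
    have coords: "jet_coords k e (jet B k (chart_inv (fst e) u) f) = prolongation k e f u" if "u \<in> S" for u
      using prolongation_eq[OF f e, of "chart_inv (fst e) u"] im(2)[OF that] by simp
    show ?thesis
    proof
      have 1: "smooth_on S (\<lambda>u. snd (prolongation k e f u) M)"
        unfolding prolongation_def
        by (cases "size M \<le> k") (use smooth_on_partials[OF im(1,3)] smooth_on_const[OF im(1)] in simp_all)
      show "smooth_on S (\<lambda>u. snd (jet_coords k e (fst (?\<sigma> (chart_inv (fst e) u)))) M)"
        by (rule smooth_on_cong[OF im(1) _ 1]) (simp add: phase_section_def coords)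
      let ?G = "dphi_indep M A (\<lambda>z. sub_local B k F e z $ \<kappa>)"
      have mom: "momenta B k e (?\<sigma> (chart_inv (fst e) u)) M A \<kappa> =
          (if size M \<le> k then (1 / orderings M) * ?G (prolongation k e f u) else 0)" if "u \<in> S" for u
        using im(2)[OF that] coords[OF that]
        by (simp add: momenta_phase_section[OF F f e] divergence_momenta_def)
      have 2: "smooth_on S (\<lambda>u. if size M \<le> k then (1 / orderings M) * ?G (prolongation k e f u) else 0)"
      proof (cases "size M \<le> k")
        case True
        then show ?thesis
          using smooth_on_prolongation[OF f e sub_local_deriv_smooth[OF F e True]]
          by (simp only: if_True S[symmetric]) (rule smooth_on_bilinear[OF im(1) bounded_bilinear_mult smooth_on_const[OF im(1)]])
      qed (simp add: smooth_on_const[OF im(1)])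
      show "smooth_on S (\<lambda>u. momenta B k e (?\<sigma> (chart_inv (fst e) u)) M A \<kappa>)"
        by (rule smooth_on_cong[OF im(1) _ 2]) (simp only: mom)
    qed
  qed
  then show ?thesis
    unfolding phase_sections_def Let_def
    using phase_of_jet_in_phase_space[OF F section_local[OF f]] section_continuous[OF f]
    by (simp add: phase_section_def jet_fst[OF B] jet_target_jet[OF B section_local[OF f]])
qed

lemma phase_section_momenta_given_by:
  assumes F: "smooth_sub_valued B k F" and f: "f \<in> sections B"
  shows "momenta_given_by B k F (phase_section B k F f)"
  unfolding momenta_given_by_def
proof (intro ballI allI impI)
  fix e x and \<mu>s :: "'n list" and A \<kappa>
  assume e: "e \<in> adapted_charts B" and "fst (phase_section B k F f x) \<in> jet_dom B k e"
    and len: "length \<mu>s \<le> k"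
  then have "f x \<in> fst (snd e)"
    using jet_in_dom[OF B section_local[OF f]] by (simp add: phase_section_def)
  from momenta_phase_section[OF F f e this]
  show "momenta B k e (phase_section B k F f x) (mset \<mu>s) A \<kappa> =
      dphi \<mu>s A (\<lambda>z. sub_local B k F e z $ \<kappa>) (jet_coords k e (fst (phase_section B k F f x)))"
    using len by (simp add: divergence_momenta_def dphi_def orderings_def phase_section_def)
qed

text \<open>The prescribed momenta agree with those of \<open>phase_section\<close> in a chart
  around each value \<open>f x\<close>, and by \<open>phase_point_eqI\<close> one chart determines
  the phase point.\<close>

lemma phase_section_unique:
  assumes F: "smooth_sub_valued B k F" and f: "f \<in> sections B"
    and \<tau>: "\<tau> \<in> phase_sections B k" "\<And>x. fst (\<tau> x) = jet B k x f" "momenta_given_by B k F \<tau>"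
  shows "\<tau> = phase_section B k F f"
proof
  fix x
  obtain p where p: "\<tau> x = (jet B k x f, p)" using \<tau>(2)[of x] by (metis prod.collapse)
  obtain e where e: "e \<in> adapted_charts B" "f x \<in> fst (snd e)"
    using adapted_chart_exists[OF B] by blast
  then have j: "jet B k x f \<in> jet_dom B k e" using jet_in_dom[OF B section_local[OF f]] by simp
  have "p = phase_of_jet B k F (jet B k x f)"
  proof (rule phase_point_eqI[OF B section_local[OF f] e])
    show "(jet B k x f, p) \<in> phase_space B k"
      using \<tau>(1) p unfolding phase_sections_def by (metis (mono_tags, lifting) mem_Collect_eq)
    show "(jet B k x f, phase_of_jet B k F (jet B k x f)) \<in> phase_space B k"
      by (rule phase_of_jet_in_phase_space[OF F section_local[OF f]])
    fix M :: "'n multiset" and A \<kappa> assume M: "size M \<le> k"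
    obtain \<mu>s where \<mu>s: "M = mset \<mu>s" by (metis ex_mset)
    have len: "length \<mu>s \<le> k" using M by (simp add: \<mu>s)
    have "momenta B k e (\<sigma> x) (mset \<mu>s) A \<kappa> =
        dphi \<mu>s A (\<lambda>z. sub_local B k F e z $ \<kappa>) (jet_coords k e (jet B k x f))"
      if "momenta_given_by B k F \<sigma>" "fst (\<sigma> x) = jet B k x f" for \<sigma>
      using that e(1) j len unfolding momenta_given_by_def by metis
    from this[OF \<tau>(3,2)] this[OF phase_section_momenta_given_by[OF F f]]
    have "momenta B k e (\<tau> x) (mset \<mu>s) A \<kappa> = momenta B k e (phase_section B k F f x) (mset \<mu>s) A \<kappa>"
      by (simp add: phase_section_def)
    then show "momenta B k e (jet B k x f, p) M A \<kappa> =
        momenta B k e (jet B k x f, phase_of_jet B k F (jet B k x f)) M A \<kappa>"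
      by (simp add: p phase_section_def \<mu>s)
  qed
  then show "\<tau> x = phase_section B k F f x" by (simp add: p phase_section_def)
qed

end

section \<open>The Euler--Lagrange equations of a total divergence\<close>

context
  fixes B :: "('m::{t2_space,second_countable_topology}, 'e::{t2_space,second_countable_topology},
               'q::{t2_space,second_countable_topology}, 'n::{finite,linorder}, 'k::finite) fbundle"
  assumes B: "smooth_fibre_bundle B"
begin

lemma top_local_total_divergence:
  assumes L: "is_total_divergence B k F L" and e: "e \<in> adapted_charts B"
    and z: "z \<in> jet_image B (Suc k) e"
  shows "top_local B (Suc k) L e z = total_div k (sub_local B k F e) z"
proof -
  let ?j = "jet_point B (Suc k) e z"
  have j: "?j \<in> jet_dom B (Suc k) e" "jet_coords (Suc k) e ?j = z"
    using jet_point_image[OF B] z by blast+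
  obtain s where s: "local_section B (fst ?j) s" "s (fst ?j) \<in> fst (snd e)"
    using jet_domE[OF B j(1)] by metis
  have "L ?j = top_form (base_atlas B) (fst e) (fst ?j) (total_div k (sub_local B k F e) z)"
    using L e j unfolding is_total_divergence_def by simp
  then show ?thesis
    by (simp add: top_local_def top_coeff_top_form[OF atlases(1)[OF B] adapted_chartD(1)[OF e]
          local_section_base[OF B s(1) e s(2)]])
qed

text \<open>The two functions are known to agree on the image of the chart in jet coordinates, so
  the line in direction \<open>N\<close> must stay in this image near \<open>0\<close>. It does for
  \<open>size N \<le> Suc k\<close> because the image is open in those directions.\<close>

lemma dphi_indep_top_local:
  assumes L: "is_total_divergence B k F L" and e: "e \<in> adapted_charts B"
    and z: "z \<in> jet_image B (Suc k) e" and N: "size N \<le> Suc k"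
  shows "dphi_indep N A (top_local B (Suc k) L e) z = dphi_indep N A (total_div k (sub_local B k F e)) z"
proof -
  let ?D = "jet_image B (Suc k) e" and ?i = "Inr (N, A)"
  define zt where "zt t = (fst z, (snd z)(N := snd z N + t *\<^sub>R axis A 1))" for t :: real
  have zt: "zt t = of_coords ((coord z)(?i := coord z ?i + t))" for t
    by (simp add: zt_def of_coords_shift)
  obtain \<delta> where \<delta>: "\<delta> > 0" "\<And>w. jet_near (Suc k) \<delta> (coord z) w \<Longrightarrow> of_coords w \<in> ?D"
    using jet_open_image[OF B e, of "Suc k"] z unfolding jet_open_def by (metis of_coords_coord)
  have "zt t \<in> ?D" if "dist t 0 < \<delta>" for t
    unfolding zt by (intro \<delta>(2) jet_near_upd jet_near_refl \<delta>(1)) (use N that in \<open>auto simp: dist_real_def\<close>)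
  then have "\<forall>\<^sub>F t in nhds 0. zt t \<in> ?D"
    using \<delta>(1) unfolding eventually_nhds_metric by blast
  then have "\<forall>\<^sub>F t in nhds 0. top_local B (Suc k) L e (zt t) = total_div k (sub_local B k F e) (zt t)"
    by (rule eventually_mono) (rule top_local_total_divergence[OF L e])
  then show ?thesis
    unfolding dphi_indep_def zt_def by (rule deriv_cong_ev) simp
qed

lemma jet_truncate_prolongation: "jet_truncate k (prolongation (Suc k) e f u) = prolongation k e f u"
  by (auto simp: jet_truncate_def prolongation_def)

text \<open>By \<open>partial_prolongation\<close> the total divergence of the derivative by
  \<open>N\<close> becomes an ordinary divergence of a function of the base coordinates, the form in
  which \<open>momenta_div\<close> is defined.\<close>

lemma dphi_top_local:
  fixes A :: 'k and \<mu>s :: "'n list"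
  assumes F: "smooth_sub_valued B k F" and L: "is_total_divergence B k F L" and f: "f \<in> sections B"
    and e: "e \<in> adapted_charts B" "f x \<in> fst (snd e)" and len: "length \<mu>s \<le> Suc k"
  defines "u \<equiv> snd (fst e) x" and "N \<equiv> mset \<mu>s"
  defines "H \<equiv> (\<lambda>\<kappa> M. dphi_indep M A (\<lambda>z. sub_local B k F e z $ \<kappa>) (prolongation k e f u))"
  shows "dphi \<mu>s A (top_local B (Suc k) L e) (jet_coords (Suc k) e (jet B (Suc k) x f)) =
    (\<Sum>\<kappa>\<in>UNIV. (if size N \<le> k then
         partial \<kappa> (\<lambda>u. dphi_indep N A (\<lambda>z. sub_local B k F e z $ \<kappa>) (prolongation k e f u)) u else 0) +
       (if \<kappa> \<in># N then H \<kappa> (N - {#\<kappa>#}) else 0)) / orderings N"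
proof -
  have u: "u \<in> snd (fst e) ` {x. f x \<in> fst (snd e)}" using e by (auto simp: u_def)
  have N: "size N \<le> Suc k" using len by (simp add: N_def)
  have "dphi_indep N A (top_local B (Suc k) L e) (prolongation (Suc k) e f u) =
      dphi_indep N A (total_div k (sub_local B k F e)) (prolongation (Suc k) e f u)"
    by (rule dphi_indep_top_local[OF L e(1) prolongation_in_image[OF B f e(1) u] N])
  also have "\<dots> = (\<Sum>\<kappa>\<in>UNIV. (if size N \<le> k then
         partial \<kappa> (\<lambda>u. dphi_indep N A (\<lambda>z. sub_local B k F e z $ \<kappa>) (prolongation k e f u)) u else 0) +
       (if \<kappa> \<in># N then H \<kappa> (N - {#\<kappa>#}) else 0))"
    using prolongation_in_image[OF B f e(1) u, of k]
    by (subst dphi_indep_total_div[OF jet_open_image[OF B e(1)] sub_local_smooth[OF B F e(1)] _ N])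
      (auto simp: jet_truncate_prolongation H_def
        partial_prolongation[OF B f e(1) sub_local_deriv_smooth[OF B F e(1)] u] intro!: sum.cong)
  finally show ?thesis
    unfolding prolongation_eq[OF B f e] u_def[symmetric] by (simp add: dphi_def N_def orderings_def)
qed

lemma momenta_div_phase_section:
  assumes F: "smooth_sub_valued B k F" and f: "f \<in> sections B"
    and e: "e \<in> adapted_charts B" "f x \<in> fst (snd e)" and len: "length \<mu>s \<le> k"
  defines "u \<equiv> snd (fst e) x"
  shows "momenta_div B k e (phase_section B k F f) \<mu>s A u =
    (\<Sum>\<kappa>\<in>UNIV. partial \<kappa> (\<lambda>u. dphi_indep (mset \<mu>s) A (\<lambda>z. sub_local B k F e z $ \<kappa>) (prolongation k e f u)) u)
      / orderings (mset \<mu>s)"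
proof -
  let ?S = "snd (fst e) ` {x. f x \<in> fst (snd e)}" and ?o = "orderings (mset \<mu>s)"
  note S = section_image[OF B f e(1)]
  have u: "u \<in> ?S" using e by (auto simp: u_def)
  have "partial \<kappa> (\<lambda>u. momenta B k e (phase_section B k F f (chart_inv (fst e) u)) (mset \<mu>s) A \<kappa>) u =
      partial \<kappa> (\<lambda>u. dphi_indep (mset \<mu>s) A (\<lambda>z. sub_local B k F e z $ \<kappa>) (prolongation k e f u)) u / ?o" for \<kappa>
  proof -
    let ?G = "dphi_indep (mset \<mu>s) A (\<lambda>z. sub_local B k F e z $ \<kappa>)"
    have "momenta B k e (phase_section B k F f (chart_inv (fst e) u)) (mset \<mu>s) A \<kappa> =
        ?G (prolongation k e f u) / ?o" if "u \<in> ?S" for u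
      using S(2)[OF that] prolongation_eq[OF B f e(1), of "chart_inv (fst e) u" k] len
      by (simp add: momenta_phase_section[OF B F f e(1)] divergence_momenta_def)
    then have "partial \<kappa> (\<lambda>u. momenta B k e (phase_section B k F f (chart_inv (fst e) u)) (mset \<mu>s) A \<kappa>) u =
        partial \<kappa> (\<lambda>u. ?G (prolongation k e f u) / ?o) u"
      by (rule partial_cong_open[OF S(1) u])
    also have "\<dots> = partial \<kappa> (\<lambda>u. ?G (prolongation k e f u)) u / ?o"
    proof (rule partial_linear_compose[OF bounded_linear_divide])
      show "smooth_at u (\<lambda>u. ?G (prolongation k e f u))"
        by (rule smooth_atI[OF S(1) u smooth_on_prolongation[OF B f e(1) sub_local_deriv_smooth[OF B F e(1)]]])
          (use len in simp)
    qed
    finally show ?thesis .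
  qed
  then show ?thesis by (simp add: momenta_div_def sum_divide_distrib)
qed

lemma phase_section_EL:
  assumes F: "smooth_sub_valued B k F" and L: "is_total_divergence B k F L" and f: "f \<in> sections B"
  shows "EL_solution B (Suc k) L (phase_section B k F f)"
proof -
  let ?\<sigma> = "phase_section B k F f"
  have EL: "(\<forall>\<mu>s A. length \<mu>s = Suc k \<longrightarrow> symmetrise P \<mu>s A = dL \<mu>s A) \<and>
      (\<forall>\<mu>s A. 1 \<le> length \<mu>s \<and> length \<mu>s \<le> k \<longrightarrow> symmetrise P \<mu>s A = dL \<mu>s A - divP \<mu>s A) \<and>
      (\<forall>A. 0 = dL [] A - divP [] A)"
    if e: "e \<in> adapted_charts B" "f x \<in> fst (snd e)" and P: "P = momenta B k e (?\<sigma> x)"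
      and divP: "divP = (\<lambda>\<mu>s A. momenta_div B k e ?\<sigma> \<mu>s A (snd (fst e) x))"
      and dL: "dL = (\<lambda>\<mu>s A. dphi \<mu>s A (top_local B (Suc k) L e) (jet_coords (Suc k) e (jet B (Suc k) x f)))"
    for e x P divP dL
  proof -
    define H where "H A \<kappa> M = dphi_indep M A (\<lambda>z. sub_local B k F e z $ \<kappa>) (prolongation k e f (snd (fst e) x))"
      for A \<kappa> M
    \<comment> \<open>The common value of both sides: \<open>symmetrise\<close> gives it for
      nonempty lists, and the derivative of the Lagrangian minus the divergence gives it up to
      length \<open>k\<close>. For the empty list it is zero, which is the equation of order
      zero.\<close>
    define R where "R \<mu>s A = (\<Sum>\<kappa>\<in>UNIV. if \<kappa> \<in># mset \<mu>s then H A \<kappa> (mset \<mu>s - {#\<kappa>#}) else 0) / orderings (mset \<mu>s)"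
      for \<mu>s A
    have sym: "symmetrise P \<mu>s A = R \<mu>s A" if "\<mu>s \<noteq> []" "length \<mu>s \<le> Suc k" for \<mu>s A
      unfolding R_def
    proof (rule symmetrise_momenta[OF that(1)])
      show "P M A \<kappa> = H A \<kappa> M / orderings M" if "Suc (size M) = length \<mu>s" for M \<kappa>
        using that \<open>length \<mu>s \<le> Suc k\<close>
        by (simp add: P momenta_phase_section[OF B F f e] divergence_momenta_def H_def prolongation_eq[OF B f e])
    qed
    have low: "dL \<mu>s A - divP \<mu>s A = R \<mu>s A" if "length \<mu>s \<le> k" for \<mu>s A
      unfolding dL divP R_def H_def
      using that dphi_top_local[OF F L f e, where \<mu>s = \<mu>s and A = A] momenta_div_phase_section[OF F f e that, where A = A]
      by (simp add: sum.distrib diff_divide_distrib[symmetric])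
    \<comment> \<open>At length \<open>Suc k\<close> the derivative of the Lagrangian contains no
      divergence term, so the highest equation has the symmetrised momentum alone.\<close>
    have top: "dL \<mu>s A = R \<mu>s A" if "length \<mu>s = Suc k" for \<mu>s A
      unfolding dL R_def H_def
      using that dphi_top_local[OF F L f e, where \<mu>s = \<mu>s and A = A] by simp
    have "R [] A = 0" for A by (simp add: R_def)
    moreover have "symmetrise P \<mu>s A = dL \<mu>s A" if "length \<mu>s = Suc k" for \<mu>s A
    proof -
      have "\<mu>s \<noteq> []" using that by auto
      then show ?thesis using that by (simp add: sym top)
    qed
    moreover have "symmetrise P \<mu>s A = dL \<mu>s A - divP \<mu>s A" if "1 \<le> length \<mu>s" "length \<mu>s \<le> k" for \<mu>s A
    proof -
      have "\<mu>s \<noteq> []" using that by auto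
      then show ?thesis using that by (simp add: sym low)
    qed
    ultimately show ?thesis using low[of "[]"] by simp
  qed
  show ?thesis
    unfolding EL_solution_def Let_def diff_Suc_1
  proof (intro conjI bexI[OF _ f] allI ballI impI)
    show "?\<sigma> \<in> phase_sections B k" by (rule phase_section_in_phase_sections[OF B F f])
    show "fst (?\<sigma> x) = jet B k x f" for x by (simp add: phase_section_def)
  qed (use EL[OF _ _ refl refl refl] in blast)+
qed

end

theorem theorem5:
  fixes B :: "('m::{t2_space,second_countable_topology}, 'e::{t2_space,second_countable_topology},
               'q::{t2_space,second_countable_topology}, 'n::{finite,linorder}, 'k::finite) fbundle"
    and l :: nat
    and F L\<^sub>0 :: "('m, 'e) jet \<Rightarrow> ('m, (real, 'n) vec) form"
  assumes "smooth_fibre_bundle B"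
    and "l \<ge> 1"
    and "smooth_sub_valued B (l - 1) F"
    and "is_total_divergence B (l - 1) F L\<^sub>0"
  shows "\<exists>\<sigma>.
    (\<forall>f\<in>sections B.
       \<sigma> f \<in> phase_sections B (l - 1) \<and>
       (\<forall>x. fst (\<sigma> f x) = jet B (l - 1) x f) \<and>
       momenta_given_by B (l - 1) F (\<sigma> f) \<and>
       EL_solution B l L\<^sub>0 (\<sigma> f) \<and>
       (\<forall>\<tau>\<in>phase_sections B (l - 1).
          (\<forall>x. fst (\<tau> x) = jet B (l - 1) x f) \<and> momenta_given_by B (l - 1) F \<tau> \<longrightarrow> \<tau> = \<sigma> f)) \<and>
    bij_betw \<sigma> (sections B) {\<tau>. EL_solution B l L\<^sub>0 \<tau> \<and> momenta_given_by B (l - 1) F \<tau>}"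
proof -
  note B = assms(1) and F = assms(3) and L = assms(4)
  let ?k = "l - 1"
  have l: "l = Suc ?k" using assms(2) by simp
  define \<sigma> where "\<sigma> = phase_section B ?k F"
  have jet: "fst (\<sigma> f x) = jet B ?k x f" for f x
    by (simp add: \<sigma>_def phase_section_def)
  have EL: "EL_solution B l L\<^sub>0 (\<sigma> f)" if "f \<in> sections B" for f
    using phase_section_EL[OF B F L that] l by (simp add: \<sigma>_def)
  have given: "momenta_given_by B ?k F (\<sigma> f)" if "f \<in> sections B" for f
    using phase_section_momenta_given_by[OF B F that] by (simp add: \<sigma>_def)
  have unique: "\<tau> = \<sigma> f"
    if "f \<in> sections B" "\<tau> \<in> phase_sections B ?k" "\<And>x. fst (\<tau> x) = jet B ?k x f" "momenta_given_by B ?k F \<tau>" for f \<tau>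
    using phase_section_unique[OF B F that] by (simp add: \<sigma>_def)
  have "inj_on \<sigma> (sections B)"
  proof (rule inj_onI)
    fix f g assume fg: "f \<in> sections B" "g \<in> sections B" "\<sigma> f = \<sigma> g"
    show "f = g"
    proof
      fix x
      \<comment> \<open>The target of the jet at \<open>x\<close> is \<open>f x\<close>, so a
        section can be read off from its phase section.\<close>
      have "jet B ?k x f = jet B ?k x g" using jet fg(3) by metis
      then show "f x = g x"
        using jet_target_jet[OF B section_local[OF B fg(1)]] jet_target_jet[OF B section_local[OF B fg(2)]] by metis
    qed
  qed
  \<comment> \<open>The section underlying a solution is part of \<open>EL_solution\<close>; with
    the momenta prescribed, uniqueness identifies the solution with
    \<open>\<sigma> f\<close>.\<close>
  moreover have "\<tau> \<in> \<sigma> ` sections B" if \<tau>: "EL_solution B l L\<^sub>0 \<tau>" "momenta_given_by B ?k F \<tau>" for \<tau>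
  proof -
    obtain f where "f \<in> sections B" "\<And>x. fst (\<tau> x) = jet B ?k x f" "\<tau> \<in> phase_sections B ?k"
      using \<tau>(1) unfolding EL_solution_def by blast
    then have "\<tau> = \<sigma> f" by (intro unique \<tau>(2))
    then show ?thesis using \<open>f \<in> sections B\<close> by blast
  qed
  ultimately have "bij_betw \<sigma> (sections B) {\<tau>. EL_solution B l L\<^sub>0 \<tau> \<and> momenta_given_by B ?k F \<tau>}"
    using EL given by (auto simp: bij_betw_def)
  moreover have "\<sigma> f \<in> phase_sections B ?k" if "f \<in> sections B" for f
    using phase_section_in_phase_sections[OF B F that] by (simp add: \<sigma>_def)
  ultimately show ?thesis
    using jet EL given unique by (intro exI[of _ \<sigma>]) blast
qed

end
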